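(* Let $\mu$ be a $(C,\alpha)$-Ahlfors regular measure on $\mathbb R$ with radius parameter $\rho_0$, let $U\subset\mathbb R$ be an open interval with $U\cap\operatorname{supp}\mu\ne\emptyset$, and let $\varphi=(\varphi_1,\dots,\varphi_n):U\to\mathbb R^n$ be a nondegenerate analytic map. Let $x_0\in\operatorname{supp}\mu\cap U$ and let $I_0\subset U$ be a closed interval centred at $x_0$ such that $3^{n+1}I_0\subset U$, $3|I_0|\le\rho_0$ and $\varphi(x)=(x,\varphi_2(x),\dots,\varphi_n(x))$ for all $x\in3^{n+1}I_0$. Then, provided $I_0$ is sufficiently small (i.e. there is a neighbourhood $V$ of $x_0$ such that the following holds whenever $I_0\subset V$), there exist constants $M_1>0$ and $\gamma>0$ such that for any $\delta>0$, any $\tau=(\tau_1,\dots,\tau_{n+1})\in\mathbb R^{n+1}$ with $\tau_1+\dots+\tau_{n+1}=0$, any $0\le\rho\le1$ and any subinterval $J\subset I_0$, at least one of the following holds: (1) $\mu(W(\tau,J,\delta))\le M_1(\delta/\rho)^\gamma\mu(3J)$; (2) there exist $1\le i\le n$ and $\mathbf v=\mathbf v_1\wedge\cdots\wedge\mathbf v_i\in\bigwedge^i(\mathbb Z^{n+1})\setminus\{\mathbf 0\}$ such that $\sup_{x\in J}\|g_\tau z(x)u(\varphi(x))\mathbf v\|<\rho$.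
   Context: $\mu$ is $(C,\alpha)$-Ahlfors regular ($C>1,\alpha>0$) with parameter $\rho_0>0$ if $C^{-1}\rho^\alpha\le\mu(B(x,\rho))\le C\rho^\alpha$ for all $x\in\operatorname{supp}\mu$ and $0<\rho\le\rho_0$. Nondegenerate: $1,\varphi_1,\dots,\varphi_n$ linearly independent over $\mathbb R$. For an interval $I$ and $\lambda>0$, $\lambda I$ is the interval with the same centre and length $\lambda|I|$. For $\mathbf x\in\mathbb R^n$ (a row), $u(\mathbf x)=\begin{bmatrix}1&\mathbf x\\0&I_n\end{bmatrix}\in\mathrm{SL}_{n+1}(\mathbb R)$. For $\mathbf y=(y_2,\dots,y_n)\in\mathbb R^{n-1}$, $u_1(\mathbf y)$ is the $(n+1)\times(n+1)$ identity matrix with the entries $y_2,\dots,y_n$ placed in row 2, columns $3,\dots,n+1$. $\psi(x)=(\varphi_2'(x),\dots,\varphi_n'(x))$ and $z(x)=u_1(\psi(x))$. $g_\tau=\mathrm{diag}(e^{\tau_1},\dots,e^{\tau_{n+1}})$. For $\epsilon>0$, $K_\epsilon$ is the set of unimodular lattices $\Lambda\subset\mathbb R^{n+1}$ with $\|\mathbf v\|\ge\epsilon$ for all nonzero $\mathbf v\in\Lambda$. $W(\tau,J,\delta)=\{x\in J: g_\tau z(x)u(\varphi(x))\mathbb Z^{n+1}\notin K_\delta\}$. $\|\cdot\|$ is the Euclidean norm; on $\bigwedge^i(\mathbb R^{n+1})$ it is the norm for which $\{\mathbf e_{j_1}\wedge\cdots\wedge\mathbf e_{j_i}:j_1<\dots<j_i\}$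 is orthonormal, and a matrix $L$ acts by $L(\mathbf v_1\wedge\cdots\wedge\mathbf v_i)=L\mathbf v_1\wedge\cdots\wedge L\mathbf v_i$. *)

theory Defs
  imports
    "HOL-Analysis.Analysis"
    "Jordan_Normal_Form.Determinant"
    "Jordan_Normal_Form.DL_Submatrix"
begin

text \<open>
  Vectors and matrices are those of \<open>Jordan_Normal_Form.Matrix\<close>, because $\mathbb{R}^n$ and
  $\mathbb{R}^{n+1}$ occur side by side and the order of the coordinates matters. Indices are
  shifted by one: $\varphi_k$ is \<open>\<phi> x $ (k - 1)\<close> and $\tau_k$ is \<open>\<tau> $ (k - 1)\<close>.
\<close>

hide_const (open) Finite_Cartesian_Product.mat Finite_Cartesian_Product.vec
  Determinants.det Finite_Cartesian_Product.row Finite_Cartesian_Product.column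
unbundle no vec_syntax

section \<open>Measures, intervals and maps on the line\<close>

definition measure_support :: "real measure \<Rightarrow> real set" where
  "measure_support \<mu> = {x. \<forall>S. open S \<longrightarrow> x \<in> S \<longrightarrow> emeasure \<mu> S > 0}"

definition ahlfors_regular :: "real \<Rightarrow> real \<Rightarrow> real \<Rightarrow> real measure \<Rightarrow> bool" where
  "ahlfors_regular C \<alpha> \<rho>\<^sub>0 \<mu> \<longleftrightarrow>
     C > 1 \<and> \<alpha> > 0 \<and> \<rho>\<^sub>0 > 0 \<and> sets \<mu> = sets borel \<and>
     (\<forall>x\<in>measure_support \<mu>. \<forall>\<rho>. 0 < \<rho> \<and> \<rho> \<le> \<rho>\<^sub>0 \<longrightarrow>
        ennreal (inverse C * \<rho> powr \<alpha>) \<le> emeasure \<mu> (ball x \<rho>) \<and>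
        emeasure \<mu> (ball x \<rho>) \<le> ennreal (C * \<rho> powr \<alpha>))"

text \<open>For a nonempty bounded interval \<open>I\<close>: the interval of the same kind (open, closed, half-open)
  with the same centre and length \<open>c\<close> times that of \<open>I\<close>.\<close>

definition dilate :: "real \<Rightarrow> real set \<Rightarrow> real set" where
  "dilate c I = (let m = (Inf I + Sup I) / 2 in (\<lambda>x. m + c * (x - m)) ` I)"

text \<open>The library's \<open>analytic_on\<close> concerns complex functions only.\<close>

definition real_analytic_on :: "(real \<Rightarrow> real) \<Rightarrow> real set \<Rightarrow> bool" where
  "real_analytic_on f U \<longleftrightarrow>
     (\<forall>x\<in>U. \<exists>r>0. \<exists>a. \<forall>y\<in>ball x r \<inter> U. (\<lambda>k. a k * (y - x) ^ k) sums f y)"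

definition analytic_map :: "nat \<Rightarrow> (real \<Rightarrow> real vec) \<Rightarrow> real set \<Rightarrow> bool" where
  "analytic_map n \<phi> U \<longleftrightarrow>
     (\<forall>x\<in>U. \<phi> x \<in> carrier_vec n) \<and> (\<forall>k<n. real_analytic_on (\<lambda>x. \<phi> x $ k) U)"

definition nondegenerate :: "nat \<Rightarrow> (real \<Rightarrow> real vec) \<Rightarrow> real set \<Rightarrow> bool" where
  "nondegenerate n \<phi> U \<longleftrightarrow>
     (\<forall>c\<^sub>0. \<forall>c::nat \<Rightarrow> real. (\<forall>x\<in>U. c\<^sub>0 * 1 + (\<Sum>k<n. c k * \<phi> x $ k) = 0) \<longrightarrow>
        c\<^sub>0 = 0 \<and> (\<forall>k<n. c k = 0))"

section \<open>The matrices\<close>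

definition u_mat :: "real vec \<Rightarrow> real mat" where
  "u_mat x = (let n = dim_vec x in
     four_block_mat (1\<^sub>m 1) (mat_of_rows n [x]) (0\<^sub>m n 1) (1\<^sub>m n))"

text \<open>\<open>y $ 0, \<dots>, y $ (n - 2)\<close> are the $y_2, \dots, y_n$ of $\mathbf{y}$.\<close>

definition u1_mat :: "real vec \<Rightarrow> real mat" where
  "u1_mat y = Matrix.mat (dim_vec y + 2) (dim_vec y + 2)
     (\<lambda>(i, j). if i = 1 \<and> 2 \<le> j then y $ (j - 2) else if i = j then 1 else 0)"

definition psi :: "nat \<Rightarrow> (real \<Rightarrow> real vec) \<Rightarrow> real \<Rightarrow> real vec" where
  "psi n \<phi> x = Matrix.vec (n - 1) (\<lambda>k. deriv (\<lambda>t. \<phi> t $ (k + 1)) x)"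

definition z_mat :: "nat \<Rightarrow> (real \<Rightarrow> real vec) \<Rightarrow> real \<Rightarrow> real mat" where
  "z_mat n \<phi> x = u1_mat (psi n \<phi> x)"

definition g_mat :: "real vec \<Rightarrow> real mat" where
  "g_mat \<tau> = mat_diag (dim_vec \<tau>) (\<lambda>i. exp (\<tau> $ i))"

definition gzu :: "nat \<Rightarrow> (real \<Rightarrow> real vec) \<Rightarrow> real vec \<Rightarrow> real \<Rightarrow> real mat" where
  "gzu n \<phi> \<tau> x = g_mat \<tau> * z_mat n \<phi> x * u_mat (\<phi> x)"

section \<open>Lattices\<close>

definition vec_norm2 :: "real vec \<Rightarrow> real" where
  "vec_norm2 v = sqrt (scalar_prod v v)"

definition int_lattice :: "nat \<Rightarrow> real vec set" where
  "int_lattice m = {v \<in> carrier_vec m. \<forall>i<m. v $ i \<in> \<int>}"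

definition unimodular_lattices :: "nat \<Rightarrow> real vec set set" where
  "unimodular_lattices m =
     {(\<lambda>v. L *\<^sub>v v) ` int_lattice m | L. L \<in> carrier_mat m m \<and> \<bar>Determinant.det L\<bar> = 1}"

definition K_set :: "nat \<Rightarrow> real \<Rightarrow> real vec set set" where
  "K_set m \<epsilon> = {\<Lambda> \<in> unimodular_lattices m. \<forall>v\<in>\<Lambda>. v \<noteq> 0\<^sub>v m \<longrightarrow> vec_norm2 v \<ge> \<epsilon>}"

definition W_set ::
  "nat \<Rightarrow> (real \<Rightarrow> real vec) \<Rightarrow> real vec \<Rightarrow> real set \<Rightarrow> real \<Rightarrow> real set" where
  "W_set n \<phi> \<tau> J \<delta> =
     {x \<in> J. (\<lambda>v. gzu n \<phi> \<tau> x *\<^sub>v v) ` int_lattice (n + 1) \<notin> K_set (n + 1) \<delta>}"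

section \<open>Exterior powers\<close>

text \<open>
  An element of $\bigwedge^i(\mathbb{R}^m)$ is represented by its coordinates in the basis of the
  $\mathbf{e}_{j_1} \wedge \dots \wedge \mathbf{e}_{j_i}$, $j_1 < \dots < j_i$, indexed by the sets
  \<open>{j\<^sub>1, \<dots>, j\<^sub>i} \<subseteq> {..<m}\<close>; it vanishes on all other sets. The coordinates of
  $\mathbf{v}_1 \wedge \dots \wedge \mathbf{v}_i$ are the $i \times i$ minors of the matrix with
  columns $\mathbf{v}_1, \dots, \mathbf{v}_i$.
\<close>

definition ext_index :: "nat \<Rightarrow> nat \<Rightarrow> nat set set" where
  "ext_index m i = {S. S \<subseteq> {..<m} \<and> card S = i}"

definition wedge :: "nat \<Rightarrow> real vec list \<Rightarrow> nat set \<Rightarrow> real" where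
  "wedge m vs S =
     (if S \<in> ext_index m (length vs)
      then Determinant.det (submatrix (mat_of_cols m vs) S UNIV) else 0)"

definition ext_norm :: "nat \<Rightarrow> nat \<Rightarrow> (nat set \<Rightarrow> real) \<Rightarrow> real" where
  "ext_norm m i w = sqrt (\<Sum>S\<in>ext_index m i. (w S)\<^sup>2)"

text \<open>$L(\mathbf{v}_1 \wedge \dots \wedge \mathbf{v}_i)$ for an $m \times m$ matrix $L$. It depends only on
  $\mathbf{v}_1 \wedge \dots \wedge \mathbf{v}_i$, since by Cauchy--Binet its coordinates are linear
  in those of $\mathbf{v}_1 \wedge \dots \wedge \mathbf{v}_i$.\<close>

definition act_wedge :: "nat \<Rightarrow> real mat \<Rightarrow> real vec list \<Rightarrow> nat set \<Rightarrow> real" where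
  "act_wedge m L vs = wedge m (map (\<lambda>v. L *\<^sub>v v) vs)"

section \<open>The measure bound\<close>

text \<open>$(\delta/\rho)^\gamma$ for $\delta, \gamma > 0$ and $\rho \ge 0$, with $\delta/0 = \infty$
  (whereas \<open>\<delta> / 0 = 0\<close> in \<open>real\<close>).\<close>

definition ratio_powr :: "real \<Rightarrow> real \<Rightarrow> real \<Rightarrow> ennreal" where
  "ratio_powr \<delta> \<rho> \<gamma> = (if \<rho> = 0 then \<infinity> else ennreal ((\<delta> / \<rho>) powr \<gamma>))"

end

theory Submission
  imports Defs
begin

text \<open>
  The argument is due to Kleinbock and Margulis. If \<open>g\<^sub>\<tau> z(x) u(\<phi>(x)) \<int>\<^bsup>n+1\<^esup>\<close> has a short vector, no flag of
  primitive subgroups of \<open>\<int>\<^bsup>n+1\<^esup>\<close> can mark \<open>x\<close>, in the sense that the members of the flag have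
  covolumes in \<open>[\<epsilon>, \<rho>]\<close> and all further subgroups compatible with it have covolume at least \<open>\<rho>\<close>.
  The measure of the unmarked points is bounded by induction on the length of flags and a covering
  argument, provided that for each subgroup the set where its covolume is below \<open>\<epsilon>\<close> is small in
  every interval on which the covolume reaches \<open>\<rho>\<close>. The coordinates of the wedge products are linear
  combinations of finitely many analytic functions, whatever \<open>\<tau>\<close> and the subgroup. By compactness
  every such combination has near \<open>x\<^sub>0\<close> a derivative of bounded order and almost constant size, which
  forces its sublevel sets into boundedly many short intervals. For those, Ahlfors regularity
  applies.
\<close>

section \<open>Germs of power series\<close>

text \<open>Infinitely many subgroups compete, so bounds for single subgroups cannot be summed. A
  flag singles out one subgroup near each point; once it is fixed, only subgroups comparable with it
  matter, and their chains are shorter by one. Hence at most \<open>n\<close> rounds occur. Each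
  round may enlarge the interval by the factor 5, which is the origin of the powers
  \<open>5 ^ n\<close> and of the smallness of the interval around the centre.

  Uniformity holds because \<tau> only multiplies the rows by constants and a subgroup only
  contributes constant coefficients: all minors of order at most \<open>n\<close> lie in the span of
  the products of at most \<open>n\<close> entries of z(x)u(\<phi>(x)).

  If \<open>K\<close> bounds the order of the controlled derivative, a sublevel set of relative
  height \<open>q\<close> is covered by fewer than \<open>2 ^ K\<close> intervals of relative length
  \<open>q powr (1 / (K + 1))\<close>. This gives the exponent \<gamma> = \<alpha>/(K+1).

  Subgroups are represented by integral matrices whose columns form a basis. Covolumes are then
  norms of vectors of minors, and inclusion is tested on real column spaces.\<close>

definition power_series_at :: "(real \<Rightarrow> real) \<Rightarrow> real \<Rightarrow> bool" where
  "power_series_at f x0 \<longleftrightarrow>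
     (\<exists>r>0. \<exists>a. \<forall>h. \<bar>h\<bar> < r \<longrightarrow> (\<lambda>k. a k * h ^ k) sums f (x0 + h))"

lemma power_series_atI:
  assumes "r > 0" "\<And>h. \<bar>h\<bar> < r \<Longrightarrow> (\<lambda>k. a k * h ^ k) sums f (x0 + h)"
  shows "power_series_at f x0"
  using assms unfolding power_series_at_def by blast

lemma power_series_at_const: "power_series_at (\<lambda>x. c) x0"
  unfolding power_series_at_def
proof (intro exI[of _ 1] conjI exI[of _ "\<lambda>k. if k = 0 then c else 0"] allI impI)
  fix h :: real
  have "(\<lambda>k. (if k = 0 then c else 0) * h ^ k) = (\<lambda>k. if k = 0 then c else 0)"
    by (auto simp: fun_eq_iff)
  then show "(\<lambda>k. (if k = 0 then c else 0) * h ^ k) sums c"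
    using sums_single[of 0 "\<lambda>_. c"] by simp
qed simp

lemma power_series_at_add:
  assumes "power_series_at f x0" "power_series_at g x0"
  shows "power_series_at (\<lambda>x. f x + g x) x0"
proof -
  obtain r a where r: "r > 0" and a: "\<And>h. \<bar>h\<bar> < r \<Longrightarrow> (\<lambda>k. a k * h ^ k) sums f (x0 + h)"
    using assms(1) unfolding power_series_at_def by blast
  obtain s b where s: "s > 0" and b: "\<And>h. \<bar>h\<bar> < s \<Longrightarrow> (\<lambda>k. b k * h ^ k) sums g (x0 + h)"
    using assms(2) unfolding power_series_at_def by blast
  have H: "(\<lambda>k. (a k + b k) * h ^ k) sums (f (x0 + h) + g (x0 + h))" if "\<bar>h\<bar> < min r s" for h
    using sums_add[OF a b, of h h] that by (simp add: distrib_right)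
  from r s have "min r s > 0" by simp
  then show ?thesis by (rule power_series_atI) (rule H)
qed

text \<open>The Cauchy product needs absolute convergence, which \<open>abs_sums\<close> draws from
  convergence at the intermediate point \<open>(\<bar>h\<bar> + r) / 2\<close>.\<close>

lemma power_series_at_mult:
  assumes "power_series_at f x0" "power_series_at g x0"
  shows "power_series_at (\<lambda>x. f x * g x) x0"
proof -
  have abs_sums: "summable (\<lambda>k. norm (a k * h ^ k))"
    if "\<And>h. \<bar>h\<bar> < r \<Longrightarrow> (\<lambda>k. a k * h ^ k) sums F (x0 + h)" "\<bar>h\<bar> < r"
    for a :: "nat \<Rightarrow> real" and F r h
  proof -
    have "\<bar>(\<bar>h\<bar> + r) / 2\<bar> < r" and h: "\<bar>h\<bar> < \<bar>(\<bar>h\<bar> + r) / 2\<bar>"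
      using that(2) by (auto simp: field_simps)
    then have "summable (\<lambda>k. a k * ((\<bar>h\<bar> + r) / 2) ^ k)"
      using that(1) sums_summable by blast
    from powser_insidea[OF this] h show ?thesis by simp
  qed
  obtain r a where r: "r > 0" and a: "\<And>h. \<bar>h\<bar> < r \<Longrightarrow> (\<lambda>k. a k * h ^ k) sums f (x0 + h)"
    using assms(1) unfolding power_series_at_def by blast
  obtain s b where s: "s > 0" and b: "\<And>h. \<bar>h\<bar> < s \<Longrightarrow> (\<lambda>k. b k * h ^ k) sums g (x0 + h)"
    using assms(2) unfolding power_series_at_def by blast
  have H: "(\<lambda>k. (\<Sum>i\<le>k. a i * b (k - i)) * h ^ k) sums (f (x0 + h) * g (x0 + h))"
    if h: "\<bar>h\<bar> < min r s" for h
  proof -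
    have "(\<lambda>k. \<Sum>i\<le>k. (a i * h ^ i) * (b (k - i) * h ^ (k - i)))
       sums ((\<Sum>k. a k * h ^ k) * (\<Sum>k. b k * h ^ k))"
      using h by (intro Cauchy_product_sums abs_sums[of r a f] abs_sums[of s b g] a b) auto
    moreover have "(\<Sum>i\<le>k. (a i * h ^ i) * (b (k - i) * h ^ (k - i)))
        = (\<Sum>i\<le>k. a i * b (k - i)) * h ^ k" for k
      by (auto simp: sum_distrib_right power_add[symmetric] intro!: sum.cong)
    ultimately show ?thesis
      using sums_unique[OF a, of h] sums_unique[OF b, of h] h by simp
  qed
  from r s have "min r s > 0" by simp
  then show ?thesis by (rule power_series_atI) (rule H)
qed

lemma power_series_at_sum:
  assumes "\<And>i. i \<in> A \<Longrightarrow> power_series_at (f i) x0"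
  shows "power_series_at (\<lambda>x. \<Sum>i\<in>A. f i x) x0"
  using assms
  by (induction A rule: infinite_finite_induct)
     (auto intro: power_series_at_const power_series_at_add)

lemma power_series_at_cong:
  assumes "power_series_at f x0" "r > 0" "\<And>x. x \<in> ball x0 r \<Longrightarrow> f x = g x"
  shows "power_series_at g x0"
proof -
  obtain s a where s: "s > 0" and a: "\<And>h. \<bar>h\<bar> < s \<Longrightarrow> (\<lambda>k. a k * h ^ k) sums f (x0 + h)"
    using assms(1) unfolding power_series_at_def by blast
  have H: "(\<lambda>k. a k * h ^ k) sums g (x0 + h)" if "\<bar>h\<bar> < min r s" for h
    using a[of h] assms(3)[of "x0 + h"] that by (simp add: dist_real_def)
  from s assms(2) have "min r s > 0" by simp
  then show ?thesis by (rule power_series_atI) (rule H)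
qed

text \<open>Iterated \<open>diffs\<close> gives the coefficients of the termwise derivatives. At
  \<open>n = 0\<close> this identifies the derivative of order \<open>k\<close> at the centre as
  \<open>fact k * a k\<close>.\<close>

lemma diffs_funpow: "(diffs ^^ k) a n * fact n = fact (n + k) * (a (n + k) :: real)"
proof (induction k arbitrary: n)
  case (Suc k)
  have "(diffs ^^ Suc k) a n * fact n = (diffs ^^ k) a (Suc n) * fact (Suc n)"
    by (simp add: diffs_def algebra_simps)
  then show ?case using Suc.IH[of "Suc n"] by simp
qed simp

text \<open>One radius serves all derivatives, because termwise differentiation does not shrink the
  interval of convergence. The family \<open>D\<close> carries the derivatives explicitly, in place
  of iterated \<open>deriv\<close>.\<close>

definition taylor_data ::
  "(real \<Rightarrow> real) \<Rightarrow> real \<Rightarrow> real \<Rightarrow> (nat \<Rightarrow> real) \<Rightarrow> (nat \<Rightarrow> real \<Rightarrow> real) \<Rightarrow> bool" where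
  "taylor_data f x0 r a D \<longleftrightarrow> r > 0 \<and>
     (\<forall>y\<in>ball x0 r. (\<lambda>k. a k * (y - x0) ^ k) sums f y \<and> D 0 y = f y) \<and>
     (\<forall>k. power_series_at (D k) x0 \<and> D k x0 = fact k * a k \<and>
        (\<forall>y\<in>ball x0 r. (D k has_field_derivative D (Suc k) y) (at y)))"

lemma power_series_at_imp_taylor_data:
  assumes "power_series_at f x0"
  obtains r a D where "taylor_data f x0 r a D"
proof -
  obtain r a where r: "r > 0" and a: "\<And>h. \<bar>h\<bar> < r \<Longrightarrow> (\<lambda>k. a k * h ^ k) sums f (x0 + h)"
    using assms(1) unfolding power_series_at_def by blast
  define D where "D k y = (\<Sum>n. (diffs ^^ k) a n * (y - x0) ^ n)" for k y
  have sm: "summable (\<lambda>n. (diffs ^^ k) a n * h ^ n)" if "\<bar>h\<bar> < r" for k h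
    using that
  proof (induction k arbitrary: h)
    case (Suc k)
    then show ?case using termdiff_converges[of h r "(diffs ^^ k) a"] by simp
  qed (use a sums_summable in auto)
  have "power_series_at (D k) x0" for k
    unfolding power_series_at_def D_def using r sm
    by (intro exI[of _ r] conjI exI[of _ "(diffs ^^ k) a"]) (auto simp: summable_sums)
  moreover have "D k x0 = fact k * a k" for k
    using diffs_funpow[of k a 0] powser_zero[of "(diffs ^^ k) a"] by (simp add: D_def)
  moreover have sums: "(\<lambda>k. a k * (y - x0) ^ k) sums f y" if "y \<in> ball x0 r" for y
    using a[of "y - x0"] that by (simp add: dist_real_def abs_minus_commute)
  moreover have "D 0 y = f y" if "y \<in> ball x0 r" for y
    using sums_unique[OF sums[OF that]] by (simp add: D_def)
  moreover have "(D k has_field_derivative D (Suc k) y) (at y)" if "y \<in> ball x0 r" for k y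
  proof -
    have "((\<lambda>h. \<Sum>n. (diffs ^^ k) a n * h ^ n) has_field_derivative
        (\<Sum>n. diffs ((diffs ^^ k) a) n * (y - x0) ^ n)) (at (y - x0))"
      using that sm by (intro termdiffs_strong'[of r]) (auto simp: dist_real_def)
    then have "((\<lambda>h. \<Sum>n. (diffs ^^ k) a n * h ^ n) has_field_derivative
        (\<Sum>n. diffs ((diffs ^^ k) a) n * (y - x0) ^ n)) (at (y + - x0))"
      by simp
    from DERIV_shift[THEN iffD1, OF this] show ?thesis by (simp add: D_def[abs_def])
  qed
  ultimately have "taylor_data f x0 r a D" using r unfolding taylor_data_def by blast
  then show thesis by (rule that)
qed

lemma power_series_at_deriv:
  assumes "power_series_at f x0" shows "power_series_at (deriv f) x0"
proof -
  obtain r a D where r: "r > 0" and D: "power_series_at (D (Suc 0)) x0"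
    "\<And>y. y \<in> ball x0 r \<Longrightarrow> D 0 y = f y"
    "\<And>y. y \<in> ball x0 r \<Longrightarrow> (D 0 has_field_derivative D (Suc 0) y) (at y)"
    using power_series_at_imp_taylor_data[OF assms] unfolding taylor_data_def by metis
  have "D (Suc 0) y = deriv f y" if "y \<in> ball x0 r" for y
  proof -
    have "(f has_field_derivative D (Suc 0) y) (at y)"
      by (rule has_field_derivative_transform_within_open[OF D(3)[OF that] open_ball that])
         (rule D(2))
    then show ?thesis by (simp add: DERIV_imp_deriv)
  qed
  with D(1) r show ?thesis by (rule power_series_at_cong)
qed

lemma power_series_at_imp_continuous_on:
  assumes "power_series_at f x0"
  obtains r where "r > 0" "continuous_on (ball x0 r) f"
proof -
  obtain r a D where r: "r > 0" and D: "\<And>y. y \<in> ball x0 r \<Longrightarrow> D (0::nat) y = f y"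
    "\<And>y. y \<in> ball x0 r \<Longrightarrow> (D 0 has_field_derivative D (Suc 0) y) (at y)"
    using power_series_at_imp_taylor_data[OF assms] unfolding taylor_data_def by metis
  have "continuous_on (ball x0 r) (D 0)"
    using D(2) by (meson DERIV_isCont continuous_at_imp_continuous_on)
  then have "continuous_on (ball x0 r) f" using D(1) continuous_on_cong by blast
  with r show thesis by (rule that)
qed

section \<open>Compactness and uniform control of one derivative\<close>

lemma bounded_coeffs_convergent_subseq:
  fixes a :: "nat \<Rightarrow> 'b \<Rightarrow> real"
  assumes "finite B" "\<And>n b. b \<in> B \<Longrightarrow> \<bar>a n b\<bar> \<le> M"
  obtains r :: "nat \<Rightarrow> nat" where "strict_mono r" "\<And>b. b \<in> B \<Longrightarrow> convergent (\<lambda>n. a (r n) b)"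
proof -
  have "\<exists>r :: nat \<Rightarrow> nat. strict_mono r \<and> (\<forall>b\<in>B. convergent (\<lambda>n. a (r n) b))"
    using assms
  proof (induction B rule: finite_induct)
    case empty
    show ?case by (auto intro: exI[of _ id] strict_mono_id)
  next
    case (insert c B)
    then obtain r :: "nat \<Rightarrow> nat" where r: "strict_mono r" "\<And>b. b \<in> B \<Longrightarrow> convergent (\<lambda>n. a (r n) b)"
      by auto
    have "bounded (range (\<lambda>n. a (r n) c))"
      using insert.prems by (auto simp: bounded_iff)
    then obtain l s where s: "strict_mono (s::nat\<Rightarrow>nat)" "((\<lambda>n. a (r n) c) \<circ> s) \<longlonglongrightarrow> l"
      using bounded_imp_convergent_subsequence by blast
    have "convergent (\<lambda>n. a ((r \<circ> s) n) b)" if "b \<in> insert c B" for b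
    proof (cases "b = c")
      case True
      then show ?thesis using s(2) by (auto simp: convergent_def o_def)
    next
      case False
      then show ?thesis
        using convergent_subseq_convergent[OF r(2) s(1), of b] that by (simp add: o_def)
    qed
    with strict_mono_o[OF r(1) s(1)] show ?case by blast
  qed
  then show thesis using that by blast
qed

text \<open>The quantity \<open>(\<Sum>b\<in>B. \<bar>a b\<bar>)\<close> is a norm on the span of \<open>B\<close>; by compactness of its unit sphere
  some Taylor coefficient of order at most \<open>K\<close> dominates it.\<close>

lemma independent_germs_jet_lower_bound:
  fixes c :: "'b \<Rightarrow> nat \<Rightarrow> real"
  assumes "finite B"
    and indep: "\<And>a. (\<And>j. (\<Sum>b\<in>B. a b * c b j) = 0) \<Longrightarrow> (\<And>b. b \<in> B \<Longrightarrow> a b = 0)"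
  obtains K e where "e > 0"
    "\<And>a. \<exists>j\<le>K. e * (\<Sum>b\<in>B. \<bar>a b\<bar>) \<le> \<bar>\<Sum>b\<in>B. a b * c b j\<bar>"
proof (rule ccontr)
  assume no: "\<not> thesis"
  have "\<exists>a. \<forall>j\<le>n. \<bar>\<Sum>b\<in>B. a b * c b j\<bar> < (1 / real (Suc n)) * (\<Sum>b\<in>B. \<bar>a b\<bar>)" for n
  proof (rule ccontr)
    assume "\<not> ?thesis"
    then have "\<And>a. \<exists>j\<le>n. (1 / real (Suc n)) * (\<Sum>b\<in>B. \<bar>a b\<bar>) \<le> \<bar>\<Sum>b\<in>B. a b * c b j\<bar>"
      by (meson not_less)
    with no that[of "1 / real (Suc n)" n] show False by simp
  qed
  then obtain a where a: "\<And>n j. j \<le> n \<Longrightarrow>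
      \<bar>\<Sum>b\<in>B. a n b * c b j\<bar> < (1 / real (Suc n)) * (\<Sum>b\<in>B. \<bar>a n b\<bar>)"
    by metis
  define N where "N n = (\<Sum>b\<in>B. \<bar>a n b\<bar>)" for n
  have N: "N n > 0" for n
  proof -
    have "0 < (1 / real (Suc n)) * N n"
      using a[of 0 n] unfolding N_def by (meson abs_ge_zero le_less_trans le0)
    then show ?thesis by (simp add: zero_less_divide_iff del: of_nat_Suc)
  qed
  \<comment> \<open>After scaling to norm 1 a subsequence converges. Its limit still has norm 1, but
    all its Taylor coefficients vanish, which contradicts \<open>indep\<close>.\<close>
  define a' where "a' n b = a n b / N n" for n b
  have sum1: "(\<Sum>b\<in>B. \<bar>a' n b\<bar>) = 1" for n
    using N[of n] by (simp add: a'_def sum_divide_distrib[symmetric] N_def)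
  have small: "\<bar>\<Sum>b\<in>B. a' n b * c b j\<bar> < 1 / real (Suc n)" if "j \<le> n" for n j
  proof -
    have "(\<Sum>b\<in>B. a' n b * c b j) = (\<Sum>b\<in>B. a n b * c b j) / N n"
      by (simp add: a'_def sum_divide_distrib)
    then show ?thesis using a[OF that] N[of n] by (simp add: N_def[symmetric] divide_less_eq)
  qed
  have "\<bar>a' n b\<bar> \<le> 1" if "b \<in> B" for n b
    using member_le_sum[OF that, of "\<lambda>b. \<bar>a' n b\<bar>"] \<open>finite B\<close> sum1[of n] by simp
  from bounded_coeffs_convergent_subseq[of B a' 1, OF \<open>finite B\<close> this]
  obtain r :: "nat \<Rightarrow> nat" where r: "strict_mono r" "\<And>b. b \<in> B \<Longrightarrow> convergent (\<lambda>n. a' (r n) b)"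
    by blast
  define l where "l b = lim (\<lambda>n. a' (r n) b)" for b
  have l: "(\<lambda>n. a' (r n) b) \<longlonglongrightarrow> l b" if "b \<in> B" for b
    using r(2)[OF that] by (simp add: l_def convergent_LIMSEQ_iff)
  have "(\<lambda>n. \<Sum>b\<in>B. \<bar>a' (r n) b\<bar>) \<longlonglongrightarrow> (\<Sum>b\<in>B. \<bar>l b\<bar>)"
    by (intro tendsto_sum tendsto_rabs l)
  then have l1: "(\<Sum>b\<in>B. \<bar>l b\<bar>) = 1" by (simp add: sum1 LIMSEQ_const_iff)
  have "(\<Sum>b\<in>B. l b * c b j) = 0" for j
  proof -
    have "(\<lambda>n. \<Sum>b\<in>B. a' (r n) b * c b j) \<longlonglongrightarrow> (\<Sum>b\<in>B. l b * c b j)"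
      by (intro tendsto_sum tendsto_mult l tendsto_const)
    moreover have "(\<lambda>n. \<Sum>b\<in>B. a' (r n) b * c b j) \<longlonglongrightarrow> 0"
    proof (rule Lim_null_comparison[OF _ LIMSEQ_subseq_LIMSEQ[OF lim_inverse_n' r(1)]])
      show "\<forall>\<^sub>F n in sequentially. norm (\<Sum>b\<in>B. a' (r n) b * c b j)
          \<le> ((\<lambda>n. 1 / real n) \<circ> r) n"
      proof (rule eventually_sequentiallyI[of "max j 1"])
        fix n assume "n \<ge> max j 1"
        with seq_suble[OF r(1), of n] have "j \<le> r n" "r n \<ge> 1" by auto
        moreover have "1 / real (Suc (r n)) \<le> 1 / real (r n)"
          using \<open>r n \<ge> 1\<close> by (intro divide_left_mono) auto
        ultimately show "norm (\<Sum>b\<in>B. a' (r n) b * c b j) \<le> ((\<lambda>n. 1 / real n) \<circ> r) n"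
          using small[of j "r n"] by simp
      qed
    qed
    ultimately show ?thesis by (rule LIMSEQ_unique)
  qed
  then have "l b = 0" if "b \<in> B" for b using indep that by blast
  with l1 show False by simp
qed

definition controlled_deriv :: "(real \<Rightarrow> real) \<Rightarrow> real set \<Rightarrow> nat \<Rightarrow> real \<Rightarrow> bool" where
  "controlled_deriv f S K Q \<longleftrightarrow> (\<forall>x\<in>S. f x = 0) \<or>
     (\<exists>j\<le>K. \<exists>A>0. \<exists>D. (\<forall>x\<in>S. D 0 x = f x \<and> A \<le> \<bar>D j x\<bar> \<and> \<bar>D j x\<bar> \<le> Q * A) \<and>
        (\<forall>k<j. \<forall>x\<in>S. (D k has_field_derivative D (Suc k) x) (at x)))"

lemma controlled_deriv_cong_subset:
  assumes "controlled_deriv f S K Q" "T \<subseteq> S" "\<And>x. x \<in> T \<Longrightarrow> f x = g x"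
  shows "controlled_deriv g T K Q"
  using assms(1)[unfolded controlled_deriv_def]
proof (elim disjE exE conjE)
  assume "\<forall>x\<in>S. f x = 0"
  then have "\<forall>x\<in>T. g x = 0" using assms(2,3) by (metis subsetD)
  then show ?thesis by (simp add: controlled_deriv_def)
next
  fix j A D
  assume "j \<le> K" "A > 0"
    and "\<forall>x\<in>S. D 0 x = f x \<and> A \<le> \<bar>D j x\<bar> \<and> \<bar>D j x\<bar> \<le> Q * A"
    and "\<forall>k<j. \<forall>x\<in>S. (D k has_field_derivative D (Suc k) x) (at x)"
  then show ?thesis unfolding controlled_deriv_def using assms(2,3)
    by (intro disjI2 exI[of _ j] conjI exI[of _ A] exI[of _ D]) auto
qed

text \<open>Induction on the number of functions. If their germs at \<open>x0\<close> are linearly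
  dependent, one of them is eliminated on a smaller ball. If they are independent, some Taylor
  coefficient of bounded order dominates the norm of the coefficients, and continuity extends this
  from \<open>x0\<close> to a ball that serves all combinations at once.\<close>

lemma span_controlled_deriv:
  assumes "finite B" "\<And>b. b \<in> B \<Longrightarrow> power_series_at b x0"
  obtains \<eta> K Q where "\<eta> > 0" "Q \<ge> 1"
    "\<And>a. controlled_deriv (\<lambda>x. \<Sum>b\<in>B. a b * b x) (ball x0 \<eta>) K Q"
proof -
  have "\<exists>\<eta> K Q. \<eta> > 0 \<and> Q \<ge> 1 \<and>
    (\<forall>a. controlled_deriv (\<lambda>x. \<Sum>b\<in>B. a b * b x) (ball x0 \<eta>) K Q)"
    using assms
  proof (induction "card B" arbitrary: B rule: less_induct)
    case less
    show ?case
    proof (cases "\<exists>a \<eta>. \<eta> > 0 \<and> (\<forall>x\<in>ball x0 \<eta>. (\<Sum>b\<in>B. a b * b x) = 0) \<and> (\<exists>b\<in>B. a b \<noteq> 0)")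
      case True
      then obtain a \<eta>0 b0 where eta0: "\<eta>0 > 0" and z: "\<And>x. x \<in> ball x0 \<eta>0 \<Longrightarrow> (\<Sum>b\<in>B. a b * b x) = 0"
        and b0: "b0 \<in> B" "a b0 \<noteq> 0" by blast
      have "card (B - {b0}) < card B" using b0 less.prems(1) by (intro card_Diff1_less)
      from less.hyps[OF this] less.prems obtain \<eta> K Q where IH: "\<eta> > 0" "Q \<ge> 1"
        "\<And>a. controlled_deriv (\<lambda>x. \<Sum>b\<in>B - {b0}. a b * b x) (ball x0 \<eta>) K Q"
        by auto
      obtain s where s: "s = min \<eta> \<eta>0" by blast
      have "controlled_deriv (\<lambda>x. \<Sum>b\<in>B. c b * b x) (ball x0 s) K Q" for c
      proof -
        \<comment> \<open>The relation expresses \<open>b0\<close> near \<open>x0\<close> by the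
          other functions; substituting it changes the coefficients into \<open>c'\<close>.\<close>
        define c' where "c' b = c b - c b0 * a b / a b0" for b
        have eq: "(\<Sum>b\<in>B - {b0}. c' b * b x) = (\<Sum>b\<in>B. c b * b x)" if "x \<in> ball x0 s" for x
        proof -
          have "(\<Sum>b\<in>B - {b0}. a b * b x) = - (a b0 * b0 x)"
            using z[of x] that b0 less.prems(1) s by (simp add: sum.remove[of B b0])
          moreover have "(\<Sum>b\<in>B - {b0}. (c b0 * a b / a b0) * b x)
              = (c b0 / a b0) * (\<Sum>b\<in>B - {b0}. a b * b x)"
            by (simp add: sum_distrib_left mult.assoc)
          ultimately have "(\<Sum>b\<in>B - {b0}. (c b0 * a b / a b0) * b x) = - (c b0 * b0 x)"
            using b0(2) by simp
          then show ?thesis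
            using b0(1) less.prems(1)
            by (simp add: sum.remove[of B b0] c'_def left_diff_distrib sum_subtractf)
        qed
        have "ball x0 s \<subseteq> ball x0 \<eta>" using s by (intro subset_ball) simp
        from controlled_deriv_cong_subset[OF IH(3)[of c'] this eq] show ?thesis .
      qed
      moreover have "s > 0" using s IH(1) eta0 by simp
      ultimately show ?thesis using IH(2) by blast
    next
      case False
      have "\<exists>r a D. taylor_data b x0 r a D" if "b \<in> B" for b
        using power_series_at_imp_taylor_data[OF less.prems(2)[OF that]] by metis
      then obtain r c D where td: "\<And>b. b \<in> B \<Longrightarrow> taylor_data b x0 (r b) (c b) (D b)"
        by metis
      have rb: "r b > 0" if "b \<in> B" for b
        using td[OF that] unfolding taylor_data_def by blast
      have cb: "(\<lambda>k. c b k * (y - x0) ^ k) sums b y" and D0: "D b 0 y = b y"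
        and DS: "(D b k has_field_derivative D b (Suc k) y) (at y)"
        if "b \<in> B" "y \<in> ball x0 (r b)" for b k y
        using td[OF that(1)] that(2) unfolding taylor_data_def by blast+
      have Dc: "D b k x0 = fact k * c b k" if "b \<in> B" for b k
        using td[OF that] unfolding taylor_data_def by blast
      define R where "R = Min (insert 1 (r ` B))"
      have R: "R > 0" "\<And>b. b \<in> B \<Longrightarrow> R \<le> r b"
        using less.prems(1) rb by (auto simp: R_def Min_gr_iff)
      have inR: "y \<in> ball x0 (r b)" if "b \<in> B" "y \<in> ball x0 R" for b y
        using R(2)[OF that(1)] that(2) by auto
      have indep: "a b = 0" if z: "\<And>j. (\<Sum>b\<in>B. a b * c b j) = 0" and b: "b \<in> B" for a b
      proof -
        have "(\<Sum>b\<in>B. a b * b y) = 0" if y: "y \<in> ball x0 R" for y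
        proof -
          have "(\<lambda>k. \<Sum>b\<in>B. a b * (c b k * (y - x0) ^ k)) sums (\<Sum>b\<in>B. a b * b y)"
            by (intro sums_sum sums_mult cb inR y)
          moreover have "(\<Sum>b\<in>B. a b * (c b k * (y - x0) ^ k)) = 0" for k
            using z[of k] by (simp add: mult.assoc[symmetric] sum_distrib_right[symmetric])
          ultimately show ?thesis using sums_unique by fastforce
        qed
        with False R(1) b show ?thesis by blast
      qed
      obtain K e where e: "e > 0"
        "\<And>a. \<exists>j\<le>K. e * (\<Sum>b\<in>B. \<bar>a b\<bar>) \<le> \<bar>\<Sum>b\<in>B. a b * c b j\<bar>"
      proof (rule independent_germs_jet_lower_bound[OF less.prems(1), of c])
        show "a b = 0" if "\<And>j. (\<Sum>b\<in>B. a b * c b j) = 0" "b \<in> B" for a b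
          by (rule indep[OF that])
      qed blast
      have "\<forall>\<^sub>F y in at x0. \<forall>b\<in>B. \<forall>k\<in>{..K}. dist (D b k y) (D b k x0) < e / 2"
      proof (intro eventually_ball_finite ballI less.prems(1))
        fix b k assume "b \<in> B" "k \<in> {..K}"
        then have "isCont (D b k) x0" using DS[of b x0 k] rb by (auto intro: DERIV_isCont)
        then show "\<forall>\<^sub>F y in at x0. dist (D b k y) (D b k x0) < e / 2"
          unfolding isCont_def using e(1) by (intro tendstoD) auto
      qed simp
      then obtain d where d: "d > 0"
        "\<And>y b k. y \<noteq> x0 \<Longrightarrow> dist y x0 < d \<Longrightarrow> b \<in> B \<Longrightarrow> k \<le> K \<Longrightarrow> \<bar>D b k y - D b k x0\<bar> < e / 2"
        by (auto simp: eventually_at dist_real_def)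
      define M where "M = (\<Sum>b\<in>B. \<Sum>k\<le>K. \<bar>D b k x0\<bar>)"
      have M: "\<bar>D b k x0\<bar> \<le> M" if "b \<in> B" "k \<le> K" for b k
      proof -
        have "\<bar>D b k x0\<bar> \<le> (\<Sum>k\<le>K. \<bar>D b k x0\<bar>)" using that by (intro member_le_sum) auto
        also have "\<dots> \<le> M" unfolding M_def
          using that less.prems(1) by (intro member_le_sum[of b B "\<lambda>b. \<Sum>k\<le>K. \<bar>D b k x0\<bar>"]) (auto intro: sum_nonneg)
        finally show ?thesis .
      qed
      define \<eta> where "\<eta> = min d R"
      \<comment> \<open>For coefficients of norm \<open>N\<close> the selected derivative is at
        least \<open>e * N\<close> and at most \<open>M * N\<close> in absolute value at
        \<open>x0\<close>, and it moves by at most \<open>e * N / 2\<close> on the ball. So it stays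
        between \<open>A = e * N / 2\<close> and \<open>M * N + e * N / 2 = Q * A\<close>.\<close>
      define Q where "Q = 1 + 2 * M / e"
      have M0: "M \<ge> 0" unfolding M_def by (intro sum_nonneg) auto
      then have Q1: "Q \<ge> 1" using e(1) by (simp add: Q_def)
      have var: "\<bar>D b k y - D b k x0\<bar> \<le> e / 2" if "y \<in> ball x0 \<eta>" "b \<in> B" "k \<le> K" for y b k
      proof (cases "y = x0")
        case True
        then show ?thesis using e(1) by simp
      next
        case False
        then show ?thesis using d(2)[OF False] that by (auto simp: \<eta>_def dist_commute less_imp_le)
      qed
      have "controlled_deriv (\<lambda>x. \<Sum>b\<in>B. a b * b x) (ball x0 \<eta>) K Q" for a
      proof (cases "(\<Sum>b\<in>B. \<bar>a b\<bar>) = 0")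
        case True
        then have "\<And>b. b \<in> B \<Longrightarrow> a b = 0" using less.prems(1) by (simp add: sum_nonneg_eq_0_iff)
        then show ?thesis by (simp add: controlled_deriv_def)
      next
        case False
        define N where "N = (\<Sum>b\<in>B. \<bar>a b\<bar>)"
        have N: "N > 0" unfolding N_def using False by (intro le_neq_trans sum_nonneg) auto
        obtain j where j: "j \<le> K" "e * N \<le> \<bar>\<Sum>b\<in>B. a b * c b j\<bar>"
          using e(2)[of a] N_def by auto
        define E where "E k = (if k = 0 then (\<lambda>x. \<Sum>b\<in>B. a b * b x)
            else (\<lambda>x. \<Sum>b\<in>B. a b * D b k x))" for k :: nat
        have E: "E k y = (\<Sum>b\<in>B. a b * D b k y)" if "y \<in> ball x0 \<eta>" for k y
          using D0 inR that by (auto simp: E_def \<eta>_def intro!: sum.cong)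
        have "(E k has_real_derivative E (Suc k) y) (at y)" if y: "y \<in> ball x0 \<eta>" for k y
        proof -
          have "((\<lambda>x. \<Sum>b\<in>B. a b * D b k x) has_real_derivative (\<Sum>b\<in>B. a b * D b (Suc k) y)) (at y)"
            using y by (intro DERIV_sum DERIV_cmult DS inR) (auto simp: \<eta>_def)
          from has_field_derivative_transform_within_open[OF this open_ball y, of "E k"] E y
          show ?thesis by simp
        qed
        moreover have "e * N / 2 \<le> \<bar>E j y\<bar> \<and> \<bar>E j y\<bar> \<le> Q * (e * N / 2)"
          if y: "y \<in> ball x0 \<eta>" for y
        proof -
          have x0: "x0 \<in> ball x0 \<eta>" using d(1) R(1) by (simp add: \<eta>_def)
          have "\<bar>E j y - E j x0\<bar> \<le> (\<Sum>b\<in>B. \<bar>a b\<bar> * (e / 2))"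
            unfolding E[OF y] E[OF x0] sum_subtractf[symmetric] right_diff_distrib[symmetric]
            using var[OF y _ j(1)]
            by (intro order_trans[OF sum_abs] sum_mono) (simp only: abs_mult, intro mult_left_mono, auto)
          also have "\<dots> = e * N / 2" unfolding sum_distrib_right[symmetric] N_def by simp
          finally have diff: "\<bar>E j y - E j x0\<bar> \<le> e * N / 2" .
          have "E j x0 = fact j * (\<Sum>b\<in>B. a b * c b j)"
            unfolding E[OF x0] using Dc by (auto simp: sum_distrib_left intro!: sum.cong)
          then have "\<bar>E j x0\<bar> \<ge> 1 * \<bar>\<Sum>b\<in>B. a b * c b j\<bar>"
            using mult_right_mono[OF fact_ge_1[of j, where 'a=real], of "\<bar>\<Sum>b\<in>B. a b * c b j\<bar>"]
            by (simp add: abs_mult)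
          then have lo: "\<bar>E j x0\<bar> \<ge> e * N" using j(2) by linarith
          have "\<bar>E j x0\<bar> \<le> (\<Sum>b\<in>B. \<bar>a b\<bar> * M)"
            unfolding E[OF x0] using M[OF _ j(1)]
            by (intro order_trans[OF sum_abs] sum_mono) (simp only: abs_mult, intro mult_left_mono, auto)
          then have up: "\<bar>E j x0\<bar> \<le> N * M" by (simp add: N_def sum_distrib_right[symmetric])
          have "Q * (e * N / 2) = e * N / 2 + N * M" using e(1) by (simp add: Q_def field_simps)
          then show ?thesis using diff lo up by linarith
        qed
        ultimately show ?thesis
          unfolding controlled_deriv_def using j(1) N e(1)
          by (intro disjI2 exI[of _ j] conjI exI[of _ "e * N / 2"] exI[of _ E]) (auto simp: E_def)
      qed
      moreover have "\<eta> > 0" using d(1) R(1) by (simp add: \<eta>_def)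
      ultimately show ?thesis using Q1 by blast
    qed
  qed
  then show thesis using that by blast
qed

section \<open>Sublevel sets\<close>

text \<open>If no separated subset of \<open>E\<close> has \<open>N\<close> points, one of maximal
  cardinality exists, and by maximality the balls of radius \<open>s\<close> around its points cover
  \<open>E\<close>. Otherwise a large separated subset is listed in increasing order.\<close>

lemma separated_or_covered:
  fixes E :: "real set"
  assumes "s > 0"
  obtains p :: "nat \<Rightarrow> real" where "\<And>i. i < N \<Longrightarrow> p i \<in> E" "\<And>i. Suc i < N \<Longrightarrow> p i + s \<le> p (Suc i)"
  | T where "finite T" "T \<subseteq> E" "card T < N" "E \<subseteq> (\<Union>t\<in>T. ball t s)"
proof -
  define sep where "sep T \<longleftrightarrow> finite T \<and> T \<subseteq> E \<and> pairwise (\<lambda>x y. s \<le> dist x y) T" for T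
  show thesis
  proof (cases "\<exists>T. sep T \<and> card T \<ge> N")
    case True
    then obtain T where T: "sep T" "card T \<ge> N" by blast
    define p where "p i = sorted_list_of_set T ! i" for i
    have len: "length (sorted_list_of_set T) = card T" by simp
    have fin: "finite T" using T by (simp add: sep_def)
    have in_T: "p i \<in> T" if "i < N" for i
      using nth_mem[of i "sorted_list_of_set T"] that T(2) fin by (simp add: p_def)
    have "p i + s \<le> p (Suc i)" if "Suc i < N" for i
    proof -
      have lt: "p i < p (Suc i)"
        using strict_sorted_list_of_set[of T] that T(2)
        by (auto simp: p_def sorted_wrt_iff_nth_less)
      then have "s \<le> dist (p i) (p (Suc i))"
        using T(1) in_T[of i] in_T[of "Suc i"] that by (auto simp: sep_def pairwise_def)
      then show ?thesis using lt by (simp add: dist_real_def)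
    qed
    moreover have "p i \<in> E" if "i < N" for i using in_T[OF that] T(1) by (auto simp: sep_def)
    ultimately show thesis using that(1) by blast
  next
    case False
    have "sep {}" by (simp add: sep_def)
    then obtain T where T: "sep T" and max: "\<And>T'. sep T' \<Longrightarrow> card T' \<le> card T"
      using ex_has_greatest_nat[of sep "{}" card N] False by (auto simp: not_le)
    have "x \<in> (\<Union>t\<in>T. ball t s)" if "x \<in> E" for x
    proof (rule ccontr)
      assume nc: "x \<notin> (\<Union>t\<in>T. ball t s)"
      then have "sep (insert x T)" using T that
        by (auto simp: sep_def pairwise_insert dist_commute not_less)
      moreover have "x \<notin> T" using nc assms by auto
      ultimately show False using max[of "insert x T"] T by (simp add: sep_def)
    qed
    then have "E \<subseteq> (\<Union>t\<in>T. ball t s)" by blast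
    moreover have "card T < N" using T False not_le by blast
    ultimately show thesis using T that(2)[of T] by (simp add: sep_def)
  qed
qed

text \<open>The points are paired as \<open>p (2 * i)\<close> and \<open>p (2 * i + 1)\<close>. The
  mean value theorem puts a small value of the next derivative inside each pair; the gaps between
  different pairs keep these new points at distance \<open>s\<close>. Each step halves the number of
  points and multiplies the bound by \<open>2 / s\<close>.\<close>

lemma iterated_mvt:
  fixes D :: "nat \<Rightarrow> real \<Rightarrow> real"
  assumes "s > 0"
    and "\<And>k x. k < j \<Longrightarrow> x \<in> {a..b} \<Longrightarrow> (D k has_real_derivative D (Suc k) x) (at x)"
    and "\<And>i. i < 2 ^ j \<Longrightarrow> p i \<in> {a..b}" "\<And>i. i < 2 ^ j \<Longrightarrow> \<bar>D 0 (p i)\<bar> \<le> e"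
    and "\<And>i. Suc i < 2 ^ j \<Longrightarrow> p i + s \<le> p (Suc i)"
  shows "\<exists>\<xi>\<in>{a..b}. \<bar>D j \<xi>\<bar> \<le> (2 / s) ^ j * e"
  using assms(2-)
proof (induction j arbitrary: D p e)
  case 0
  then show ?case by (intro bexI[of _ "p 0"]) auto
next
  case (Suc j)
  have "\<exists>q. p (2 * i) < q \<and> q < p (2 * i + 1) \<and> \<bar>D 1 q\<bar> \<le> 2 * e / s" if i: "i < 2 ^ j" for i
  proof -
    have idx: "Suc (2 * i) < 2 ^ Suc j" using i by simp
    then have gap: "p (2 * i) + s \<le> p (2 * i + 1)" using Suc.prems(4)[of "2 * i"] by simp
    have ends: "p (2 * i) \<in> {a..b}" "p (2 * i + 1) \<in> {a..b}"
      using Suc.prems(2) idx by (metis Suc_lessD Suc_eq_plus1)+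
    have "p (2 * i) < p (2 * i + 1)" using gap assms(1) by linarith
    from MVT2[OF this, of "D 0" "D 1"] Suc.prems(1)[of 0] ends
    obtain q where q: "p (2 * i) < q" "q < p (2 * i + 1)"
      "D 0 (p (2 * i + 1)) - D 0 (p (2 * i)) = (p (2 * i + 1) - p (2 * i)) * D 1 q"
      by auto
    have "s * \<bar>D 1 q\<bar> \<le> (p (2 * i + 1) - p (2 * i)) * \<bar>D 1 q\<bar>"
      using gap by (intro mult_right_mono) auto
    also have "\<dots> = \<bar>D 0 (p (2 * i + 1)) - D 0 (p (2 * i))\<bar>"
      unfolding q(3) abs_mult using gap assms(1) by simp
    also have "\<dots> \<le> e + e"
      using Suc.prems(3)[of "2 * i"] Suc.prems(3)[of "2 * i + 1"] idx by auto
    finally have "\<bar>D 1 q\<bar> \<le> 2 * e / s" using assms(1) by (simp add: field_simps)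
    with q show ?thesis by blast
  qed
  then obtain q where q: "\<And>i. i < 2 ^ j \<Longrightarrow> p (2 * i) < q i"
    "\<And>i. i < 2 ^ j \<Longrightarrow> q i < p (2 * i + 1)" "\<And>i. i < 2 ^ j \<Longrightarrow> \<bar>D 1 (q i)\<bar> \<le> 2 * e / s"
    by metis
  have "\<exists>\<xi>\<in>{a..b}. \<bar>(\<lambda>k. D (Suc k)) j \<xi>\<bar> \<le> (2 / s) ^ j * (2 * e / s)"
  proof (rule Suc.IH[of "\<lambda>k. D (Suc k)" q])
    show "q i \<in> {a..b}" if "i < 2 ^ j" for i
      using q(1,2)[OF that] Suc.prems(2)[of "2 * i"] Suc.prems(2)[of "2 * i + 1"] that by auto
    show "q i + s \<le> q (Suc i)" if "Suc i < 2 ^ j" for i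
      using q(2)[of i] q(1)[of "Suc i"] Suc.prems(4)[of "2 * i + 1"] that by auto
  qed (use Suc.prems(1) q(3) in auto)
  then show ?case by (simp add: mult.assoc mult.commute mult.left_commute)
qed

text \<open>At \<open>2 ^ K\<close> points at mutual distance \<open>s\<close> a function with a controlled derivative cannot be
  small compared with its supremum: smallness passes to every derivative of order \<open>i \<le> j\<close> at one
  point, and back up from the \<open>j\<close>-th derivative (which has constant size) to the function.\<close>

lemma controlled_deriv_sup_le:
  assumes cd: "controlled_deriv f {a..b} K Q" and Q: "Q \<ge> 1"
    and s: "0 < s" "s \<le> 2 * (b - a)" and e: "e \<ge> 0"
    and p: "\<And>i. i < 2 ^ K \<Longrightarrow> p i \<in> {a..b}" "\<And>i. i < 2 ^ K \<Longrightarrow> \<bar>f (p i)\<bar> \<le> e"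
      "\<And>i. Suc i < 2 ^ K \<Longrightarrow> p i + s \<le> p (Suc i)"
    and y: "y \<in> {a..b}"
  shows "\<bar>f y\<bar> \<le> (Q + K) * (2 * (b - a) / s) ^ K * e"
  using cd unfolding controlled_deriv_def
proof (elim disjE exE conjE)
  assume "\<forall>x\<in>{a..b}. f x = 0"
  then show ?thesis using y Q s e by simp
next
  fix j A D
  assume j: "j \<le> K" and A: "A > 0"
    and bd': "\<forall>x\<in>{a..b}. D (0::nat) x = f x \<and> A \<le> \<bar>D j x\<bar> \<and> \<bar>D j x\<bar> \<le> Q * A"
    and DS: "\<forall>k<j. \<forall>x\<in>{a..b}. (D k has_real_derivative D (Suc k) x) (at x)"
  have D0: "D 0 x = f x" if "x \<in> {a..b}" for x using bd' that by blast
  have bd: "\<forall>x\<in>{a..b}. A \<le> \<bar>D j x\<bar> \<and> \<bar>D j x\<bar> \<le> Q * A" using bd' by blast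
  define l where "l = b - a"
  have l: "l > 0" "2 * l / s \<ge> 1" using s by (auto simp: l_def)
  have small: "\<exists>\<xi>\<in>{a..b}. \<bar>D i \<xi>\<bar> \<le> (2 / s) ^ i * e" if "i \<le> j" for i
  proof (rule iterated_mvt[of s i a b D p e, OF s(1)])
    have le: "(2::nat) ^ i \<le> 2 ^ K" using that j by (intro power_increasing) auto
    show "p k \<in> {a..b}" "\<bar>D 0 (p k)\<bar> \<le> e" if "k < 2 ^ i" for k
      using p(1,2)[of k] that le D0 by auto
    show "p k + s \<le> p (Suc k)" if "Suc k < 2 ^ i" for k
      using p(3)[of k] that le by auto
  qed (use DS that in auto)
  \<comment> \<open>The way back up: \<open>D j\<close> is everywhere at most \<open>Q\<close> times
    its small value at one point. Each lower derivative is small at some point and varies by at most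
    the length \<open>l\<close> times the bound for the next one.\<close>
  have "\<forall>x\<in>{a..b}. \<bar>D (j - i) x\<bar> \<le> (Q + i) * (2 / s) ^ j * l ^ i * e" if "i \<le> j" for i
    using that
  proof (induction i)
    case 0
    show ?case
    proof
      fix x assume "x \<in> {a..b}"
      obtain \<xi> where "\<xi> \<in> {a..b}" "\<bar>D j \<xi>\<bar> \<le> (2 / s) ^ j * e" using small[of j] by auto
      then have "A \<le> (2 / s) ^ j * e" using bd by (meson order_trans)
      then have "Q * A \<le> Q * ((2 / s) ^ j * e)" using Q by (intro mult_left_mono) auto
      then show "\<bar>D (j - 0) x\<bar> \<le> (Q + real 0) * (2 / s) ^ j * l ^ 0 * e"
        using bd \<open>x \<in> {a..b}\<close> by (auto simp: mult.assoc intro: order_trans)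
    qed
  next
    case (Suc i)
    define k where "k = j - Suc i"
    have k: "k < j" "Suc k = j - i" "j = k + Suc i" using Suc.prems by (auto simp: k_def)
    obtain \<xi> where xi: "\<xi> \<in> {a..b}" "\<bar>D k \<xi>\<bar> \<le> (2 / s) ^ k * e"
      using small[of k] k(1) by auto
    define M where "M = (Q + i) * (2 / s) ^ j * l ^ i * e"
    have M: "M \<ge> 0" using Q s e l by (simp add: M_def)
    \<comment> \<open>Since \<open>2 * l / s\<close> is at least 1, the bound at
      \<open>\<xi>\<close> can be raised to the same powers of \<open>2 / s\<close> and
      \<open>l\<close> as the bound for the variation, and the two add up.\<close>
    have "(2 / s) ^ k * 1 \<le> (2 / s) ^ k * (2 * l / s) ^ Suc i"
      using l s by (intro mult_left_mono one_le_power) auto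
    also have "(2 * l / s) ^ Suc i = (2 / s) ^ Suc i * l ^ Suc i"
      by (subst power_mult_distrib[symmetric]) simp
    also have "(2 / s) ^ k * ((2 / s) ^ Suc i * l ^ Suc i) = (2 / s) ^ j * l ^ Suc i"
      unfolding k(3) power_add by (simp only: mult.assoc)
    finally have le: "(2 / s) ^ k * e \<le> (2 / s) ^ j * l ^ Suc i * e"
      using e by (intro mult_right_mono) auto
    show ?case unfolding k_def[symmetric]
    proof
      fix x assume x: "x \<in> {a..b}"
      have "norm (D k x - D k \<xi>) \<le> M * norm (x - \<xi>)"
      proof (rule field_differentiable_bound[of "{a..b}"])
        show "(D k has_real_derivative D (Suc k) z) (at z within {a..b})" if "z \<in> {a..b}" for z
          using DS k(1) that by (auto intro: has_field_derivative_at_within)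
        show "norm (D (Suc k) z) \<le> M" if "z \<in> {a..b}" for z
          using Suc.IH Suc.prems that by (auto simp: k(2) M_def)
      qed (use x xi(1) in auto)
      also have "\<dots> \<le> M * l"
        using x xi(1) M by (intro mult_left_mono) (auto simp: l_def)
      finally have "\<bar>D k x\<bar> \<le> (2 / s) ^ j * l ^ Suc i * e + M * l"
        using xi(2) le by simp
      also have "\<dots> = (Q + Suc i) * (2 / s) ^ j * l ^ Suc i * e"
        by (simp add: M_def algebra_simps)
      finally show "\<bar>D k x\<bar> \<le> (Q + Suc i) * (2 / s) ^ j * l ^ Suc i * e" .
    qed
  qed
  from bspec[OF this[of j] y] D0[OF y]
  have "\<bar>f y\<bar> \<le> (Q + j) * (2 * l / s) ^ j * e"
    by (simp add: power_mult_distrib power_divide mult.assoc)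
  also have "\<dots> \<le> (Q + K) * (2 * l / s) ^ K * e"
    using j l Q e by (intro mult_right_mono mult_mono power_increasing) auto
  finally show ?thesis by (simp add: l_def)
qed

section \<open>Sublevel sets under an Ahlfors regular measure\<close>

lemma ahlfors_regularD:
  assumes "ahlfors_regular C \<alpha> \<rho>0 \<mu>"
  shows "C > 1" "\<alpha> > 0" "\<rho>0 > 0" "sets \<mu> = sets borel"
    "\<And>x r. x \<in> measure_support \<mu> \<Longrightarrow> 0 < r \<Longrightarrow> r \<le> \<rho>0 \<Longrightarrow>
       ennreal (r powr \<alpha>) \<le> ennreal C * emeasure \<mu> (ball x r)"
    "\<And>x r. x \<in> measure_support \<mu> \<Longrightarrow> 0 < r \<Longrightarrow> r \<le> \<rho>0 \<Longrightarrow>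
       emeasure \<mu> (ball x r) \<le> ennreal (C * r powr \<alpha>)"
proof -
  show C: "C > 1" and "\<alpha> > 0" "\<rho>0 > 0" "sets \<mu> = sets borel"
    using assms by (auto simp: ahlfors_regular_def)
  fix x r :: real assume x: "x \<in> measure_support \<mu>" "0 < r" "r \<le> \<rho>0"
  show "emeasure \<mu> (ball x r) \<le> ennreal (C * r powr \<alpha>)"
    using assms x by (auto simp: ahlfors_regular_def)
  have "ennreal (r powr \<alpha>) = ennreal C * ennreal (inverse C * r powr \<alpha>)"
    using C by (subst ennreal_mult[symmetric]) auto
  also have "\<dots> \<le> ennreal C * emeasure \<mu> (ball x r)"
    using assms x by (intro mult_left_mono) (auto simp: ahlfors_regular_def)
  finally show "ennreal (r powr \<alpha>) \<le> ennreal C * emeasure \<mu> (ball x r)" .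
qed

text \<open>If the sublevel set contained \<open>2 ^ K\<close> points at mutual distance
  \<open>s\<close>, the supremum bound would contradict the value at \<open>y\<close>. So fewer than
  \<open>2 ^ K\<close> balls of radius \<open>s\<close>, centred in the support, cover it. The
  summand \<open>2 powr \<alpha>\<close> is for \<open>q \<ge> 1\<close>, where the single ball of
  radius \<open>2 * R\<close> is enough.\<close>

lemma controlled_sublevel_measure:
  assumes ahl: "ahlfors_regular C \<alpha> \<rho>0 \<mu>"
    and cd: "controlled_deriv f (cball x R) K Q" and Q: "Q \<ge> 1"
    and x: "x \<in> measure_support \<mu>" and R: "R > 0" "2 * R \<le> \<rho>0"
    and e: "e > 0" and h: "h > 0" and y: "y \<in> cball x R" "\<bar>f y\<bar> \<ge> h"
  shows "\<exists>N\<in>sets \<mu>. {z \<in> cball x R \<inter> measure_support \<mu>. \<bar>f z\<bar> < e} \<subseteq> N \<and>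
    emeasure \<mu> N \<le> ennreal (C * (2 ^ K + 2 powr \<alpha>) *
       (4 ^ K * (Q + K) * e / h) powr (\<alpha> / (K + 1)) * R powr \<alpha>)"
proof -
  note ahlD = ahlfors_regularD[OF ahl]
  define q where "q = 4 ^ K * (Q + K) * e / h"
  define \<gamma> where "\<gamma> = \<alpha> / (K + 1)"
  have q: "q > 0" using Q e h by (simp add: q_def)
  have \<gamma>: "\<gamma> > 0" using ahlD(2) by (simp add: \<gamma>_def)
  show ?thesis unfolding q_def[symmetric] \<gamma>_def[symmetric]
  proof (cases "q \<ge> 1")
    case True
    have "emeasure \<mu> (ball x (2 * R)) \<le> ennreal (C * (2 * R) powr \<alpha>)"
      using R by (intro ahlD(6) x) auto
    also have "\<dots> \<le> ennreal (C * (2 ^ K + 2 powr \<alpha>) * q powr \<gamma> * R powr \<alpha>)"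
    proof (rule ennreal_leI)
      have "1 \<le> q powr \<gamma>" using True \<gamma> by (simp add: ge_one_powr_ge_zero)
      then have "C * (2 powr \<alpha>) * 1 * R powr \<alpha> \<le> C * (2 ^ K + 2 powr \<alpha>) * q powr \<gamma> * R powr \<alpha>"
        using ahlD(1) by (intro mult_right_mono mult_mono) auto
      then show "C * (2 * R) powr \<alpha> \<le> C * (2 ^ K + 2 powr \<alpha>) * q powr \<gamma> * R powr \<alpha>"
        using R by (simp add: powr_mult mult.assoc)
    qed
    finally show "\<exists>N\<in>sets \<mu>. {z \<in> cball x R \<inter> measure_support \<mu>. \<bar>f z\<bar> < e} \<subseteq> N \<and>
      emeasure \<mu> N \<le> ennreal (C * (2 ^ K + 2 powr \<alpha>) * q powr \<gamma> * R powr \<alpha>)"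
      using R ahlD(4) by (intro bexI[of _ "ball x (2 * R)"]) auto
  next
    case False
    \<comment> \<open>For this \<open>s\<close> the supremum bound
      \<open>h * (q * (R / s) ^ K)\<close> becomes \<open>h * q powr (1 / (K + 1))\<close>, which is
      less than \<open>h\<close>. The exponent with \<open>K + 1\<close> in place of
      \<open>K\<close> makes the inequality strict and also covers \<open>K = 0\<close>.\<close>
    define s where "s = R * q powr (1 / (K + 1))"
    have s0: "s > 0" using R q by (simp add: s_def)
    have "q powr (1 / (K + 1)) \<le> 1" using False q by (intro powr_le1) auto
    then have sR: "s \<le> R" using R by (simp add: s_def mult_le_cancel_left1)
    have cb: "cball x R = {x - R..x + R}" by (auto simp: dist_real_def)
    define E where "E = {z \<in> cball x R \<inter> measure_support \<mu>. \<bar>f z\<bar> < e}"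
    show "\<exists>N\<in>sets \<mu>. {z \<in> cball x R \<inter> measure_support \<mu>. \<bar>f z\<bar> < e} \<subseteq> N \<and>
      emeasure \<mu> N \<le> ennreal (C * (2 ^ K + 2 powr \<alpha>) * q powr \<gamma> * R powr \<alpha>)"
      unfolding E_def[symmetric]
    proof (rule separated_or_covered[OF s0, of "2 ^ K" E])
      fix p :: "nat \<Rightarrow> real"
      assume p: "\<And>i. i < 2 ^ K \<Longrightarrow> p i \<in> E" "\<And>i. Suc i < 2 ^ K \<Longrightarrow> p i + s \<le> p (Suc i)"
      have "\<bar>f y\<bar> \<le> (Q + K) * (2 * ((x + R) - (x - R)) / s) ^ K * e"
        using cd[unfolded cb] Q s0 _ _ _ _ p(2) y(1)[unfolded cb]
        by (rule controlled_deriv_sup_le) (use sR R e p(1) in \<open>auto simp: E_def cb less_imp_le\<close>)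
      also have "\<dots> = (4 ^ K * (Q + K) * e) * (R / s) ^ K"
        by (simp add: power_mult_distrib power_divide)
      also have "\<dots> = h * (q * (R / s) ^ K)" using h by (simp add: q_def)
      also have "(R / s) ^ K = q powr (- (K / (K + 1)))"
      proof -
        have "R / s = q powr (- (1 / (K + 1)))"
          using R by (simp add: s_def powr_minus_divide)
        then have "(R / s) ^ K = (q powr (- (1 / (K + 1)))) powr K"
          using q by (subst powr_realpow) auto
        then show ?thesis unfolding powr_powr by simp
      qed
      also have "q * q powr (- (K / (K + 1))) = q powr (1 / (K + 1))"
      proof -
        have "q * q powr (- (K / (K + 1))) = q powr (1 + - (K / (K + 1)))"
          using q by (subst powr_add) simp
        also have "1 + - (K / (K + 1)) = 1 / (K + 1)" by (simp add: field_simps)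
        finally show ?thesis .
      qed
      finally have "h \<le> h * q powr (1 / (K + 1))" using y(2) by linarith
      moreover have "q powr (1 / (K + 1)) < 1 powr (1 / (K + 1))"
        using False q by (intro powr_less_mono2) auto
      ultimately have False using h by simp
      then show "\<exists>N\<in>sets \<mu>. E \<subseteq> N \<and>
        emeasure \<mu> N \<le> ennreal (C * (2 ^ K + 2 powr \<alpha>) * q powr \<gamma> * R powr \<alpha>)" ..
    next
      fix T assume T: "finite T" "T \<subseteq> E" "card T < 2 ^ K" "E \<subseteq> (\<Union>t\<in>T. ball t s)"
      have "emeasure \<mu> (\<Union>t\<in>T. ball t s) \<le> (\<Sum>t\<in>T. emeasure \<mu> (ball t s))"
        by (rule emeasure_subadditive_finite[OF T(1)]) (simp add: image_subset_iff ahlD(4))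
      also have "\<dots> \<le> (\<Sum>t\<in>T. ennreal (C * s powr \<alpha>))"
        using T(2) s0 sR R by (intro sum_mono ahlD(6)) (auto simp: E_def)
      also have "\<dots> = ennreal (card T * (C * s powr \<alpha>))"
        using ahlD(1) by (simp add: ennreal_of_nat_eq_real_of_nat ennreal_mult)
      also have "\<dots> \<le> ennreal (C * (2 ^ K + 2 powr \<alpha>) * q powr \<gamma> * R powr \<alpha>)"
      proof (rule ennreal_leI)
        have "s powr \<alpha> = R powr \<alpha> * (q powr (1 / (K + 1))) powr \<alpha>"
          unfolding s_def using R by (subst powr_mult) auto
        also have "(q powr (1 / (K + 1))) powr \<alpha> = q powr \<gamma>"
          unfolding powr_powr by (simp add: \<gamma>_def)
        finally have "s powr \<alpha> = q powr \<gamma> * R powr \<alpha>" by (simp only: mult.commute)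
        moreover have "real (card T) \<le> 2 ^ K + 2 powr \<alpha>"
        proof -
          have "real (card T) \<le> real (2 ^ K)" using T(3) by (intro of_nat_mono) simp
          also have "real (2 ^ K) = 2 ^ K" by simp
          finally show ?thesis using powr_ge_zero[of 2 \<alpha>] by linarith
        qed
        ultimately have "real (card T) * (C * s powr \<alpha>) \<le> (2 ^ K + 2 powr \<alpha>) * (C * (q powr \<gamma> * R powr \<alpha>))"
          using ahlD(1) by (simp only:) (intro mult_right_mono, auto)
        also have "\<dots> = C * (2 ^ K + 2 powr \<alpha>) * q powr \<gamma> * R powr \<alpha>"
          by (simp only: mult.assoc mult.commute mult.left_commute)
        finally show "real (card T) * (C * s powr \<alpha>) \<le> C * (2 ^ K + 2 powr \<alpha>) * q powr \<gamma> * R powr \<alpha>" .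
      qed
      finally show "\<exists>N\<in>sets \<mu>. E \<subseteq> N \<and>
        emeasure \<mu> N \<le> ennreal (C * (2 ^ K + 2 powr \<alpha>) * q powr \<gamma> * R powr \<alpha>)"
        using T(1,4) ahlD(4) by (intro bexI[of _ "\<Union>t\<in>T. ball t s"]) auto
    qed
  qed
qed

text \<open>The Euclidean norm is at most the sum of the absolute values, so one coordinate reaches
  \<open>h / card X\<close> at \<open>y\<close>. The sublevel set of the norm lies in the sublevel
  set of this coordinate.\<close>

lemma controlled_norm_sublevel_measure:
  assumes ahl: "ahlfors_regular C \<alpha> \<rho>0 \<mu>" and X: "finite X" "X \<noteq> {}"
    and cd: "\<And>S. S \<in> X \<Longrightarrow> controlled_deriv (f S) (cball x R) K Q" and Q: "Q \<ge> 1"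
    and x: "x \<in> measure_support \<mu>" and R: "R > 0" "2 * R \<le> \<rho>0"
    and e: "e > 0" and h: "h > 0"
    and y: "y \<in> cball x R" "sqrt (\<Sum>S\<in>X. (f S y)\<^sup>2) \<ge> h"
  shows "\<exists>N\<in>sets \<mu>. {z \<in> cball x R \<inter> measure_support \<mu>. sqrt (\<Sum>S\<in>X. (f S z)\<^sup>2) < e} \<subseteq> N \<and>
    emeasure \<mu> N \<le> ennreal (C * (2 ^ K + 2 powr \<alpha>) *
       (4 ^ K * (Q + K) * card X * (e / h)) powr (\<alpha> / (K + 1)) * R powr \<alpha>)"
proof -
  have "\<exists>S\<in>X. \<bar>f S y\<bar> \<ge> h / card X"
  proof (rule ccontr)
    assume "\<not> ?thesis"
    then have "(\<Sum>S\<in>X. \<bar>f S y\<bar>) < (\<Sum>S\<in>X. h / card X)"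
      using X by (intro sum_strict_mono) auto
    then show False
      using y(2) L2_set_le_sum_abs[of "\<lambda>S. f S y" X] X by (simp add: L2_set_def)
  qed
  then obtain S where S: "S \<in> X" "\<bar>f S y\<bar> \<ge> h / card X" by blast
  have "h / card X > 0" using X h by (simp add: card_gt_0_iff)
  from controlled_sublevel_measure[OF ahl cd[OF S(1)] Q x R e this y(1) S(2)]
  obtain N where N: "N \<in> sets \<mu>" "{z \<in> cball x R \<inter> measure_support \<mu>. \<bar>f S z\<bar> < e} \<subseteq> N"
    "emeasure \<mu> N \<le> ennreal (C * (2 ^ K + 2 powr \<alpha>) *
       (4 ^ K * (Q + K) * e / (h / card X)) powr (\<alpha> / (K + 1)) * R powr \<alpha>)" by blast
  have "\<bar>f S z\<bar> \<le> sqrt (\<Sum>S\<in>X. (f S z)\<^sup>2)" for z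
    using member_le_L2_set[OF X(1) S(1), of "\<lambda>S. \<bar>f S z\<bar>"] by (simp add: L2_set_def)
  then have "{z \<in> cball x R \<inter> measure_support \<mu>. sqrt (\<Sum>S\<in>X. (f S z)\<^sup>2) < e} \<subseteq> N"
    using N(2) by (fastforce intro: le_less_trans)
  moreover have eq: "4 ^ K * (Q + K) * e / (h / card X) = 4 ^ K * (Q + K) * card X * (e / h)"
    by simp
  ultimately show ?thesis using N(1) N(3)[unfolded eq] by blast
qed

section \<open>Marked points\<close>

lemma emeasure_UN_le_mult_disjoint:
  assumes C: "countable C" and N: "\<And>i. i \<in> C \<Longrightarrow> N i \<in> sets M" and Y: "\<And>i. i \<in> C \<Longrightarrow> Y i \<in> sets M"
    and disj: "disjoint_family_on Y C"
    and le: "\<And>i. i \<in> C \<Longrightarrow> emeasure M (N i) \<le> \<kappa> * emeasure M (Y i)"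
  shows "emeasure M (\<Union>i\<in>C. N i) \<le> \<kappa> * emeasure M (\<Union>i\<in>C. Y i)"
proof -
  define I where "I = to_nat_on C ` C"
  define g where "g = inv_into C (to_nat_on C)"
  have g: "g k \<in> C" if "k \<in> I" for k using that by (auto simp: I_def g_def inv_into_into)
  have g': "g (to_nat_on C i) = i" if "i \<in> C" for i
    using inv_into_f_f[OF inj_on_to_nat_on[OF C] that] by (simp add: g_def)
  have inj: "g k \<noteq> g l" if "k \<in> I" "l \<in> I" "k \<noteq> l" for k l
    using that g' by (auto simp: I_def)
  define X where "X F k = (if k \<in> I then F (g k) else {})" for F :: "'a \<Rightarrow> 'b set" and k
  have X_to_nat: "X F (to_nat_on C i) = F i" if "i \<in> C" for F i
    using that by (simp add: X_def I_def g')
  have UN: "(\<Union>i\<in>C. F i) = (\<Union>k. X F k)" for F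
  proof (intro equalityI UN_least)
    show "F i \<subseteq> (\<Union>k. X F k)" if "i \<in> C" for i
      using X_to_nat[OF that, of F] by blast
    show "X F k \<subseteq> (\<Union>i\<in>C. F i)" for k using g[of k] by (auto simp: X_def)
  qed
  have "emeasure M (\<Union>k. X N k) \<le> (\<Sum>k. emeasure M (X N k))"
    using N g by (intro emeasure_subadditive_countably) (auto simp: X_def)
  also have "\<dots> \<le> (\<Sum>k. \<kappa> * emeasure M (X Y k))"
    using le g by (intro suminf_le) (auto simp: X_def)
  also have "\<dots> = \<kappa> * (\<Sum>k. emeasure M (X Y k))" by simp
  also have "(\<Sum>k. emeasure M (X Y k)) = emeasure M (\<Union>k. X Y k)"
  proof (rule suminf_emeasure)
    show "range (X Y) \<subseteq> sets M" using Y g by (auto simp: X_def)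
    show "disjoint_family (X Y)"
      unfolding disjoint_family_on_def X_def using disj g inj
      by (auto simp: disjoint_family_on_def)
  qed
  finally show ?thesis by (simp add: UN)
qed

text \<open>The marked points of Kleinbock and Margulis; the chains \<open>F\<close> stand for flags of subgroups.\<close>

definition marked ::
  "('s \<Rightarrow> real \<Rightarrow> real) \<Rightarrow> ('s \<Rightarrow> 's \<Rightarrow> bool) \<Rightarrow> real \<Rightarrow> real \<Rightarrow> 's set \<Rightarrow> real \<Rightarrow> bool" where
  "marked \<psi> cmp \<epsilon> \<rho> S x \<longleftrightarrow>
     (\<exists>F\<subseteq>S. finite F \<and> pairwise cmp F \<and> (\<forall>s\<in>F. \<epsilon> \<le> \<psi> s x \<and> \<psi> s x \<le> \<rho>) \<and>
        (\<forall>t\<in>S - F. (\<forall>s\<in>F. cmp s t) \<longrightarrow> \<rho> \<le> \<psi> t x))"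

lemma marked_empty: "(\<And>t. t \<in> S \<Longrightarrow> \<rho> \<le> \<psi> t x) \<Longrightarrow> marked \<psi> cmp \<epsilon> \<rho> S x"
  unfolding marked_def by (intro exI[of _ "{}"]) auto

text \<open>A further member compatible with \<open>insert s F\<close> is comparable with
  \<open>s\<close> in particular, so it belongs to the reduced family and is controlled
  there.\<close>

lemma marked_insert:
  assumes "symp cmp" "s \<in> S" "\<epsilon> \<le> \<psi> s x" "\<psi> s x \<le> \<rho>" "marked \<psi> cmp \<epsilon> \<rho> {t \<in> S. cmp s t} x"
  shows "marked \<psi> cmp \<epsilon> \<rho> S x"
proof -
  obtain F where F: "F \<subseteq> {t \<in> S. cmp s t}" "finite F" "pairwise cmp F"
    "\<forall>s\<in>F. \<epsilon> \<le> \<psi> s x \<and> \<psi> s x \<le> \<rho>"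
    "\<And>t. t \<in> {t \<in> S. cmp s t} - F \<Longrightarrow> (\<forall>s\<in>F. cmp s t) \<Longrightarrow> \<rho> \<le> \<psi> t x"
    using assms(5) unfolding marked_def by blast
  have "pairwise cmp (insert s F)"
    using F(1,3) assms(1) by (auto simp: pairwise_insert symp_def)
  then show ?thesis unfolding marked_def
    using F assms(2-4) by (intro exI[of _ "insert s F"]) auto
qed

text \<open>The 1 pays for the points where the selected function is below
  \<open>\<epsilon>\<close>, the other summand for the induction hypothesis on radius
  \<open>2 * R\<close>. Comparing this radius with the disjoint balls of radius \<open>R / 5\<close>
  costs \<open>C * 10 powr \<alpha>\<close>; their union lies in a ball of radius
  \<open>4 * r\<close>, which costs \<open>C * 4 powr \<alpha>\<close>.\<close>

primrec marking_const :: "real \<Rightarrow> real \<Rightarrow> nat \<Rightarrow> real" where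
  "marking_const C \<alpha> 0 = 0"
| "marking_const C \<alpha> (Suc k) = (1 + marking_const C \<alpha> k) * C\<^sup>2 * 40 powr \<alpha>"

lemma marking_const_nonneg: "marking_const C \<alpha> k \<ge> 0"
  by (induction k) auto

text \<open>Induction on the length of chains. Around an unmarked \<open>y\<close> take the largest interval on which
  some \<open>\<psi> s\<close> stays below \<open>\<rho>\<close>; on twice that interval every \<open>\<psi> t\<close> comparable with \<open>s\<close> reaches \<open>\<rho>\<close>,
  so the induction hypothesis applies to these \<open>t\<close>. The intervals are summed with a Vitali covering.
  Since an optimal \<open>s\<close> need not exist, one within a factor 2 of the supremum is used.\<close>

lemma unmarked_measure:
  fixes \<psi> :: "'s \<Rightarrow> real \<Rightarrow> real"
  assumes ahl: "ahlfors_regular C \<alpha> \<rho>0 \<mu>"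
    and cmp: "symp cmp" "irreflp cmp"
    and D: "closed D" and cont: "\<And>s. s \<in> S \<Longrightarrow> continuous_on D (\<psi> s)"
    and q: "q \<ge> 0"
    and good: "\<And>s x R y. \<lbrakk>s \<in> S; x \<in> measure_support \<mu>; R > 0; 2 * R \<le> \<rho>0; cball x R \<subseteq> D;
       y \<in> cball x R; \<rho> \<le> \<psi> s y\<rbrakk> \<Longrightarrow>
       \<exists>N\<in>sets \<mu>. {z \<in> cball x R \<inter> measure_support \<mu>. \<psi> s z < \<epsilon>} \<subseteq> N \<and>
         emeasure \<mu> N \<le> ennreal (q * R powr \<alpha>)"
    and chains: "\<And>F. F \<subseteq> S \<Longrightarrow> finite F \<Longrightarrow> pairwise cmp F \<Longrightarrow> card F \<le> k"
    and x: "x \<in> measure_support \<mu>" and r: "r \<ge> 0" "8 * 5 ^ k * r \<le> \<rho>0" "cball x (5 ^ k * r) \<subseteq> D"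
    and big: "\<And>s. s \<in> S \<Longrightarrow> \<exists>y\<in>cball x r. \<rho> \<le> \<psi> s y"
  shows "\<exists>N\<in>sets \<mu>. {z \<in> cball x r \<inter> measure_support \<mu>. \<not> marked \<psi> cmp \<epsilon> \<rho> S z} \<subseteq> N \<and>
    emeasure \<mu> N \<le> ennreal (marking_const C \<alpha> k * q * r powr \<alpha>)"
  using cont good chains x r big
proof (induction k arbitrary: S x r)
  case 0
  have "S = {}" using "0.prems"(3)[of "{s}" for s] by fastforce
  then have "marked \<psi> cmp \<epsilon> \<rho> S z" for z by (intro marked_empty) simp
  then show ?case by (intro bexI[of _ "{}"]) auto
next
  case (Suc k)
  note ahlD = ahlfors_regularD[OF ahl]
  \<comment> \<open>The distance \<open>rad y s\<close> from \<open>y\<close> to \<open>Z s\<close>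
    is the radius of the largest interval around \<open>y\<close> on which, within \<open>D\<close>,
    \<open>\<psi> s\<close> stays below \<open>\<rho>\<close>. As \<open>Z s\<close> is closed, the
    distance is attained.\<close>
  define Z where "Z s = {z \<in> D. \<rho> \<le> \<psi> s z}" for s
  define rad where "rad y s = infdist y (Z s)" for y s
  have r5: "5 * r \<le> 5 ^ Suc k * r"
    using Suc.prems(5) one_le_power[of "5::real" k] by (simp add: mult_right_mono)
  have r40: "40 * r \<le> \<rho>0" using r5 Suc.prems(6) by (simp only: mult.assoc)
  have D5: "cball x (5 * r) \<subseteq> D" using subset_cball[OF r5] Suc.prems(7) by blast
  have clZ: "closed (Z s)" if "s \<in> S" for s
    unfolding Z_def using continuous_on_closed_Collect_le[OF continuous_on_const Suc.prems(1)[OF that] D] .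
  have neZ: "\<exists>z\<in>Z s. z \<in> cball x r" if "s \<in> S" for s
    using Suc.prems(8)[OF that] D5 Suc.prems(5) by (fastforce simp: Z_def)
  have rad_le: "rad y s \<le> 2 * r" if "s \<in> S" "y \<in> cball x r" for s y
  proof -
    obtain z where z: "z \<in> Z s" "z \<in> cball x r" using neZ \<open>s \<in> S\<close> by blast
    have "rad y s \<le> dist y z" unfolding rad_def using z(1) by (rule infdist_le)
    also have "\<dots> \<le> 2 * r" using z(2) that(2) by (simp add: dist_real_def)
    finally show ?thesis .
  qed
  have rad_attained: "\<exists>z\<in>D. dist y z = rad y s \<and> \<rho> \<le> \<psi> s z" if "s \<in> S" for y s
  proof -
    have "closed (Z s)" "Z s \<noteq> {}" using clZ[OF that] neZ[OF that] by blast+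
    then obtain z where "z \<in> Z s" "infdist y (Z s) = dist y z"
      using infdist_attains_inf[of "Z s" y] by metis
    then show ?thesis by (auto simp: rad_def Z_def)
  qed
  have rad_small: "\<psi> s z < \<rho>" if "z \<in> D" "dist y z < rad y s" for s y z
  proof (rule ccontr)
    assume "\<not> \<psi> s z < \<rho>"
    then have "z \<in> Z s" using that by (simp add: Z_def)
    from infdist_le[OF this, of y] that(2) show False by (simp add: rad_def)
  qed
  define E where "E = {y \<in> cball x r \<inter> measure_support \<mu>. \<exists>s\<in>S. \<psi> s y < \<rho>}"
  have "\<exists>s\<in>S. 0 < rad y s \<and> (\<forall>t\<in>S. rad y t \<le> 2 * rad y s)" if y: "y \<in> E" for y
  proof -
    obtain s0 where s0: "s0 \<in> S" "\<psi> s0 y < \<rho>" using y by (auto simp: E_def)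
    have "y \<notin> Z s0" using s0 by (simp add: Z_def)
    then have pos: "0 < rad y s0"
      unfolding rad_def using clZ[OF s0(1)] neZ[OF s0(1)] infdist_pos_not_in_closed by blast
    have bdd: "bdd_above (rad y ` S)"
      using rad_le y by (auto simp: E_def intro!: bdd_aboveI[of _ "2 * r"])
    define R where "R = (SUP s\<in>S. rad y s)"
    have R: "rad y t \<le> R" if "t \<in> S" for t
      unfolding R_def using cSUP_upper[OF that bdd] .
    have "R / 2 < R" using pos R[OF s0(1)] by simp
    then obtain s where s: "s \<in> S" "R / 2 < rad y s"
      using less_cSUP_iff[OF _ bdd, of "R / 2"] s0(1) by (auto simp: R_def)
    have "rad y t \<le> 2 * rad y s" if "t \<in> S" for t using R[OF that] s(2) by linarith
    moreover have "0 < rad y s" using pos R[OF s0(1)] s(2) by linarith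
    ultimately show ?thesis using s(1) by blast
  qed
  then obtain \<sigma> where \<sigma>: "\<And>y. y \<in> E \<Longrightarrow> \<sigma> y \<in> S" "\<And>y. y \<in> E \<Longrightarrow> 0 < rad y (\<sigma> y)"
    "\<And>y t. y \<in> E \<Longrightarrow> t \<in> S \<Longrightarrow> rad y t \<le> 2 * rad y (\<sigma> y)" by metis
  define R where "R y = rad y (\<sigma> y)" for y
  have R: "0 < R y" "R y \<le> 2 * r" if "y \<in> E" for y
    using \<sigma>(1,2)[OF that] rad_le that by (auto simp: R_def E_def)
  define c where "c = marking_const C \<alpha> k"
  have c0: "c \<ge> 0" by (simp add: c_def marking_const_nonneg)
  have "\<exists>N\<in>sets \<mu>. {z \<in> ball y (R y) \<inter> measure_support \<mu>. \<not> marked \<psi> cmp \<epsilon> \<rho> S z} \<subseteq> N \<and>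
      emeasure \<mu> N \<le> ennreal ((1 + c) * q * (2 * R y) powr \<alpha>)" if y: "y \<in> E" for y
  proof -
    have ysup: "y \<in> measure_support \<mu>" and yx: "dist x y \<le> r" using y by (auto simp: E_def)
    \<comment> \<open>The point \<open>y\<close> is within \<open>r\<close> of \<open>x\<close>, and
      \<open>R y \<le> 2 * r\<close>. The remaining \<open>k\<close> rounds thus stay within
      \<open>r + 5 ^ k * (4 * r)\<close> of \<open>x\<close>, which is at most
      \<open>5 ^ Suc k * r\<close>: hence the factor 5 per round.\<close>
    have incl: "cball y (5 ^ k * (2 * R y)) \<subseteq> D"
    proof -
      have "5 ^ k * (2 * R y) \<le> 5 ^ k * (4 * r)"
        using R[OF y] by (intro mult_left_mono) auto
      moreover have "r \<le> 5 ^ k * r"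
        using Suc.prems(5) one_le_power[of "5::real" k] by (simp add: mult_le_cancel_right1)
      moreover have "5 ^ Suc k * r = 5 ^ k * r + 5 ^ k * (4 * r)" by simp
      moreover have "dist y x \<le> r" using yx by (simp add: dist_commute)
      ultimately have "dist y x + 5 ^ k * (2 * R y) \<le> 5 ^ Suc k * r" by linarith
      then have "cball y (5 ^ k * (2 * R y)) \<subseteq> cball x (5 ^ Suc k * r)"
        by (simp add: cball_subset_cball_iff)
      then show ?thesis using Suc.prems(7) by blast
    qed
    have "1 * (2 * R y) \<le> 5 ^ k * (2 * R y)"
      using R(1)[OF y] by (intro mult_right_mono) auto
    then have incl1: "cball y (2 * R y) \<subseteq> D" using incl subset_cball[of "2 * R y"] by fastforce
    have small: "8 * 5 ^ k * (2 * R y) \<le> \<rho>0"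
    proof -
      have "8 * 5 ^ k * (2 * R y) \<le> 8 * 5 ^ k * (5 * r)"
        using R[OF y] by (intro mult_left_mono) auto
      also have "\<dots> = 8 * 5 ^ Suc k * r" by simp
      finally show ?thesis using Suc.prems(6) by (rule order_trans)
    qed
    have "2 * (2 * R y) \<le> 8 * 5 ^ k * (2 * R y)"
    proof (rule mult_right_mono)
      show "(2::real) \<le> 8 * 5 ^ k" using one_le_power[of "5::real" k] by linarith
    qed (use R(1)[OF y] in simp)
    then have small1: "2 * (2 * R y) \<le> \<rho>0" using small by linarith
    have reach: "\<exists>z\<in>cball y (2 * R y). \<rho> \<le> \<psi> t z" if t: "t \<in> S" for t
      using rad_attained[OF t, of y] \<sigma>(3)[OF y t] by (force simp: R_def)
    \<comment> \<open>By irreflexivity \<open>\<sigma> y\<close> is outside \<open>S'\<close>, and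
      it can be added to every chain in \<open>S'\<close>. The bound on the length of chains
      therefore drops to \<open>k\<close>.\<close>
    define S' where "S' = {t \<in> S. cmp (\<sigma> y) t}"
    have "\<exists>N\<in>sets \<mu>. {z \<in> cball y (2 * R y) \<inter> measure_support \<mu>. \<not> marked \<psi> cmp \<epsilon> \<rho> S' z} \<subseteq> N \<and>
      emeasure \<mu> N \<le> ennreal (marking_const C \<alpha> k * q * (2 * R y) powr \<alpha>)"
    proof (rule Suc.IH)
      fix F assume F: "F \<subseteq> S'" "finite F" "pairwise cmp F"
      have "\<sigma> y \<notin> F" using F(1) cmp(2) by (auto simp: S'_def irreflp_def)
      have "pairwise cmp (insert (\<sigma> y) F)"
        using F cmp(1) by (auto simp: S'_def pairwise_insert symp_def)
      from Suc.prems(3)[OF _ _ this] F(1,2) \<sigma>(1)[OF y] \<open>\<sigma> y \<notin> F\<close> show "card F \<le> k"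
        by (auto simp: S'_def)
    next
      fix s u R' w
      assume "s \<in> S'" "u \<in> measure_support \<mu>" "R' > 0" "2 * R' \<le> \<rho>0" "cball u R' \<subseteq> D"
        "w \<in> cball u R'" "\<rho> \<le> \<psi> s w"
      then show "\<exists>N\<in>sets \<mu>. {z \<in> cball u R' \<inter> measure_support \<mu>. \<psi> s z < \<epsilon>} \<subseteq> N \<and>
          emeasure \<mu> N \<le> ennreal (q * R' powr \<alpha>)"
        unfolding S'_def by (intro Suc.prems(2)) auto
    next
      show "continuous_on D (\<psi> s)" if "s \<in> S'" for s
        using that Suc.prems(1) by (simp add: S'_def)
      show "\<exists>z\<in>cball y (2 * R y). \<rho> \<le> \<psi> s z" if "s \<in> S'" for s
        using that reach by (simp add: S'_def)
      show "0 \<le> 2 * R y" using R(1)[OF y] by simp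
    qed (rule ysup small incl)+
    then obtain N2 where N2: "N2 \<in> sets \<mu>"
      "{z \<in> cball y (2 * R y) \<inter> measure_support \<mu>. \<not> marked \<psi> cmp \<epsilon> \<rho> S' z} \<subseteq> N2"
      "emeasure \<mu> N2 \<le> ennreal (c * q * (2 * R y) powr \<alpha>)" by (auto simp: c_def)
    obtain w where "w \<in> cball y (2 * R y)" "\<rho> \<le> \<psi> (\<sigma> y) w" using reach \<sigma>(1)[OF y] by blast
    then obtain N1 where N1: "N1 \<in> sets \<mu>"
      "{z \<in> cball y (2 * R y) \<inter> measure_support \<mu>. \<psi> (\<sigma> y) z < \<epsilon>} \<subseteq> N1"
      "emeasure \<mu> N1 \<le> ennreal (q * (2 * R y) powr \<alpha>)"
      using Suc.prems(2)[OF \<sigma>(1)[OF y] ysup _ small1 incl1] R(1)[OF y] by auto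
    have "marked \<psi> cmp \<epsilon> \<rho> S z"
      if z: "z \<in> ball y (R y)" "z \<in> measure_support \<mu>" "z \<notin> N1" "z \<notin> N2" for z
    proof (rule marked_insert[OF cmp(1) \<sigma>(1)[OF y]])
      have z2: "z \<in> cball y (2 * R y)" using z(1) R(1)[OF y] by auto
      show "\<epsilon> \<le> \<psi> (\<sigma> y) z" using N1(2) z2 z by force
      show "marked \<psi> cmp \<epsilon> \<rho> {t \<in> S. cmp (\<sigma> y) t} z" using N2(2) z2 z by (force simp: S'_def)
      show "\<psi> (\<sigma> y) z \<le> \<rho>"
        using rad_small[of z y "\<sigma> y"] z(1) z2 incl1 by (auto simp: R_def less_imp_le)
    qed
    then have "{z \<in> ball y (R y) \<inter> measure_support \<mu>. \<not> marked \<psi> cmp \<epsilon> \<rho> S z} \<subseteq> N1 \<union> N2" by auto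
    moreover have "emeasure \<mu> (N1 \<union> N2) \<le> ennreal ((1 + c) * q * (2 * R y) powr \<alpha>)"
    proof -
      have "emeasure \<mu> (N1 \<union> N2) \<le> emeasure \<mu> N1 + emeasure \<mu> N2"
        using N1(1) N2(1) by (rule emeasure_subadditive)
      also have "\<dots> \<le> ennreal (q * (2 * R y) powr \<alpha>) + ennreal (c * q * (2 * R y) powr \<alpha>)"
        using N1(3) N2(3) by (rule add_mono)
      also have "\<dots> = ennreal ((1 + c) * q * (2 * R y) powr \<alpha>)"
        using q c0 by (subst ennreal_plus[symmetric]) (auto simp: algebra_simps)
      finally show ?thesis .
    qed
    ultimately show ?thesis using N1(1) N2(1) by (intro bexI[of _ "N1 \<union> N2"] conjI) auto
  qed
  then have "\<forall>y\<in>E. \<exists>N. N \<in> sets \<mu> \<and>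
      {z \<in> ball y (R y) \<inter> measure_support \<mu>. \<not> marked \<psi> cmp \<epsilon> \<rho> S z} \<subseteq> N \<and>
      emeasure \<mu> N \<le> ennreal ((1 + c) * q * (2 * R y) powr \<alpha>)"
    by (simp only: Bex_def) simp
  from bchoice[OF this] obtain N where N: "\<And>y. y \<in> E \<Longrightarrow> N y \<in> sets \<mu>"
    "\<And>y. y \<in> E \<Longrightarrow> {z \<in> ball y (R y) \<inter> measure_support \<mu>. \<not> marked \<psi> cmp \<epsilon> \<rho> S z} \<subseteq> N y"
    "\<And>y. y \<in> E \<Longrightarrow> emeasure \<mu> (N y) \<le> ennreal ((1 + c) * q * (2 * R y) powr \<alpha>)"
    by blast
  \<comment> \<open>Vitali: the selected fifths are disjoint while the full balls cover
    \<open>E\<close>. The fifths are centred in the support, so lower regularity lets their measure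
    pay for the sets \<open>N y\<close>.\<close>
  have "E \<subseteq> (\<Union>y\<in>E. ball y (R y / 5))" using R by force
  moreover have "\<And>y. y \<in> E \<Longrightarrow> 0 < R y / 5 \<and> R y / 5 \<le> r" using R Suc.prems(5) by force
  ultimately obtain K where K: "countable K" "K \<subseteq> E"
    "pairwise (\<lambda>i j. disjnt (ball i (R i / 5)) (ball j (R j / 5))) K"
    "E \<subseteq> (\<Union>y\<in>K. ball y (5 * (R y / 5)))"
    by (rule Vitali_covering_lemma_balls)
  define \<kappa> where "\<kappa> = (1 + c) * q * C * 10 powr \<alpha>"
  have \<kappa>0: "\<kappa> \<ge> 0" using c0 q ahlD(1) by (simp add: \<kappa>_def)
  have Nk: "emeasure \<mu> (N y) \<le> ennreal \<kappa> * emeasure \<mu> (ball y (R y / 5))" if "y \<in> K" for y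
  proof -
    have y: "y \<in> E" using that K(2) by blast
    have rs: "0 < R y / 5" "R y / 5 \<le> \<rho>0"
      using R[OF y] r40 by auto
    have "ennreal ((1 + c) * q * (2 * R y) powr \<alpha>)
        = ennreal ((1 + c) * q * 10 powr \<alpha>) * ennreal ((R y / 5) powr \<alpha>)"
      using R(1)[OF y] c0 q
      by (subst ennreal_mult[symmetric]) (auto simp: powr_mult[symmetric] mult.assoc)
    also have "\<dots> \<le> ennreal ((1 + c) * q * 10 powr \<alpha>) * (ennreal C * emeasure \<mu> (ball y (R y / 5)))"
      using y rs by (intro mult_left_mono ahlD(5)) (auto simp: E_def)
    also have "\<dots> = ennreal \<kappa> * emeasure \<mu> (ball y (R y / 5))"
      using c0 q ahlD(1) by (simp add: \<kappa>_def mult.assoc[symmetric] ennreal_mult[symmetric])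
        (simp add: mult_ac)
    finally show ?thesis using N(3)[OF y] by (rule order_trans[rotated])
  qed
  have Nsets: "(\<Union>y\<in>K. N y) \<in> sets \<mu>" using K(1,2) N(1) by (intro sets.countable_UN') auto
  have "emeasure \<mu> (\<Union>y\<in>K. N y) \<le> ennreal (marking_const C \<alpha> (Suc k) * q * r powr \<alpha>)"
  \<comment> \<open>Regularity speaks of positive radii only; for \<open>r = 0\<close> the
    inequalities \<open>0 < R y \<le> 2 * r\<close> leave \<open>E\<close> empty.\<close>
  proof (cases "r = 0")
    case True
    then have "E = {}" using R by force
    then show ?thesis using K(2) by simp
  next
    case False
    then have r0: "r > 0" using Suc.prems(5) by simp
    have "emeasure \<mu> (\<Union>y\<in>K. N y) \<le> ennreal \<kappa> * emeasure \<mu> (\<Union>y\<in>K. ball y (R y / 5))"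
      using K N(1) Nk ahlD(4)
      by (intro emeasure_UN_le_mult_disjoint)
         (auto simp: disjoint_family_on_def pairwise_def disjnt_def)
    also have "\<dots> \<le> ennreal \<kappa> * emeasure \<mu> (ball x (4 * r))"
    proof (intro mult_left_mono emeasure_mono)
      show "(\<Union>y\<in>K. ball y (R y / 5)) \<subseteq> ball x (4 * r)"
      proof clarify
        fix y z assume "y \<in> K" "z \<in> ball y (R y / 5)"
        moreover from this have "dist x y \<le> r" "R y \<le> 2 * r" using K(2) R by (auto simp: E_def)
        ultimately show "z \<in> ball x (4 * r)" using r0 dist_triangle[of x z y] by simp
      qed
    qed (use ahlD(4) in auto)
    also have "\<dots> \<le> ennreal \<kappa> * ennreal (C * (4 * r) powr \<alpha>)"
      using r0 r40 Suc.prems(4) by (intro mult_left_mono ahlD(6)) auto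
    also have "\<dots> = ennreal (marking_const C \<alpha> (Suc k) * q * r powr \<alpha>)"
    proof -
      have "\<kappa> * (C * (4 * r) powr \<alpha>) = (1 + c) * q * C\<^sup>2 * (10 powr \<alpha> * 4 powr \<alpha>) * r powr \<alpha>"
        using r0 by (simp add: \<kappa>_def powr_mult power2_eq_square)
      also have "10 powr \<alpha> * 4 powr \<alpha> = 40 powr \<alpha>" by (subst powr_mult[symmetric]) auto
      finally show ?thesis using \<kappa>0 by (simp add: c_def ennreal_mult'[symmetric] mult_ac)
    qed
    finally show ?thesis .
  qed
  moreover have "{z \<in> cball x r \<inter> measure_support \<mu>. \<not> marked \<psi> cmp \<epsilon> \<rho> S z} \<subseteq> (\<Union>y\<in>K. N y)"
  proof
    fix z assume z: "z \<in> {z \<in> cball x r \<inter> measure_support \<mu>. \<not> marked \<psi> cmp \<epsilon> \<rho> S z}"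
    then have "z \<in> E" using marked_empty[of S \<rho> \<psi> z] by (auto simp: E_def not_less[symmetric])
    then obtain y where "y \<in> K" "z \<in> ball y (R y)" using K(4) by auto
    then show "z \<in> (\<Union>y\<in>K. N y)" using N(2)[of y] z K(2) by blast
  qed
  ultimately show ?case using Nsets by blast
qed

section \<open>Volumes and primitive matrices\<close>

definition row_minor :: "real mat \<Rightarrow> nat set \<Rightarrow> real" where
  "row_minor A S = Determinant.det (submatrix A S UNIV)"

text \<open>The volume spanned by the columns of \<open>A\<close>, that is, the norm of their wedge product.\<close>

definition vol :: "real mat \<Rightarrow> real" where
  "vol A = sqrt (\<Sum>S\<in>ext_index (dim_row A) (dim_col A). (row_minor A S)\<^sup>2)"

lemma finite_ext_index: "finite (ext_index m i)"
  unfolding ext_index_def by (rule finite_subset[of _ "Pow {..<m}"]) auto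

lemma card_ext_index_le: "card (ext_index m i) \<le> 2 ^ m"
proof -
  have "card (ext_index m i) \<le> card (Pow {..<m})"
    by (rule card_mono) (auto simp: ext_index_def)
  then show ?thesis by (simp add: card_Pow)
qed

lemma submatrix_rows:
  assumes "A \<in> carrier_mat m i" "S \<in> ext_index m k"
  shows "submatrix A S UNIV = Matrix.mat k i (\<lambda>(a, b). A $$ (pick S a, b))"
proof -
  have "{r. r < dim_row A \<and> r \<in> S} = S" using assms by (auto simp: ext_index_def)
  then show ?thesis using assms by (auto simp: submatrix_def pick_UNIV ext_index_def)
qed

lemma pick_ext_index:
  assumes "S \<in> ext_index m i" "a < i"
  shows "pick S a \<in> S" "pick S a < m"
proof -
  show "pick S a \<in> S" using assms by (auto simp: ext_index_def intro: pick_in_set_le)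
  then show "pick S a < m" using assms by (auto simp: ext_index_def)
qed

text \<open>Selecting rows commutes with multiplication on the right. All minors change by the same
  factor under a change of basis, so volumes of matrices with the same column space are compared by
  one determinant.\<close>

lemma row_minor_mult:
  assumes A: "A \<in> carrier_mat m i" and T: "T \<in> carrier_mat i i" and S: "S \<in> ext_index m i"
  shows "row_minor (A * T) S = Determinant.det T * row_minor A S"
proof -
  have "submatrix (A * T) S UNIV = submatrix A S UNIV * T"
  proof (rule eq_matI)
    fix a b assume "a < dim_row (submatrix A S UNIV * T)" "b < dim_col (submatrix A S UNIV * T)"
    then have a: "a < i" and b: "b < i"
      using T by (auto simp: submatrix_rows[OF A S])
    have "row (submatrix A S UNIV) a = row A (pick S a)"
      using pick_ext_index(2)[OF S a] A a by (auto simp: submatrix_rows[OF A S])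
    then show "submatrix (A * T) S UNIV $$ (a, b) = (submatrix A S UNIV * T) $$ (a, b)"
      using pick_ext_index(2)[OF S a] A T a b
      by (simp add: submatrix_rows[OF mult_carrier_mat[OF A T] S] submatrix_rows[OF A S])
  qed (use A T S in \<open>auto simp: submatrix_rows[OF A S] submatrix_rows[OF mult_carrier_mat[OF A T] S]\<close>)
  moreover have "submatrix A S UNIV \<in> carrier_mat i i" by (simp add: submatrix_rows[OF A S])
  ultimately show ?thesis using det_mult[of "submatrix A S UNIV" i T] T
    by (simp add: row_minor_def mult.commute)
qed

lemma vol_nonneg: "vol A \<ge> 0"
  by (simp add: vol_def sum_nonneg)

lemma vol_mult:
  assumes A: "A \<in> carrier_mat m i" and T: "T \<in> carrier_mat i i"
  shows "vol (A * T) = \<bar>Determinant.det T\<bar> * vol A"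
proof -
  have "(\<Sum>S\<in>ext_index m i. (row_minor (A * T) S)\<^sup>2)
      = (Determinant.det T)\<^sup>2 * (\<Sum>S\<in>ext_index m i. (row_minor A S)\<^sup>2)"
    by (simp add: row_minor_mult[OF A T] power_mult_distrib sum_distrib_left)
  then show ?thesis using A T by (simp add: vol_def real_sqrt_mult)
qed

lemma row_minor_le_vol:
  assumes "A \<in> carrier_mat m i" "S \<in> ext_index m i"
  shows "\<bar>row_minor A S\<bar> \<le> vol A"
  using member_le_L2_set[OF finite_ext_index assms(2), of "\<lambda>S. \<bar>row_minor A S\<bar>"] assms(1)
  by (simp add: vol_def L2_set_def)

lemma vol_le_sum:
  assumes "A \<in> carrier_mat m i"
  shows "vol A \<le> (\<Sum>S\<in>ext_index m i. \<bar>row_minor A S\<bar>)"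
  using L2_set_le_sum_abs[of "row_minor A" "ext_index m i"] assms
  by (simp add: vol_def L2_set_def)

lemma vol_eq_0_iff:
  assumes "A \<in> carrier_mat m i"
  shows "vol A = 0 \<longleftrightarrow> (\<forall>S\<in>ext_index m i. row_minor A S = 0)"
  using assms finite_ext_index by (auto simp: vol_def sum_nonneg_eq_0_iff)

lemma vol_square:
  assumes A: "A \<in> carrier_mat m m" shows "vol A = \<bar>Determinant.det A\<bar>"
proof -
  have "S = {..<m}" if "S \<subseteq> {..<m}" "card S = m" for S
    using card_subset_eq[of "{..<m}" S] that by simp
  then have idx: "ext_index m m = {{..<m}}" by (auto simp: ext_index_def)
  have "pick {..<m} a = a" if "a < m" for a
  proof -
    have "{y \<in> {..<m}. y < a} = {..<a}" using that by auto
    then show ?thesis using pick_card_in_set[of a "{..<m}"] that by simp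
  qed
  then have "submatrix A {..<m} UNIV = A"
    using A by (auto simp: submatrix_rows[OF A, of _ m] idx)
  then show ?thesis using A by (simp add: vol_def idx row_minor_def)
qed

text \<open>Reindexing for the Laplace expansion: deleting one element lowers the position of the
  later ones by one.\<close>

lemma pick_Diff_pick:
  assumes "k < card S" "a < card S" "k \<noteq> a"
  shows "pick (S - {pick S a}) (if k < a then k else k - 1) = pick S k"
proof -
  have ne: "pick S k \<noteq> pick S a"
    using assms pick_mono_le[of k S a] pick_mono_le[of a S k] by (cases k a rule: linorder_cases) auto
  have fin: "finite S" using assms(1) by (metis card.infinite not_less_zero)
  have "{y \<in> S - {pick S a}. y < pick S k} = {y \<in> S. y < pick S k} - {pick S a}" by auto
  moreover have "card ({y \<in> S. y < pick S k} - {pick S a}) = (if k < a then k else k - 1)"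
  proof (cases "k < a")
    case True
    then have "pick S k < pick S a" using pick_mono_le assms by blast
    then have "{y \<in> S. y < pick S k} - {pick S a} = {y \<in> S. y < pick S k}" by auto
    then show ?thesis using True card_pick_le[OF assms(1)] by simp
  next
    case False
    then have "pick S a < pick S k" using pick_mono_le[of k S a] assms by auto
    then have "pick S a \<in> {y \<in> S. y < pick S k}" using pick_in_set_le[OF assms(2)] by simp
    then show ?thesis using False card_pick_le[OF assms(1)] fin by (simp add: card_Diff_singleton)
  qed
  ultimately have "card {y \<in> S - {pick S a}. y < pick S k} = (if k < a then k else k - 1)"
    by (simp only:)
  moreover have "pick S k \<in> S - {pick S a}" using ne pick_in_set_le[OF assms(1)] by simp
  ultimately show ?thesis using pick_card_in_set[of "pick S k" "S - {pick S a}"] by (simp only:)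
qed

section \<open>Adjoining a vector as last column\<close>

definition append_col :: "real mat \<Rightarrow> real vec \<Rightarrow> real mat" where
  "append_col A v = Matrix.mat (dim_row A) (Suc (dim_col A))
     (\<lambda>(r, c). if c < dim_col A then A $$ (r, c) else v $ r)"

lemma append_col_carrier: "A \<in> carrier_mat m i \<Longrightarrow> append_col A v \<in> carrier_mat m (Suc i)"
  by (auto simp: append_col_def)

text \<open>Laplace expansion along the last column; deleting the row \<open>pick S a\<close> leaves
  the minor of \<open>A\<close> on the remaining rows.\<close>

lemma row_minor_append_col:
  assumes A: "A \<in> carrier_mat m i" and S: "S \<in> ext_index m (Suc i)"
  shows "row_minor (append_col A v) S
    = (\<Sum>a<Suc i. v $ (pick S a) * ((-1) ^ (a + i) * row_minor A (S - {pick S a})))"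
proof -
  define M where "M = submatrix (append_col A v) S UNIV"
  have M: "M = Matrix.mat (Suc i) (Suc i) (\<lambda>(a, b). append_col A v $$ (pick S a, b))"
    unfolding M_def by (rule submatrix_rows[OF append_col_carrier[OF A] S])
  have cS: "card S = Suc i" using S by (simp add: ext_index_def)
  have "mat_delete M a i = submatrix A (S - {pick S a}) UNIV" if a: "a < Suc i" for a
  proof -
    have S': "S - {pick S a} \<in> ext_index m i"
      using S pick_ext_index(1)[OF S a] by (auto simp: ext_index_def)
    show ?thesis
    proof (rule eq_matI)
      fix k b assume "k < dim_row (submatrix A (S - {pick S a}) UNIV)"
        "b < dim_col (submatrix A (S - {pick S a}) UNIV)"
      then have k: "k < i" and b: "b < i" by (auto simp: submatrix_rows[OF A S'])
      define k' where "k' = (if k < a then k else Suc k)"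
      have k': "k' < Suc i" "k' \<noteq> a" "k = (if k' < a then k' else k' - 1)"
        using k by (auto simp: k'_def)
      have "pick (S - {pick S a}) k = pick S k'"
        using pick_Diff_pick[of k' S a] k' a cS by simp
      then show "mat_delete M a i $$ (k, b) = submatrix A (S - {pick S a}) UNIV $$ (k, b)"
        using k b k'(1) A pick_ext_index(2)[OF S k'(1)]
        by (auto simp: mat_delete_def M submatrix_rows[OF A S'] append_col_def k'_def)
    qed (auto simp: M submatrix_rows[OF A S'])
  qed
  then have "cofactor M a i = (-1) ^ (a + i) * row_minor A (S - {pick S a})" if "a < Suc i" for a
    using that by (simp add: cofactor_def row_minor_def)
  moreover have "M $$ (a, i) = v $ (pick S a)" if "a < Suc i" for a
    using that A pick_ext_index(2)[OF S that] by (simp add: M append_col_def)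
  moreover have "Determinant.det M = (\<Sum>a<Suc i. M $$ (a, i) * cofactor M a i)"
    by (rule laplace_expansion_column) (auto simp: M)
  ultimately show ?thesis unfolding row_minor_def M_def[symmetric] by simp
qed

lemma abs_vec_index_le_norm2:
  assumes "v \<in> carrier_vec m" "k < m" shows "\<bar>v $ k\<bar> \<le> vec_norm2 v"
proof -
  have "(v $ k)\<^sup>2 \<le> (\<Sum>j\<in>{0..<m}. (v $ j)\<^sup>2)" using assms(2) by (intro member_le_sum) auto
  also have "\<dots> = scalar_prod v v" using assms(1) by (simp add: scalar_prod_def power2_eq_square)
  finally show ?thesis unfolding vec_norm2_def by (metis real_sqrt_abs real_sqrt_le_mono)
qed

text \<open>A crude substitute for the sharp bound by \<open>vec_norm2 v * vol A\<close>: there are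
  at most \<open>2 ^ m\<close> minors, each with at most \<open>m\<close> terms in its expansion.
  The loss only enters the final constant.\<close>

lemma vol_append_col_le:
  assumes A: "A \<in> carrier_mat m i" and v: "v \<in> carrier_vec m"
  shows "vol (append_col A v) \<le> 2 ^ m * real m * vec_norm2 v * vol A"
proof -
  have nonneg: "vec_norm2 v * vol A \<ge> 0"
    by (simp add: vec_norm2_def vol_nonneg scalar_prod_def sum_nonneg)
  have "\<bar>row_minor (append_col A v) S\<bar> \<le> m * (vec_norm2 v * vol A)"
    if S: "S \<in> ext_index m (Suc i)" for S
  proof -
    have im: "Suc i \<le> m" using S card_mono[of "{..<m}" S] by (auto simp: ext_index_def)
    have "\<bar>row_minor (append_col A v) S\<bar>
        \<le> (\<Sum>a<Suc i. \<bar>v $ (pick S a) * ((-1) ^ (a + i) * row_minor A (S - {pick S a}))\<bar>)"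
      unfolding row_minor_append_col[OF A S] by (rule sum_abs)
    also have "\<dots> \<le> (\<Sum>a<Suc i. vec_norm2 v * vol A)"
    proof (rule sum_mono)
      fix a assume "a \<in> {..<Suc i}"
      then have a: "a < Suc i" by simp
      have S': "S - {pick S a} \<in> ext_index m i"
        using S pick_ext_index(1)[OF S a] by (auto simp: ext_index_def)
      show "\<bar>v $ (pick S a) * ((-1) ^ (a + i) * row_minor A (S - {pick S a}))\<bar>
          \<le> vec_norm2 v * vol A"
        using abs_vec_index_le_norm2[OF v pick_ext_index(2)[OF S a]] row_minor_le_vol[OF A S']
        by (auto simp: abs_mult power_abs intro!: mult_mono)
    qed
    also have "\<dots> = Suc i * (vec_norm2 v * vol A)" by simp
    also have "\<dots> \<le> m * (vec_norm2 v * vol A)"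
      using im nonneg by (intro mult_right_mono) auto
    finally show ?thesis .
  qed
  then have "vol (append_col A v) \<le> (\<Sum>S\<in>ext_index m (Suc i). m * (vec_norm2 v * vol A))"
    by (intro order_trans[OF vol_le_sum[OF append_col_carrier[OF A]]] sum_mono)
  also have "\<dots> = card (ext_index m (Suc i)) * (m * (vec_norm2 v * vol A))" by simp
  also have "\<dots> \<le> 2 ^ m * (m * (vec_norm2 v * vol A))"
  proof (rule mult_right_mono)
    have "real (card (ext_index m (Suc i))) \<le> real (2 ^ m)"
      by (intro of_nat_mono card_ext_index_le)
    then show "real (card (ext_index m (Suc i))) \<le> 2 ^ m" by simp
  qed (use nonneg in simp)
  finally show ?thesis by (simp add: mult.assoc)
qed

lemma mult_append_col:
  assumes "L \<in> carrier_mat k m" "A \<in> carrier_mat m i" "v \<in> carrier_vec m"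
  shows "L * append_col A v = append_col (L * A) (L *\<^sub>v v)"
proof (rule eq_matI)
  fix r c assume "r < dim_row (append_col (L * A) (L *\<^sub>v v))" "c < dim_col (append_col (L * A) (L *\<^sub>v v))"
  then have r: "r < k" and c: "c < Suc i" using assms by (auto simp: append_col_def)
  have "col (append_col A v) c = (if c < i then col A c else v)"
    using assms c by (auto simp: append_col_def)
  then show "(L * append_col A v) $$ (r, c) = append_col (L * A) (L *\<^sub>v v) $$ (r, c)"
    using assms r c by (auto simp: append_col_def)
qed (use assms in \<open>auto simp: append_col_def\<close>)

lemma append_col_eq_mult:
  assumes "A \<in> carrier_mat m i" "B \<in> carrier_mat m k" "T \<in> carrier_mat k i" "t \<in> carrier_vec k"
    "A = B * T" "v = B *\<^sub>v t"
  shows "append_col A v = B * append_col T t"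
  using mult_append_col[OF assms(2,3,4)] assms(5,6) by simp

lemma append_col_recover:
  assumes "A \<in> carrier_mat m i" "v \<in> carrier_vec m"
  shows "A = append_col A v * Matrix.mat (Suc i) i (\<lambda>(r, c). if r = c then 1 else 0)"
    and "v = append_col A v *\<^sub>v unit_vec (Suc i) i"
proof -
  define E where "E = Matrix.mat (Suc i) i (\<lambda>(r, c). if r = c then (1::real) else 0)"
  show "A = append_col A v * E"
  proof (rule eq_matI)
    fix r c assume "r < dim_row (append_col A v * E)" "c < dim_col (append_col A v * E)"
    then have r: "r < m" and c: "c < i" using assms by (auto simp: append_col_def E_def)
    have "col E c = unit_vec (Suc i) c" using c by (auto simp: E_def unit_vec_def)
    then show "A $$ (r, c) = (append_col A v * E) $$ (r, c)"
      using assms r c by (simp add: append_col_def E_def)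
  qed (use assms in \<open>auto simp: append_col_def E_def\<close>)
  show "v = append_col A v *\<^sub>v unit_vec (Suc i) i"
    by (rule eq_vecI) (use assms in \<open>auto simp: append_col_def\<close>)
qed

text \<open>Let the minor of \<open>A\<close> on \<open>S\<close> be nonzero. Some \<open>w\<close>
  in the column space agrees with \<open>v\<close> on the rows of \<open>S\<close>, and replacing
  \<open>v\<close> by \<open>v - w\<close> keeps the volume zero. The minors on \<open>S\<close>
  with one more row then force \<open>v = w\<close>.\<close>

lemma vol_append_col_nonzero:
  assumes A: "A \<in> carrier_mat m i" and v: "v \<in> carrier_vec m" and vol: "vol A \<noteq> 0"
    and span: "\<And>t. t \<in> carrier_vec i \<Longrightarrow> v \<noteq> A *\<^sub>v t"
  shows "vol (append_col A v) \<noteq> 0"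
proof
  assume zero: "vol (append_col A v) = 0"
  obtain S where S: "S \<in> ext_index m i" "row_minor A S \<noteq> 0"
    using vol vol_eq_0_iff[OF A] by auto
  define B where "B = submatrix A S UNIV"
  have B: "B \<in> carrier_mat i i" and Beq: "B = Matrix.mat i i (\<lambda>(a, b). A $$ (pick S a, b))"
    using submatrix_rows[OF A S(1)] by (simp_all add: B_def)
  have "Determinant.det B \<noteq> 0" using S(2) by (simp add: B_def row_minor_def)
  then have "B \<in> Units (ring_mat TYPE(real) i ())" by (rule det_non_zero_imp_unit[OF B])
  then obtain B' where B': "B' \<in> carrier_mat i i" "B * B' = 1\<^sub>m i"
    by (auto simp: Units_def ring_mat_def)
  define t where "t = B' *\<^sub>v Matrix.vec i (\<lambda>a. v $ (pick S a))"
  have t: "t \<in> carrier_vec i" using B' by (simp add: t_def)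
  have "B *\<^sub>v t = Matrix.vec i (\<lambda>a. v $ (pick S a))"
    unfolding t_def using B B' by (subst assoc_mult_mat_vec[symmetric]) auto
  then have Bt: "(B *\<^sub>v t) $ a = v $ (pick S a)" if "a < i" for a using that by simp
  define w where "w = A *\<^sub>v t"
  have w: "w \<in> carrier_vec m" unfolding w_def using A t by (rule mult_mat_vec_carrier)
  have w_eq: "w $ (pick S a) = v $ (pick S a)" if "a < i" for a
  proof -
    have "row B a = row A (pick S a)"
      using A that pick_ext_index(2)[OF S(1) that] by (auto simp: Beq)
    then show ?thesis
      using Bt[OF that] B A that pick_ext_index(2)[OF S(1) that] by (simp add: w_def)
  qed
  \<comment> \<open>The identity with last column changed to \<open>(-t, 1)\<close>: the column
    operation that turns \<open>v\<close> into \<open>v - w\<close>.\<close>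
  define T where "T = append_col (Matrix.mat (Suc i) i (\<lambda>(r, c). if r = c then (1::real) else 0))
      (Matrix.vec (Suc i) (\<lambda>r. if r < i then - t $ r else 1))"
  have T: "T \<in> carrier_mat (Suc i) (Suc i)" by (simp add: T_def append_col_def)
  have "append_col A (v - w) = append_col A v * T"
  proof -
    have "append_col A v *\<^sub>v Matrix.vec (Suc i) (\<lambda>r. if r < i then - t $ r else 1) = v - w"
    proof (rule eq_vecI)
      fix r assume "r < dim_vec (v - w)"
      then have r: "r < m" using w by simp
      have "(append_col A v *\<^sub>v Matrix.vec (Suc i) (\<lambda>r. if r < i then - t $ r else 1)) $ r
          = (\<Sum>c<Suc i. append_col A v $$ (r, c) * (if c < i then - t $ c else 1))"
        using A r by (simp add: scalar_prod_def append_col_def atLeast0LessThan)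
      also have "\<dots> = (\<Sum>c<i. A $$ (r, c) * (- t $ c)) + v $ r"
        using A r by (simp add: append_col_def)
      also have "(\<Sum>c<i. A $$ (r, c) * (- t $ c)) = - (w $ r)"
        using A r t by (simp add: w_def scalar_prod_def atLeast0LessThan sum_negf)
      finally show "(append_col A v *\<^sub>v Matrix.vec (Suc i) (\<lambda>r. if r < i then - t $ r else 1)) $ r
          = (v - w) $ r" using r w v by simp
    qed (use A w in \<open>auto simp: append_col_def\<close>)
    from append_col_eq_mult[OF A append_col_carrier[OF A, of v] _ _ append_col_recover(1)[OF A v]
        this[symmetric]]
    show ?thesis unfolding T_def by simp
  qed
  then have zero': "vol (append_col A (v - w)) = 0"
    using vol_mult[OF append_col_carrier[OF A] T] zero by simp
  have dz: "(v - w) $ j = 0" if j: "j < m" for j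
  proof (cases "j \<in> S")
    case True
    obtain a where "a < i" "pick S a = j"
    proof -
      have "card {y \<in> S. y < j} < card S"
        using S(1) True by (intro psubset_card_mono) (auto simp: ext_index_def intro: finite_subset)
      then show thesis
        using that[of "card {y \<in> S. y < j}"] pick_card_in_set[OF True] S(1) by (simp add: ext_index_def)
    qed
    then show ?thesis using w_eq[of a] j v w by auto
  next
    case False
    define S' where "S' = insert j S"
    have finS: "finite S" using S(1) by (auto simp: ext_index_def intro: finite_subset)
    have S': "S' \<in> ext_index m (Suc i)"
      using S(1) False j finS by (auto simp: ext_index_def S'_def)
    define a0 where "a0 = card {y \<in> S'. y < j}"
    have a0: "pick S' a0 = j" unfolding a0_def by (rule pick_card_in_set) (simp add: S'_def)
    have "card {y \<in> S'. y < j} < card S'"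
      using finS by (intro psubset_card_mono) (auto simp: S'_def)
    then have a0i: "a0 < Suc i" using S' by (simp add: a0_def ext_index_def)
    have other: "(v - w) $ (pick S' a) = 0" if a: "a < Suc i" "a \<noteq> a0" for a
    proof -
      have cS': "card S' = Suc i" using S' by (simp add: ext_index_def)
      have "pick S' a \<noteq> pick S' a0"
        using a a0i cS' pick_mono_le[of a S' a0] pick_mono_le[of a0 S' a]
        by (cases a a0 rule: linorder_cases) auto
      then have p: "pick S' a \<in> S" using pick_ext_index(1)[OF S' a(1)] a0 by (auto simp: S'_def)
      have "card {y \<in> S. y < pick S' a} < card S"
        using finS p by (intro psubset_card_mono) auto
      then show ?thesis
        using w_eq[of "card {y \<in> S. y < pick S' a}"] pick_card_in_set[OF p] S(1)
          pick_ext_index(2)[OF S' a(1)] v w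
        by (simp add: ext_index_def)
    qed
    \<comment> \<open>The entries of \<open>v - w\<close> in the rows of \<open>S\<close> vanish, so
      the expansion keeps only row \<open>j\<close>, whose cofactor is up to sign the nonzero minor
      on \<open>S\<close>.\<close>
    have "0 = row_minor (append_col A (v - w)) S'"
      using zero' vol_eq_0_iff[OF append_col_carrier[OF A]] S' by simp
    also have "\<dots> = (\<Sum>a<Suc i. (v - w) $ (pick S' a)
        * ((-1) ^ (a + i) * row_minor A (S' - {pick S' a})))"
      by (rule row_minor_append_col[OF A S'])
    also have "\<dots> = (v - w) $ (pick S' a0) * ((-1) ^ (a0 + i) * row_minor A (S' - {pick S' a0}))"
      using a0i other by (subst sum.remove[of _ a0]) auto
    also have "S' - {pick S' a0} = S" by (simp only: a0) (use False in \<open>auto simp: S'_def\<close>)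
    finally show ?thesis using S(2) a0 by simp
  qed
  have "v = w"
  proof (rule eq_vecI)
    show "v $ j = w $ j" if "j < dim_vec w" for j using dz[of j] that v w by simp
  qed (use v w in simp)
  with span[OF t] show False by (simp add: w_def)
qed

section \<open>Integral matrices, column spaces and primitive subgroups\<close>

definition int_mat :: "real mat \<Rightarrow> bool" where
  "int_mat A \<longleftrightarrow> (\<forall>r<dim_row A. \<forall>c<dim_col A. A $$ (r, c) \<in> \<int>)"

lemma row_minor_Ints:
  assumes "int_mat A" "A \<in> carrier_mat m i" "S \<in> ext_index m i"
  shows "row_minor A S \<in> \<int>"
proof -
  have M: "submatrix A S UNIV \<in> carrier_mat i i" by (simp add: submatrix_rows[OF assms(2,3)])
  have "submatrix A S UNIV $$ (a, b) \<in> \<int>" if "a < i" "b < i" for a b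
    using that assms pick_ext_index(2)[OF assms(3)]
    by (auto simp: submatrix_rows[OF assms(2,3)] int_mat_def)
  then have "(\<Prod>a = 0..<i. submatrix A S UNIV $$ (a, p a)) \<in> \<int>" if "p permutes {0..<i}" for p
    using that by (intro Ints_prod) (auto simp: permutes_in_image)
  moreover have "(signof p :: real) \<in> \<int>" for p by (simp add: sign_def)
  ultimately show ?thesis
    unfolding row_minor_def det_def'[OF M] by (intro Ints_sum Ints_mult) auto
qed

lemma int_mat_append_col:
  assumes "int_mat A" "A \<in> carrier_mat m i" "v \<in> int_lattice m"
  shows "int_mat (append_col A v)"
  using assms by (auto simp: int_mat_def append_col_def int_lattice_def)

text \<open>The coefficients in \<open>T\<close> are real, so this compares column spaces. For bases
  of primitive subgroups it amounts to inclusion of the subgroups.\<close>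

definition in_cols :: "real mat \<Rightarrow> real mat \<Rightarrow> bool" where
  "in_cols A B \<longleftrightarrow> (\<exists>T\<in>carrier_mat (dim_col B) (dim_col A). A = B * T)"

lemma in_cols_refl: "in_cols A A"
  unfolding in_cols_def by (intro bexI[of _ "1\<^sub>m (dim_col A)"]) auto

lemma in_cols_trans: "in_cols A B \<Longrightarrow> in_cols B C \<Longrightarrow> in_cols A C"
  unfolding in_cols_def
proof (elim bexE)
  fix T T' assume T: "T \<in> carrier_mat (dim_col B) (dim_col A)" "A = B * T"
    "T' \<in> carrier_mat (dim_col C) (dim_col B)" "B = C * T'"
  have "C * T' * T = C * (T' * T)"
    by (rule assoc_mult_mat[of C "dim_row C" "dim_col C" T' "dim_col B" T "dim_col A"])
       (use T(1,3) in simp_all)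
  then have "A = C * (T' * T)" using T(2,4) by (simp only:)
  moreover have "T' * T \<in> carrier_mat (dim_col C) (dim_col A)"
    using T(3,1) by (rule mult_carrier_mat)
  ultimately show "\<exists>T\<in>carrier_mat (dim_col C) (dim_col A). A = C * T" by blast
qed

text \<open>Strict inequality of the ranks makes the relation irreflexive and keeps different bases
  of one subgroup from occurring in the same chain.\<close>

definition comparable :: "real mat \<Rightarrow> real mat \<Rightarrow> bool" where
  "comparable A B \<longleftrightarrow> (dim_col A < dim_col B \<and> in_cols A B) \<or> (dim_col B < dim_col A \<and> in_cols B A)"

text \<open>No integral matrix with columns in the column space of \<open>A\<close> has smaller volume: the columns of
  \<open>A\<close> generate a primitive subgroup.\<close>

definition primitive_mat :: "real mat \<Rightarrow> bool" where
  "primitive_mat A \<longleftrightarrow> (\<forall>T\<in>carrier_mat (dim_col A) (dim_col A).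
     int_mat (A * T) \<longrightarrow> Determinant.det T \<noteq> 0 \<longrightarrow> 1 \<le> \<bar>Determinant.det T\<bar>)"

lemma ex_inverse_mat:
  assumes "T \<in> carrier_mat i i" "Determinant.det T \<noteq> (0 :: real)"
  obtains T' where "T' \<in> carrier_mat i i" "T * T' = 1\<^sub>m i"
proof -
  have "T \<in> Units (ring_mat TYPE(real) i ())" by (rule det_non_zero_imp_unit[OF assms])
  then show thesis using that by (auto simp: Units_def ring_mat_def)
qed

text \<open>On a fixed row set \<open>S\<close> where \<open>N\<close> has a nonzero minor, the
  minor of an admissible \<open>N * T\<close> is an integer proportional to the determinant of
  \<open>T\<close>. Hence the absolute value of this determinant has a minimum, and a minimiser is
  primitive. The identity is admissible, whence the bound 1.\<close>

lemma ex_primitive_mat: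
  assumes N: "N \<in> carrier_mat m i" "int_mat N" and vol: "vol N \<noteq> 0"
  obtains T where "T \<in> carrier_mat i i" "Determinant.det T \<noteq> 0" "\<bar>Determinant.det T\<bar> \<le> 1"
    "int_mat (N * T)" "primitive_mat (N * T)"
proof -
  obtain S where S: "S \<in> ext_index m i" "row_minor N S \<noteq> 0"
    using vol vol_eq_0_iff[OF N(1)] by auto
  define P where "P T \<longleftrightarrow> T \<in> carrier_mat i i \<and> Determinant.det T \<noteq> 0 \<and> int_mat (N * T)" for T
  define f where "f T = nat \<lfloor>\<bar>row_minor (N * T) S\<bar>\<rfloor>" for T
  have f: "real (f T) = \<bar>Determinant.det T\<bar> * \<bar>row_minor N S\<bar>" if "P T" for T
  proof -
    have "row_minor (N * T) S \<in> \<int>"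
      using that N(1) S(1) by (intro row_minor_Ints[of _ m i]) (auto simp: P_def)
    then have "real (f T) = \<bar>row_minor (N * T) S\<bar>" by (auto simp: f_def elim!: Ints_cases)
    then show ?thesis using row_minor_mult[OF N(1) _ S(1)] that by (simp add: P_def abs_mult)
  qed
  have P1: "P (1\<^sub>m i)" using N by (simp add: P_def)
  obtain T where T: "P T" "\<And>T'. P T' \<Longrightarrow> f T \<le> f T'"
    using ex_has_least_nat[of P "1\<^sub>m i" f] P1 by blast
  have le: "\<bar>Determinant.det T\<bar> \<le> \<bar>Determinant.det T'\<bar>" if "P T'" for T'
  proof -
    have "real (f T) \<le> real (f T')" using T(2)[OF that] by simp
    then show ?thesis unfolding f[OF T(1)] f[OF that] using S(2) by simp
  qed
  have Tc: "T \<in> carrier_mat i i" using T(1) by (simp add: P_def)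
  have "1 \<le> \<bar>Determinant.det T'\<bar>"
    if T': "T' \<in> carrier_mat i i" "int_mat (N * T * T')" "Determinant.det T' \<noteq> 0" for T'
  proof -
    have "P (T * T')"
      using T(1) T' N(1) mult_carrier_mat[OF Tc T'(1)] det_mult[OF Tc T'(1)] assoc_mult_mat[OF N(1) Tc T'(1)]
      by (simp add: P_def)
    from le[OF this] show ?thesis
      using det_mult[OF Tc T'(1)] T(1) by (simp add: P_def abs_mult mult_le_cancel_left1)
  qed
  then have "primitive_mat (N * T)" using N(1) Tc by (auto simp: primitive_mat_def)
  with that[OF Tc] T(1) le[OF P1] show thesis by (simp add: P_def)
qed

text \<open>All bases of a subgroup are included, not one representative. The ranks 0 and
  \<open>n + 1\<close> are left out; the flag argument treats them directly.\<close>

definition sublattices :: "nat \<Rightarrow> real mat set" where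
  "sublattices n = {A. \<exists>i. 1 \<le> i \<and> i \<le> n \<and> A \<in> carrier_mat (n + 1) i \<and> int_mat A \<and> vol A \<noteq> 0
     \<and> primitive_mat A}"

text \<open>A nonzero integral determinant has absolute value at least 1, and \<open>L\<close>
  preserves it. This settles rank \<open>n + 1\<close>.\<close>

lemma vol_mult_ge_1:
  assumes "L \<in> carrier_mat m m" "\<bar>Determinant.det L\<bar> = 1" "N \<in> carrier_mat m m" "int_mat N" "vol N \<noteq> 0"
  shows "vol (L * N) \<ge> 1"
proof -
  obtain S where S: "S \<in> ext_index m m" "row_minor N S \<noteq> 0"
    using assms(5) vol_eq_0_iff[OF assms(3)] by auto
  then have "1 \<le> \<bar>row_minor N S\<bar>"
    using row_minor_Ints[OF assms(4,3) S(1)] by (intro Ints_nonzero_abs_ge1) auto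
  also have "\<dots> \<le> vol N" by (rule row_minor_le_vol[OF assms(3) S(1)])
  also have "\<dots> = vol (L * N)"
    using assms(1-3) by (simp add: vol_square[of _ m] det_mult abs_mult)
  finally show ?thesis .
qed

text \<open>A new vector \<open>v\<close> sits between two consecutive members of the flag. Adjoining it to the lower one
  gives a subgroup comparable with the whole flag, hence of volume at least \<open>\<epsilon>\<close>, whereas the lower
  one has volume at most 1.\<close>

lemma flag_imp_no_short_vector:
  assumes L: "L \<in> carrier_mat (n + 1) (n + 1)" "\<bar>Determinant.det L\<bar> = 1"
    and \<epsilon>: "\<epsilon> \<le> \<rho>" "\<rho> \<le> 1"
    and F: "F \<subseteq> sublattices n" "finite F" "pairwise comparable F"
    and bd: "\<And>A. A \<in> F \<Longrightarrow> \<epsilon> \<le> vol (L * A) \<and> vol (L * A) \<le> \<rho>"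
    and ext: "\<And>A. A \<in> sublattices n - F \<Longrightarrow> (\<And>B. B \<in> F \<Longrightarrow> comparable B A) \<Longrightarrow> \<rho> \<le> vol (L * A)"
    and v: "v \<in> int_lattice (n + 1)" "v \<noteq> 0\<^sub>v (n + 1)"
  shows "\<epsilon> \<le> 2 ^ (n + 1) * real (n + 1) * vec_norm2 (L *\<^sub>v v)"
proof -
  define m where "m = n + 1"
  define contains where "contains A \<longleftrightarrow> (\<exists>t\<in>carrier_vec (dim_col A). v = A *\<^sub>v t)" for A
  \<comment> \<open>The lower part of the flag: the members whose column space misses
    \<open>v\<close>. Its largest member becomes \<open>A0\<close>, and all members outside
    \<open>F0\<close> lie strictly above \<open>A0\<close>.\<close>
  define F0 where "F0 = {A \<in> F. \<not> contains A}"
  have vc: "v \<in> carrier_vec m" using v by (simp add: int_lattice_def m_def)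
  have cols_contains: "contains B" if "contains A" "in_cols A B" "A \<in> carrier_mat m (dim_col A)"
    "B \<in> carrier_mat m (dim_col B)" for A B
  proof -
    obtain t T where t: "t \<in> carrier_vec (dim_col A)" "v = A *\<^sub>v t"
      "T \<in> carrier_mat (dim_col B) (dim_col A)" "A = B * T"
      using \<open>contains A\<close> \<open>in_cols A B\<close> unfolding contains_def in_cols_def by blast
    have "B * T *\<^sub>v t = B *\<^sub>v (T *\<^sub>v t)" using that(4) t(3,1) by (rule assoc_mult_mat_vec)
    then have "v = B *\<^sub>v (T *\<^sub>v t)" unfolding t(4)[symmetric] t(2)[symmetric] .
    then show ?thesis unfolding contains_def using mult_mat_vec_carrier[OF t(3,1)] by blast
  qed
  have Fc: "A \<in> carrier_mat m (dim_col A)" "int_mat A" "vol A \<noteq> 0" "1 \<le> dim_col A" "dim_col A \<le> n"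
    "primitive_mat A" if "A \<in> F" for A
    using F(1) that by (auto simp: sublattices_def m_def)
  have "\<exists>A0. A0 \<in> carrier_mat m (dim_col A0) \<and> int_mat A0 \<and> vol A0 \<noteq> 0 \<and> dim_col A0 \<le> n \<and>
     \<not> contains A0 \<and> vol (L * A0) \<le> 1 \<and> (\<forall>A\<in>F0. dim_col A \<le> dim_col A0 \<and> in_cols A A0) \<and>
     (\<forall>B\<in>F - F0. dim_col A0 < dim_col B \<and> in_cols A0 B)"
  proof (cases "F0 = {}")
    case True
    \<comment> \<open>The matrix without columns stands for the zero subgroup. Its only minor is the
      empty determinant, so its volume is 1.\<close>
    define A0 :: "real mat" where "A0 = Matrix.mat m 0 (\<lambda>_. 0)"
    have vol0: "vol A = 1" if "A \<in> carrier_mat m 0" for A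
    proof -
      have "S = {}" if "S \<subseteq> {..<m}" "card S = 0" for S
        using finite_subset[OF that(1)] that(2) by simp
      then have idx: "ext_index m 0 = {{}}" by (auto simp: ext_index_def)
      have "submatrix A {} UNIV \<in> carrier_mat 0 0" using that by (auto simp: submatrix_def)
      then show ?thesis using that by (simp add: vol_def idx row_minor_def)
    qed
    have "\<not> contains A0"
    proof
      assume "contains A0"
      then obtain t where "t \<in> carrier_vec 0" "v = A0 *\<^sub>v t" by (auto simp: contains_def A0_def)
      then have "v = 0\<^sub>v m" by (auto simp: A0_def scalar_prod_def)
      then show False using v(2) by (simp add: m_def)
    qed
    moreover have "in_cols A0 B" if "B \<in> F" for B
    proof -
      have "dim_row B = m" using Fc(1)[OF that] by (rule carrier_matD)
      then have "A0 = B * Matrix.mat (dim_col B) 0 (\<lambda>_. 0)"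
        by (intro eq_matI) (simp_all add: A0_def)
      moreover have "Matrix.mat (dim_col B) 0 (\<lambda>_. 0) \<in> carrier_mat (dim_col B) (dim_col A0)"
        by (simp add: A0_def)
      ultimately show ?thesis unfolding in_cols_def by blast
    qed
    moreover have "A0 \<in> carrier_mat m 0" "L * A0 \<in> carrier_mat m 0"
      using L(1) by (auto simp: A0_def m_def)
    ultimately show ?thesis
      using True Fc(4) vol0 by (intro exI[of _ A0]) (simp add: A0_def int_mat_def Suc_le_eq)
  next
    case False
    have "finite F0" using F(2) by (simp add: F0_def)
    then have "Max (dim_col ` F0) \<in> dim_col ` F0" using False by (intro Max_in) auto
    then obtain A0 where A0: "A0 \<in> F0" "dim_col A0 = Max (dim_col ` F0)" by force
    have max: "dim_col A \<le> dim_col A0" if "A \<in> F0" for A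
      unfolding A0(2) using that \<open>finite F0\<close> by (intro Max_ge) auto
    have A0F: "A0 \<in> F" "\<not> contains A0" using A0(1) by (auto simp: F0_def)
    have "in_cols A A0" if "A \<in> F0" for A
    proof (cases "A = A0")
      case False
      then have "comparable A A0" using F(3) A0F(1) that by (auto simp: pairwise_def F0_def)
      then show ?thesis using max[OF that] by (auto simp: comparable_def)
    qed (simp add: in_cols_refl)
    moreover have "dim_col A0 < dim_col B \<and> in_cols A0 B" if "B \<in> F - F0" for B
    proof -
      have B: "B \<in> F" "contains B" using that by (auto simp: F0_def)
      then have "comparable A0 B" using F(3) A0F by (auto simp: pairwise_def)
      moreover have "\<not> in_cols B A0" using cols_contains[OF B(2)] A0F Fc(1) B(1) by blast
      ultimately show ?thesis by (auto simp: comparable_def)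
    qed
    moreover have "vol (L * A0) \<le> 1" using bd[OF A0F(1)] \<epsilon> by linarith
    ultimately show ?thesis using max A0F(2) Fc[OF A0F(1)] by blast
  qed
  then obtain A0 where A0: "A0 \<in> carrier_mat m (dim_col A0)" "int_mat A0" "vol A0 \<noteq> 0"
    "dim_col A0 \<le> n" "\<not> contains A0" "vol (L * A0) \<le> 1"
    and below: "\<And>A. A \<in> F0 \<Longrightarrow> dim_col A \<le> dim_col A0 \<and> in_cols A A0"
    and above: "\<And>B. B \<in> F - F0 \<Longrightarrow> dim_col A0 < dim_col B \<and> in_cols A0 B"
    by blast
  define i where "i = dim_col A0"
  define N where "N = append_col A0 v"
  have A0c: "A0 \<in> carrier_mat m i" unfolding i_def by (rule A0(1))
  have N: "N \<in> carrier_mat m (Suc i)" unfolding N_def by (rule append_col_carrier[OF A0c])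
  have dN: "dim_col N = Suc i" using N by (rule carrier_matD)
  have Nint: "int_mat N" unfolding N_def using int_mat_append_col[OF A0(2) A0c] v(1) by (simp add: m_def)
  have Nvol: "vol N \<noteq> 0"
    unfolding N_def using A0(5) by (intro vol_append_col_nonzero[OF A0c vc A0(3)])
      (auto simp: contains_def i_def)
  have A0N: "in_cols A0 N"
    unfolding in_cols_def using append_col_recover(1)[OF A0c vc] N A0c
    by (intro bexI[of _ "Matrix.mat (Suc i) i (\<lambda>(r, c). if r = c then 1 else 0)"]) (auto simp: N_def)
  have Ncont: "contains N"
    unfolding contains_def using append_col_recover(2)[OF A0c vc] N
    by (intro bexI[of _ "unit_vec (Suc i) i"]) (auto simp: N_def)
  have NB: "in_cols N B" if BF: "B \<in> F - F0" for B
  proof -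
    have B: "B \<in> F" "contains B" using BF by (auto simp: F0_def)
    obtain T where T: "T \<in> carrier_mat (dim_col B) i" "A0 = B * T"
      using above[OF BF] by (auto simp: in_cols_def i_def)
    obtain t where t: "t \<in> carrier_vec (dim_col B)" "v = B *\<^sub>v t"
      using B(2) unfolding contains_def by blast
    have "N = B * append_col T t"
      unfolding N_def by (rule append_col_eq_mult[OF A0c Fc(1)[OF B(1)] T(1) t(1) T(2) t(2)])
    then show ?thesis unfolding in_cols_def dN using append_col_carrier[OF T(1)] by blast
  qed
  have "\<epsilon> \<le> vol (L * N)"
  proof -
    \<comment> \<open>In \<open>same\<close> a flag member has the column space of \<open>N\<close>,
      and its primitivity bounds its volume by that of \<open>N\<close>. In \<open>full\<close> the
      matrix \<open>N\<close> is square with nonzero integral determinant. In \<open>new\<close> a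
      primitive matrix with this column space could extend the flag, so its volume is at least
      \<open>\<rho>\<close>, and it is at most that of \<open>N\<close>.\<close>
    consider (same) B where "B \<in> F - F0" "dim_col B = Suc i" | (full) "Suc i = m"
      | (new) "Suc i \<le> n" "\<And>B. B \<in> F - F0 \<Longrightarrow> dim_col B \<noteq> Suc i"
      using A0(4) by (fastforce simp: i_def m_def)
    then show ?thesis
    proof cases
      case same
      then have B: "B \<in> F" "primitive_mat B" using Fc by auto
      have Bc: "B \<in> carrier_mat m (Suc i)" using Fc(1)[OF B(1)] unfolding same(2) .
      obtain T where T: "T \<in> carrier_mat (Suc i) (Suc i)" "N = B * T"
        using NB[OF same(1)] unfolding in_cols_def dN same(2) by blast
      have "Determinant.det T \<noteq> 0" using Nvol vol_mult[OF Bc T(1)] T(2) by auto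
      then have "1 \<le> \<bar>Determinant.det T\<bar>"
        using B(2) T Nint same(2) by (auto simp: primitive_mat_def)
      then have "1 * vol (L * B) \<le> \<bar>Determinant.det T\<bar> * vol (L * B)"
        by (intro mult_right_mono vol_nonneg)
      also have "\<dots> = vol (L * B * T)"
        using L(1) Bc T(1) by (subst vol_mult[of "L * B" m "Suc i"]) (auto simp: m_def)
      also have "L * B * T = L * N"
        using L(1) Bc T by (simp add: m_def assoc_mult_mat[of L "n + 1" "n + 1" B "Suc i"])
      finally show ?thesis using bd[OF B(1)] by simp
    next
      case full
      then have "1 \<le> vol (L * N)"
        using vol_mult_ge_1[OF L] N Nint Nvol by (simp add: m_def)
      then show ?thesis using \<epsilon> by linarith
    next
      case new
      obtain T where T: "T \<in> carrier_mat (Suc i) (Suc i)" "Determinant.det T \<noteq> 0"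
        "\<bar>Determinant.det T\<bar> \<le> 1" "int_mat (N * T)" "primitive_mat (N * T)"
        by (rule ex_primitive_mat[OF N Nint Nvol])
      define P where "P = N * T"
      have P: "P \<in> carrier_mat m (Suc i)" using N T(1) by (simp add: P_def)
      have dP: "dim_col P = Suc i" using P by (rule carrier_matD)
      have PN: "in_cols P N" unfolding in_cols_def dN dP using T(1) P_def by blast
      obtain T' where T': "T' \<in> carrier_mat (Suc i) (Suc i)" "T * T' = 1\<^sub>m (Suc i)"
        by (rule ex_inverse_mat[OF T(1,2)])
      have "N = P * T'" using assoc_mult_mat[OF N T(1) T'(1)] T'(2) N by (simp add: P_def)
      then have NP: "in_cols N P" unfolding in_cols_def dN dP using T'(1) by blast
      have "P \<in> sublattices n"
      proof -
        have "vol P \<noteq> 0" using Nvol vol_mult[OF N T(1)] T(2) by (simp add: P_def)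
        then show ?thesis
          unfolding sublattices_def using P T(4,5) new(1) by (auto simp: P_def[symmetric] m_def)
      qed
      moreover have "P \<notin> F"
      proof
        assume "P \<in> F"
        moreover have "contains P"
          using cols_contains[OF Ncont NP] N P unfolding dN dP by blast
        ultimately show False using new(2)[of P] dP by (auto simp: F0_def)
      qed
      moreover have "comparable A P" if "A \<in> F" for A
      proof (cases "A \<in> F0")
        case True
        then have "in_cols A P" using below[OF True] in_cols_trans A0N NP by blast
        then show ?thesis using below[OF True] dP by (auto simp: comparable_def i_def)
      next
        case False
        then have "A \<in> F - F0" using that by blast
        then have "in_cols P A" "Suc i < dim_col A"
          using in_cols_trans[OF PN NB] above[of A] new(2)[of A] by (auto simp: i_def)
        then show ?thesis using dP by (auto simp: comparable_def)
      qed
      ultimately have "\<rho> \<le> vol (L * P)" by (intro ext) auto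
      also have "L * P = L * N * T"
        using L(1) N T(1) by (simp add: P_def m_def assoc_mult_mat[of L "n + 1" "n + 1" N "Suc i"])
      also have "vol (L * N * T) = \<bar>Determinant.det T\<bar> * vol (L * N)"
        using L(1) N T(1) by (intro vol_mult[of "L * N" m "Suc i"]) (auto simp: m_def)
      also have "\<dots> \<le> 1 * vol (L * N)" using T(3) by (intro mult_right_mono vol_nonneg)
      finally show ?thesis using \<epsilon> by simp
    qed
  qed
  also have "L * N = append_col (L * A0) (L *\<^sub>v v)"
    unfolding N_def using L(1) A0c vc by (intro mult_append_col) (auto simp: m_def)
  also have "vol \<dots> \<le> 2 ^ m * real m * vec_norm2 (L *\<^sub>v v) * vol (L * A0)"
    using L(1) A0c vc by (intro vol_append_col_le[of _ m i]) (auto simp: m_def)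
  also have "\<dots> \<le> 2 ^ m * real m * vec_norm2 (L *\<^sub>v v) * 1"
    using A0(6) by (intro mult_left_mono) (auto simp: vec_norm2_def scalar_prod_def sum_nonneg)
  finally show ?thesis by (simp add: m_def)
qed

section \<open>The matrices as functions of x\<close>

text \<open>The inductive form yields the closure properties without handling coefficients; these
  are extracted only once \<open>B\<close> is finite.\<close>

inductive lin_span :: "(real \<Rightarrow> real) set \<Rightarrow> (real \<Rightarrow> real) \<Rightarrow> bool" for B where
  lin_span_zero: "lin_span B (\<lambda>x. 0)"
| lin_span_step: "lin_span B f \<Longrightarrow> b \<in> B \<Longrightarrow> lin_span B (\<lambda>x. c * b x + f x)"

lemma lin_span_base: "b \<in> B \<Longrightarrow> lin_span B b"
  using lin_span_step[OF lin_span_zero, of b B 1] by simp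

lemma lin_span_add: "lin_span B f \<Longrightarrow> lin_span B g \<Longrightarrow> lin_span B (\<lambda>x. f x + g x)"
proof (induction rule: lin_span.induct)
  case (lin_span_step f b c)
  then show ?case using lin_span.lin_span_step[of B "\<lambda>x. f x + g x" b c] by (simp add: add.assoc)
qed simp

lemma lin_span_scale: "lin_span B f \<Longrightarrow> lin_span B (\<lambda>x. k * f x)"
proof (induction rule: lin_span.induct)
  case lin_span_zero
  show ?case using lin_span.lin_span_zero by simp
next
  case (lin_span_step f b c)
  then show ?case using lin_span.lin_span_step[of B "\<lambda>x. k * f x" b "k * c"]
    by (simp add: distrib_left mult.assoc)
qed

lemma lin_span_sum: "(\<And>i. i \<in> A \<Longrightarrow> lin_span B (f i)) \<Longrightarrow> lin_span B (\<lambda>x. \<Sum>i\<in>A. f i x)"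
  by (induction A rule: infinite_finite_induct) (auto intro: lin_span_zero lin_span_add)

lemma lin_span_mono: "lin_span B f \<Longrightarrow> B \<subseteq> C \<Longrightarrow> lin_span C f"
  by (induction rule: lin_span.induct) (auto intro: lin_span.intros)

lemma lin_span_coeffs:
  assumes "lin_span B f" "finite B"
  obtains a where "f = (\<lambda>x. \<Sum>b\<in>B. a b * b x)"
proof -
  have "\<exists>a. f = (\<lambda>x. \<Sum>b\<in>B. a b * b x)" using assms(1)
  proof (induction rule: lin_span.induct)
    case lin_span_zero
    show ?case by (intro exI[of _ "\<lambda>_. 0"]) simp
  next
    case (lin_span_step f b c)
    then obtain a where a: "f = (\<lambda>x. \<Sum>b\<in>B. a b * b x)" by blast
    define a' where "a' d = a d + (if d = b then c else 0)" for d
    have "(\<Sum>d\<in>B. a' d * d x) = c * b x + f x" for x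
    proof -
      have "(\<Sum>d\<in>B. (if d = b then c else 0) * d x) = (\<Sum>d\<in>B. if d = b then c * d x else 0)"
        by (intro sum.cong) auto
      then show ?thesis
        using lin_span_step.hyps(2) assms(2)
        by (simp add: a'_def distrib_right sum.distrib a sum.delta)
    qed
    then show ?case by (intro exI[of _ a']) simp
  qed
  then show thesis using that by blast
qed

lemma lin_span_mult:
  assumes "lin_span B f" "lin_span C g"
  shows "lin_span {\<lambda>x. b x * c x |b c. b \<in> B \<and> c \<in> C} (\<lambda>x. f x * g x)" (is "lin_span ?P _")
  using assms(1)
proof (induction rule: lin_span.induct)
  case lin_span_zero
  show ?case using lin_span.lin_span_zero by simp
next
  case (lin_span_step f b k)
  have "lin_span ?P (\<lambda>x. b x * g x)"
    using assms(2)
  proof (induction rule: lin_span.induct)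
    case lin_span_zero
    show ?case using lin_span.lin_span_zero by simp
  next
    case (lin_span_step g c k)
    have "(\<lambda>x. b x * c x) \<in> ?P" using \<open>b \<in> B\<close> lin_span_step.hyps(2) by blast
    from lin_span.lin_span_step[OF lin_span_step.IH this, of k]
    show ?case by (simp add: algebra_simps)
  qed
  from lin_span_add[OF lin_span_scale[OF this, of k] lin_span_step.IH]
  show ?case by (simp add: algebra_simps)
qed

primrec products :: "(real \<Rightarrow> real) set \<Rightarrow> nat \<Rightarrow> (real \<Rightarrow> real) set" where
  "products B 0 = {\<lambda>x. 1}"
| "products B (Suc k) = {\<lambda>x. b x * p x |b p. b \<in> B \<and> p \<in> products B k}"

lemma finite_products: "finite B \<Longrightarrow> finite (products B k)"
proof (induction k)
  case (Suc k)
  have "products B (Suc k) = (\<lambda>(b, p). \<lambda>x. b x * p x) ` (B \<times> products B k)"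
    by force
  then show ?case using Suc by simp
qed simp

lemma power_series_at_products:
  "(\<And>b. b \<in> B \<Longrightarrow> power_series_at b x0) \<Longrightarrow> p \<in> products B k \<Longrightarrow> power_series_at p x0"
  by (induction k arbitrary: p) (auto intro: power_series_at_const power_series_at_mult)

lemma lin_span_prod:
  assumes "\<And>a. a < k \<Longrightarrow> lin_span B (f a)"
  shows "lin_span (products B k) (\<lambda>x. \<Prod>a<k. f a x)"
  using assms
proof (induction k)
  case 0
  show ?case using lin_span_base[of "\<lambda>x. 1"] by simp
next
  case (Suc k)
  have "lin_span (products B (Suc k)) (\<lambda>x. f k x * (\<Prod>a<k. f a x))"
    unfolding products.simps by (intro lin_span_mult Suc.prems Suc.IH) auto
  then show ?case by (simp add: mult.commute)
qed

lemma continuous_on_lin_span: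
  assumes "lin_span B f" "\<And>b. b \<in> B \<Longrightarrow> continuous_on D b"
  shows "continuous_on D f"
  using assms by (induction rule: lin_span.induct) (auto intro!: continuous_intros)

section \<open>The entries and minors of the matrices\<close>

definition u_entry :: "(real \<Rightarrow> real vec) \<Rightarrow> nat \<Rightarrow> nat \<Rightarrow> real \<Rightarrow> real" where
  "u_entry \<phi> r c x = (if r = c then 1 else if r = 0 then \<phi> x $ (c - 1) else 0)"

text \<open>Indices start at 0: column \<open>c\<close> belongs to coordinate \<open>c - 1\<close>
  of \<open>\<phi>\<close>, which stands in row 0 of \<open>u_mat\<close>, and for
  \<open>2 \<le> c\<close> its derivative stands in row 1 of \<open>z_mat\<close>.\<close>

definition z_entry :: "(real \<Rightarrow> real vec) \<Rightarrow> nat \<Rightarrow> nat \<Rightarrow> real \<Rightarrow> real" where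
  "z_entry \<phi> r c x = (if r = 1 \<and> 2 \<le> c then deriv (\<lambda>t. \<phi> t $ (c - 1)) x
     else if r = c then 1 else 0)"

definition zu_entry :: "nat \<Rightarrow> (real \<Rightarrow> real vec) \<Rightarrow> nat \<Rightarrow> nat \<Rightarrow> real \<Rightarrow> real" where
  "zu_entry n \<phi> r c x = (\<Sum>k<n + 1. z_entry \<phi> r k x * u_entry \<phi> k c x)"

lemma u_mat_eq:
  assumes "\<phi> x \<in> carrier_vec n"
  shows "u_mat (\<phi> x) = Matrix.mat (n + 1) (n + 1) (\<lambda>(r, c). u_entry \<phi> r c x)"
  using assms
  by (intro eq_matI) (auto simp: u_mat_def Let_def u_entry_def mat_of_rows_def)

lemma z_mat_eq:
  assumes "n \<ge> 1"
  shows "z_mat n \<phi> x = Matrix.mat (n + 1) (n + 1) (\<lambda>(r, c). z_entry \<phi> r c x)"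
proof -
  have *: "Suc (j - 2) = j - Suc 0" if "2 \<le> j" for j using that by simp
  show ?thesis
    using assms by (intro eq_matI) (auto simp: z_mat_def u1_mat_def psi_def z_entry_def *)
qed

lemma det_triangular_ones:
  assumes "A \<in> carrier_mat m m" "\<And>r c. c < r \<Longrightarrow> r < m \<Longrightarrow> A $$ (r, c) = 0"
  shows "Determinant.det A = (\<Prod>r = 0..<m. (A $$ (r, r) :: real))"
proof -
  have "upper_triangular A" using assms by (auto simp: upper_triangular_def)
  then show ?thesis using assms(1) by (simp add: det_upper_triangular prod_list_diag_prod)
qed

lemma gzu_carrier:
  assumes "n \<ge> 1" "\<phi> x \<in> carrier_vec n" "\<tau> \<in> carrier_vec (n + 1)"
  shows "gzu n \<phi> \<tau> x \<in> carrier_mat (n + 1) (n + 1)"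
proof -
  have "g_mat \<tau> \<in> carrier_mat (n + 1) (n + 1)" using assms(3) by (auto simp: g_mat_def mat_diag_def)
  then show ?thesis unfolding gzu_def
    by (intro mult_carrier_mat) (auto simp: u_mat_eq[of \<phi> x n, OF assms(2)] z_mat_eq[OF assms(1)])
qed

text \<open>The diagonal factor only scales the rows, so \<tau> enters each entry through a factor
  that is constant in \<open>x\<close>.\<close>

lemma gzu_index:
  assumes "n \<ge> 1" "\<phi> x \<in> carrier_vec n" "\<tau> \<in> carrier_vec (n + 1)" "r < n + 1" "c < n + 1"
  shows "gzu n \<phi> \<tau> x $$ (r, c) = exp (\<tau> $ r) * zu_entry n \<phi> r c x"
proof -
  define Z where "Z = z_mat n \<phi> x"
  define M where "M = u_mat (\<phi> x)"
  have Z: "Z \<in> carrier_mat (n + 1) (n + 1)" and M: "M \<in> carrier_mat (n + 1) (n + 1)"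
    by (simp_all add: Z_def M_def u_mat_eq[of \<phi> x n, OF assms(2)] z_mat_eq[OF assms(1)])
  have g: "g_mat \<tau> = mat_diag (n + 1) (\<lambda>i. exp (\<tau> $ i))" using assms(3) by (simp add: g_mat_def)
  have "gzu n \<phi> \<tau> x = g_mat \<tau> * (Z * M)"
    unfolding gzu_def Z_def[symmetric] M_def[symmetric] g by (rule assoc_mult_mat[OF mat_diag_dim Z M])
  also have "\<dots> = Matrix.mat (n + 1) (n + 1) (\<lambda>(i, j). exp (\<tau> $ i) * (Z * M) $$ (i, j))"
    unfolding g using Z M by (intro mat_diag_mult_left) auto
  finally have "gzu n \<phi> \<tau> x $$ (r, c) = exp (\<tau> $ r) * (Z * M) $$ (r, c)" using assms(4,5) by simp
  also have "(Z * M) $$ (r, c) = zu_entry n \<phi> r c x"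
    using assms(4,5) by (simp add: Z_def M_def u_mat_eq[of \<phi> x n, OF assms(2)] z_mat_eq[OF assms(1)]
      scalar_prod_def zu_entry_def atLeast0LessThan del: sum.lessThan_Suc)
  finally show ?thesis .
qed

lemma det_gzu:
  assumes "n \<ge> 1" "\<phi> x \<in> carrier_vec n" "\<tau> \<in> carrier_vec (n + 1)" "(\<Sum>k<n + 1. \<tau> $ k) = 0"
  shows "Determinant.det (gzu n \<phi> \<tau> x) = 1"
proof -
  have g: "g_mat \<tau> = mat_diag (n + 1) (\<lambda>i. exp (\<tau> $ i))" using assms(3) by (simp add: g_mat_def)
  have "Determinant.det (g_mat \<tau>) = (\<Prod>r = 0..<n + 1. exp (\<tau> $ r))"
    unfolding g by (subst det_triangular_ones[of _ "n + 1"]) (auto simp: mat_diag_def)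
  also have "\<dots> = 1" using assms(4) by (simp add: exp_sum[symmetric] atLeast0LessThan del: sum.lessThan_Suc prod.lessThan_Suc)
  finally have dg: "Determinant.det (g_mat \<tau>) = 1" .
  have dz: "Determinant.det (z_mat n \<phi> x) = 1"
    unfolding z_mat_eq[OF assms(1)]
    by (subst det_triangular_ones[of _ "n + 1"]) (auto simp: z_entry_def intro!: prod.neutral)
  have du: "Determinant.det (u_mat (\<phi> x)) = 1"
    unfolding u_mat_eq[of \<phi> x n, OF assms(2)]
    by (subst det_triangular_ones[of _ "n + 1"]) (auto simp: u_entry_def intro!: prod.neutral)
  have c: "g_mat \<tau> \<in> carrier_mat (n + 1) (n + 1)" "z_mat n \<phi> x \<in> carrier_mat (n + 1) (n + 1)"
    "u_mat (\<phi> x) \<in> carrier_mat (n + 1) (n + 1)"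
    by (simp_all add: g u_mat_eq[of \<phi> x n, OF assms(2)] z_mat_eq[OF assms(1)])
  then show ?thesis unfolding gzu_def
    using det_mult[OF c(1,2)] det_mult[OF mult_carrier_mat[OF c(1,2)] c(3)] dg dz du by simp
qed

lemma real_analytic_on_imp_power_series_at:
  assumes "real_analytic_on f U" "open U" "x0 \<in> U"
  shows "power_series_at f x0"
proof -
  obtain r a where r: "r > 0" and a: "\<And>y. y \<in> ball x0 r \<inter> U \<Longrightarrow> (\<lambda>k. a k * (y - x0) ^ k) sums f y"
    using assms(1,3) unfolding real_analytic_on_def by blast
  obtain s where s: "s > 0" "ball x0 s \<subseteq> U" using assms(2,3) openE by blast
  have "(\<lambda>k. a k * h ^ k) sums f (x0 + h)" if "\<bar>h\<bar> < min r s" for h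
    using a[of "x0 + h"] s(2) that by (auto simp: dist_real_def subset_iff)
  then show ?thesis using r s(1) by (intro power_series_atI[of "min r s" a]) auto
qed

lemma power_series_at_zu_entry:
  assumes "analytic_map n \<phi> U" "open U" "x0 \<in> U" "r < n + 1" "c < n + 1"
  shows "power_series_at (zu_entry n \<phi> r c) x0"
proof -
  have \<phi>: "power_series_at (\<lambda>t. \<phi> t $ k) x0" if "k < n" for k
    using assms(1-3) that by (auto simp: analytic_map_def intro: real_analytic_on_imp_power_series_at)
  have "power_series_at (z_entry \<phi> r k) x0" if "k < n + 1" for k
  proof (cases "r = 1 \<and> 2 \<le> k")
    case True
    then have "z_entry \<phi> r k = deriv (\<lambda>t. \<phi> t $ (k - 1))"
      by (simp add: z_entry_def fun_eq_iff)
    moreover have "k - 1 < n" using that True by arith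
    ultimately show ?thesis using power_series_at_deriv[OF \<phi>] by simp
  next
    case False
    then have "z_entry \<phi> r k = (\<lambda>x. if r = k then 1 else 0)"
      by (auto simp: z_entry_def fun_eq_iff)
    then show ?thesis using power_series_at_const by simp
  qed
  moreover have "power_series_at (u_entry \<phi> k c) x0" for k
  proof (cases "k \<noteq> c \<and> k = 0")
    case True
    then have "u_entry \<phi> k c = (\<lambda>x. \<phi> x $ (c - 1))" by (simp add: u_entry_def fun_eq_iff)
    moreover have "c - 1 < n" using assms(5) True by arith
    ultimately show ?thesis using \<phi> True by simp
  next
    case False
    then have "u_entry \<phi> k c = (\<lambda>x. if k = c then 1 else 0)"
      by (auto simp: u_entry_def fun_eq_iff)
    then show ?thesis using power_series_at_const by simp
  qed
  ultimately show ?thesis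
    unfolding zu_entry_def[abs_def] by (intro power_series_at_sum power_series_at_mult) auto
qed

text \<open>By the Leibniz formula a minor of order \<open>i\<close> is a combination of products of
  \<open>i\<close> entries, and only orders up to \<open>n\<close> occur.\<close>

definition zu_products :: "nat \<Rightarrow> (real \<Rightarrow> real vec) \<Rightarrow> (real \<Rightarrow> real) set" where
  "zu_products n \<phi> = (\<Union>i\<le>n. products {zu_entry n \<phi> r c |r c. r < n + 1 \<and> c < n + 1} i)"

lemma finite_zu_products: "finite (zu_products n \<phi>)"
proof -
  have "{zu_entry n \<phi> r c |r c. r < n + 1 \<and> c < n + 1}
      = (\<lambda>(r, c). zu_entry n \<phi> r c) ` ({..<n + 1} \<times> {..<n + 1})" by force
  then have "finite {zu_entry n \<phi> r c |r c. r < n + 1 \<and> c < n + 1}" by simp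
  then show ?thesis by (auto simp: zu_products_def intro: finite_products)
qed

lemma power_series_at_zu_products:
  assumes "analytic_map n \<phi> U" "open U" "x0 \<in> U" "b \<in> zu_products n \<phi>"
  shows "power_series_at b x0"
  using assms(4) power_series_at_zu_entry[OF assms(1-3)]
  by (auto simp: zu_products_def intro: power_series_at_products[rotated])

text \<open>The spanning set depends neither on \<open>\<tau>\<close> nor on \<open>A\<close>, which makes the final constants uniform.\<close>

lemma row_minor_gzu_lin_span:
  assumes "n \<ge> 1" "\<tau> \<in> carrier_vec (n + 1)" "A \<in> carrier_mat (n + 1) i" "i \<le> n"
    "S \<in> ext_index (n + 1) i"
  obtains f where "lin_span (zu_products n \<phi>) f"
    "\<And>x. \<phi> x \<in> carrier_vec n \<Longrightarrow> row_minor (gzu n \<phi> \<tau> x * A) S = f x"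
proof
  define B where "B = {zu_entry n \<phi> r c |r c. r < n + 1 \<and> c < n + 1}"
  define e where "e a b x = exp (\<tau> $ (pick S a))
      * (\<Sum>c<n + 1. A $$ (c, b) * zu_entry n \<phi> (pick S a) c x)" for a b x
  \<comment> \<open>The Leibniz formula written with the explicit entries \<open>e\<close>. As a
    function on the whole line \<open>f\<close> lies in the span; it is claimed to equal the minor
    only where \<open>\<phi> x\<close> has dimension \<open>n\<close>.\<close>
  define f where "f x = (\<Sum>p\<in>{p. p permutes {0..<i}}. signof p * (\<Prod>a<i. e a (p a) x))" for x
  have "lin_span B (e a b)" if "a < i" for a b
    unfolding e_def[abs_def] B_def using pick_ext_index(2)[OF assms(5) that]
    by (intro lin_span_scale lin_span_sum lin_span_base) blast
  then have "lin_span (products B i) f"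
    unfolding f_def[abs_def] by (intro lin_span_sum lin_span_scale lin_span_prod) blast
  then show "lin_span (zu_products n \<phi>) f"
    by (rule lin_span_mono) (use assms(4) in \<open>auto simp: zu_products_def B_def\<close>)
  fix x assume x: "\<phi> x \<in> carrier_vec n"
  define G where "G = gzu n \<phi> \<tau> x"
  have G: "G \<in> carrier_mat (n + 1) (n + 1)" unfolding G_def by (rule gzu_carrier[of n \<phi> x \<tau>, OF assms(1) x assms(2)])
  have GA: "G * A \<in> carrier_mat (n + 1) i" using G assms(3) by simp
  have M: "submatrix (G * A) S UNIV \<in> carrier_mat i i"
    by (simp add: submatrix_rows[OF GA assms(5)])
  have "submatrix (G * A) S UNIV $$ (a, b) = e a b x" if "a < i" "b < i" for a b
  proof -
    have p: "pick S a < n + 1" by (rule pick_ext_index(2)[OF assms(5) that(1)])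
    have "submatrix (G * A) S UNIV $$ (a, b) = (\<Sum>c<n + 1. G $$ (pick S a, c) * A $$ (c, b))"
      using p that G assms(3)
      by (simp add: submatrix_rows[OF GA assms(5)] scalar_prod_def atLeast0LessThan del: sum.lessThan_Suc)
    also have "\<dots> = (\<Sum>c<n + 1. exp (\<tau> $ (pick S a)) * (A $$ (c, b) * zu_entry n \<phi> (pick S a) c x))"
      unfolding G_def using gzu_index[of n \<phi> x \<tau>, OF assms(1) x assms(2) p] by (intro sum.cong) auto
    finally show ?thesis by (simp only: e_def sum_distrib_left)
  qed
  then have "(\<Prod>a = 0..<i. submatrix (G * A) S UNIV $$ (a, p a)) = (\<Prod>a<i. e a (p a) x)"
    if "p permutes {0..<i}" for p
    using that by (auto simp: atLeast0LessThan permutes_in_image intro!: prod.cong)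
  then show "row_minor (gzu n \<phi> \<tau> x * A) S = f x"
    unfolding row_minor_def G_def[symmetric] det_def'[OF M] f_def by (intro sum.cong) auto
qed

section \<open>Nondivergence\<close>

lemma null_outside_support:
  assumes "sets \<mu> = sets borel"
  shows "- measure_support \<mu> \<in> null_sets \<mu>"
proof -
  define F where "F = {S. open S \<and> emeasure \<mu> S = 0}"
  have eq: "- measure_support \<mu> = \<Union>F"
    by (auto simp: measure_support_def F_def not_gr_zero)
  obtain F' where F': "F' \<subseteq> F" "countable F'" "\<Union>F' = \<Union>F"
    using Lindelof[of F] by (auto simp: F_def)
  have "S \<in> null_sets \<mu>" if "S \<in> F'" for S
  proof -
    have "open S" "emeasure \<mu> S = 0" using that F'(1) by (auto simp: F_def)
    then show ?thesis by (intro null_setsI) (simp_all add: assms)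
  qed
  then have "(\<Union>S\<in>F'. S) \<in> null_sets \<mu>" using F'(2) by (intro null_sets_UN') auto
  then show ?thesis using F'(3) eq by simp
qed

text \<open>Upper regularity on shrinking balls. It disposes of intervals that consist of one point,
  whose dilate has no positive length to work with.\<close>

lemma ahlfors_regular_singleton:
  assumes ahl: "ahlfors_regular C \<alpha> \<rho>0 \<mu>" and x: "x \<in> measure_support \<mu>"
  shows "emeasure \<mu> {x} = 0"
proof -
  note ahlD = ahlfors_regularD[OF ahl]
  have "emeasure \<mu> {x} \<le> ennreal e" if e: "e > 0" for e
  proof -
    define t where "t = min \<rho>0 ((e / C) powr (1 / \<alpha>))"
    have t: "t > 0" "t \<le> \<rho>0" using ahlD(1,3) e by (auto simp: t_def)
    have "t powr \<alpha> \<le> ((e / C) powr (1 / \<alpha>)) powr \<alpha>"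
      using t ahlD(2) by (intro powr_mono2) (auto simp: t_def)
    also have "\<dots> = e / C" using ahlD(1,2) e by (simp add: powr_powr)
    finally have "C * t powr \<alpha> \<le> e" using ahlD(1) by (simp add: field_simps)
    moreover have "emeasure \<mu> {x} \<le> emeasure \<mu> (ball x t)"
      using t ahlD(4) by (intro emeasure_mono) auto
    ultimately show ?thesis using ahlD(6)[OF x t] by (meson ennreal_leI order_trans)
  qed
  then have "emeasure \<mu> {x} \<le> 0 + ennreal e" if "e > 0" for e using that by simp
  from ennreal_le_epsilon[OF this] show ?thesis by simp
qed

lemma bounded_interval_between:
  fixes J :: "real set"
  assumes "is_interval J" "bounded J" "J \<noteq> {}"
  shows "{Inf J<..<Sup J} \<subseteq> J" "J \<subseteq> {Inf J..Sup J}"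
proof -
  have bdd: "bdd_above J" "bdd_below J"
    using assms(2) by (auto simp: bounded_imp_bdd_above bounded_imp_bdd_below)
  show "J \<subseteq> {Inf J..Sup J}" using bdd by (auto intro: cInf_lower cSup_upper)
  show "{Inf J<..<Sup J} \<subseteq> J"
  proof
    fix w assume w: "w \<in> {Inf J<..<Sup J}"
    then obtain a where "a \<in> J" "a < w" using cInf_less_iff[OF assms(3) bdd(2)] by auto
    moreover obtain b where "b \<in> J" "w < b" using w less_cSup_iff[OF assms(3) bdd(1)] by auto
    ultimately show "w \<in> J" using assms(1) unfolding is_interval_1 by (meson less_imp_le)
  qed
qed

lemma bounded_interval_borel:
  fixes J :: "real set"
  assumes "is_interval J" "bounded J"
  shows "J \<in> sets borel" "dilate 3 J \<in> sets borel"
proof -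
  show J: "J \<in> sets borel"
  proof (cases "J = {}")
    case False
    have "J = {Inf J<..<Sup J} \<union> (J \<inter> {Inf J, Sup J})"
      using bounded_interval_between[OF assms False] by force
    moreover have "J \<inter> {Inf J, Sup J} \<in> sets borel"
      by (intro borel_closed finite_imp_closed) auto
    ultimately show ?thesis by (metis borel_open open_greaterThanLessThan sets.Un)
  qed simp
  define m where "m = (Inf J + Sup J) / 2"
  have "dilate 3 J = (\<lambda>y. m + (y - m) / 3) -` J"
  proof (intro equalityI subsetI)
    fix y assume "y \<in> (\<lambda>y. m + (y - m) / 3) -` J"
    then show "y \<in> dilate 3 J" unfolding dilate_def Let_def m_def[symmetric]
      by (intro image_eqI[of _ _ "m + (y - m) / 3"]) (simp_all add: field_simps)
  next
    fix y assume "y \<in> dilate 3 J"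
    then obtain w where "w \<in> J" "y = m + 3 * (w - m)"
      by (auto simp: dilate_def Let_def m_def[symmetric])
    moreover from this have "m + (y - m) / 3 = w" by (simp add: field_simps)
    ultimately show "y \<in> (\<lambda>y. m + (y - m) / 3) -` J" by simp
  qed
  moreover have "(\<lambda>y. m + (y - m) / 3) \<in> borel_measurable borel" by measurable
  ultimately show "dilate 3 J \<in> sets borel"
    using measurable_sets[OF _ J, of "\<lambda>y. m + (y - m) / 3" borel] by simp
qed

lemma ball_subset_dilate:
  fixes J :: "real set"
  assumes J: "is_interval J" "bounded J" and x: "x \<in> J"
  shows "ball x (Sup J - Inf J) \<subseteq> dilate 3 J"
proof
  fix y assume y: "y \<in> ball x (Sup J - Inf J)"
  have ne: "J \<noteq> {}" using x by blast
  define m where "m = (Inf J + Sup J) / 2"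
  have "Inf J \<le> x" "x \<le> Sup J" using bounded_interval_between(2)[OF J ne] x by auto
  moreover have "y - x < Sup J - Inf J" "x - y < Sup J - Inf J"
    using y by (auto simp: dist_real_def)
  ultimately have "Inf J < m + (y - m) / 3" "m + (y - m) / 3 < Sup J"
    unfolding m_def by (simp_all add: field_simps)
  then have "m + (y - m) / 3 \<in> {Inf J<..<Sup J}" by simp
  then have "m + (y - m) / 3 \<in> J" using bounded_interval_between(1)[OF J ne] by blast
  then show "y \<in> dilate 3 J" unfolding dilate_def Let_def m_def[symmetric]
    by (intro image_eqI[of _ _ "m + (y - m) / 3"]) (simp_all add: field_simps)
qed

text \<open>An interval that misses the support or is a single point is null. Otherwise the ball
  around a support point with the length of \<open>J\<close> as radius lies in the dilate, and lower
  regularity turns bounds by powers of the length into bounds by the measure of the dilate.\<close>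

lemma interval_dichotomy:
  assumes ahl: "ahlfors_regular C \<alpha> \<rho>0 \<mu>" and J: "is_interval J" "bounded J" "J \<noteq> {}"
    and len: "Sup J - Inf J \<le> \<rho>0"
  obtains "emeasure \<mu> J = 0"
  | x where "x \<in> J" "x \<in> measure_support \<mu>" "0 < Sup J - Inf J"
    "ennreal ((Sup J - Inf J) powr \<alpha>) \<le> ennreal C * emeasure \<mu> (dilate 3 J)"
proof (cases "J \<inter> measure_support \<mu> = {}")
  case True
  then have "emeasure \<mu> J \<le> emeasure \<mu> (- measure_support \<mu>)"
    using null_outside_support ahlfors_regularD(4)[OF ahl] by (intro emeasure_mono) auto
  also have "\<dots> = 0" using null_outside_support[OF ahlfors_regularD(4)[OF ahl]] by (rule null_setsD1)
  finally show thesis using that(1) by simp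
next
  case False
  note ahlD = ahlfors_regularD[OF ahl]
  obtain x where x: "x \<in> J" "x \<in> measure_support \<mu>" using False by blast
  have sub: "J \<subseteq> {Inf J..Sup J}" by (rule bounded_interval_between(2)[OF J])
  show thesis
  proof (cases "0 < Sup J - Inf J")
    case True
    have "ennreal ((Sup J - Inf J) powr \<alpha>) \<le> ennreal C * emeasure \<mu> (ball x (Sup J - Inf J))"
      by (rule ahlD(5)[OF x(2) True len])
    also have "\<dots> \<le> ennreal C * emeasure \<mu> (dilate 3 J)"
      using ball_subset_dilate[OF J(1,2) x(1)] bounded_interval_borel(2)[OF J(1,2)] ahlD(4)
      by (intro mult_left_mono emeasure_mono) auto
    finally show thesis using that(2) x True by blast
  next
    case False
    have "y = x" if "y \<in> J" for y
    proof -
      have "Inf J \<le> y \<and> y \<le> Sup J" "Inf J \<le> x \<and> x \<le> Sup J" using sub that x(1) by auto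
      then show ?thesis using False by linarith
    qed
    then have "J = {x}" using x(1) by blast
    then show thesis using that(1) ahlfors_regular_singleton[OF ahl x(2)] by simp
  qed
qed

section \<open>Assembling the local estimate\<close>

lemma comparable_symp: "symp comparable"
  by (auto simp: symp_def comparable_def)

lemma comparable_irreflp: "irreflp comparable"
  by (auto simp: irreflp_def comparable_def)

text \<open>Comparable matrices have different ranks, and the ranks range over
  \<open>{1..n}\<close>.\<close>

lemma comparable_chain_card:
  assumes "F \<subseteq> sublattices n" "pairwise comparable F"
  shows "card F \<le> n"
proof -
  have "inj_on dim_col F"
    using assms(2) by (force simp: inj_on_def pairwise_def comparable_def)
  moreover have "dim_col ` F \<subseteq> {1..n}" using assms(1) by (auto simp: sublattices_def)
  ultimately have "card F \<le> card {1..n}" by (intro card_inj_on_le) auto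
  then show ?thesis by simp
qed

lemma vol_gzu_lin_span:
  assumes "n \<ge> 1" "\<tau> \<in> carrier_vec (n + 1)" "A \<in> carrier_mat (n + 1) i" "i \<le> n"
  obtains f where "\<And>S. S \<in> ext_index (n + 1) i \<Longrightarrow> lin_span (zu_products n \<phi>) (f S)"
    "\<And>x. \<phi> x \<in> carrier_vec n \<Longrightarrow>
       vol (gzu n \<phi> \<tau> x * A) = sqrt (\<Sum>S\<in>ext_index (n + 1) i. (f S x)\<^sup>2)"
proof -
  have "\<forall>S\<in>ext_index (n + 1) i. \<exists>f. lin_span (zu_products n \<phi>) f \<and>
      (\<forall>x. \<phi> x \<in> carrier_vec n \<longrightarrow> row_minor (gzu n \<phi> \<tau> x * A) S = f x)"
    using row_minor_gzu_lin_span[OF assms] by metis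
  from bchoice[OF this] obtain f where f: "\<And>S. S \<in> ext_index (n + 1) i \<Longrightarrow> lin_span (zu_products n \<phi>) (f S)"
    "\<And>S x. S \<in> ext_index (n + 1) i \<Longrightarrow> \<phi> x \<in> carrier_vec n \<Longrightarrow>
       row_minor (gzu n \<phi> \<tau> x * A) S = f S x" by blast
  have "vol (gzu n \<phi> \<tau> x * A) = sqrt (\<Sum>S\<in>ext_index (n + 1) i. (f S x)\<^sup>2)"
    if x: "\<phi> x \<in> carrier_vec n" for x
  proof -
    have "gzu n \<phi> \<tau> x * A \<in> carrier_mat (n + 1) i"
      using gzu_carrier[of n \<phi> x \<tau>, OF assms(1) x assms(2)] assms(3) by simp
    then have "dim_row (gzu n \<phi> \<tau> x * A) = n + 1" "dim_col (gzu n \<phi> \<tau> x * A) = i"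
      by (rule carrier_matD)+
    then show ?thesis using f(2)[OF _ x] by (simp only: vol_def cong: sum.cong)
  qed
  with f(1) show thesis by (rule that)
qed

text \<open>The ratio of \<open>\<epsilon>\<close> to \<open>\<delta>\<close> is exactly the
  constant lost in \<open>flag_imp_no_short_vector\<close>, so a flag at level
  \<open>\<epsilon>\<close> excludes nonzero vectors shorter than \<open>\<delta>\<close>.\<close>

lemma marked_imp_K_set:
  assumes n: "n \<ge> 1" and \<phi>: "\<phi> x \<in> carrier_vec n" and \<tau>: "\<tau> \<in> carrier_vec (n + 1)"
      "(\<Sum>k<n + 1. \<tau> $ k) = 0"
    and \<epsilon>: "\<epsilon> \<le> \<rho>" "\<rho> \<le> 1" "\<epsilon> = 2 ^ (n + 1) * real (n + 1) * \<delta>"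
    and marked: "marked (\<lambda>A y. vol (gzu n \<phi> \<tau> y * A)) comparable \<epsilon> \<rho> (sublattices n) x"
  shows "(\<lambda>v. gzu n \<phi> \<tau> x *\<^sub>v v) ` int_lattice (n + 1) \<in> K_set (n + 1) \<delta>"
proof -
  define L where "L = gzu n \<phi> \<tau> x"
  have L: "L \<in> carrier_mat (n + 1) (n + 1)" "\<bar>Determinant.det L\<bar> = 1"
    unfolding L_def using gzu_carrier[of n \<phi> x \<tau>, OF n \<phi> \<tau>(1)] det_gzu[of n \<phi> x \<tau>, OF n \<phi> \<tau>] by simp_all
  have "\<delta> \<le> vec_norm2 (L *\<^sub>v v)" if v: "v \<in> int_lattice (n + 1)" "L *\<^sub>v v \<noteq> 0\<^sub>v (n + 1)" for v
  proof -
    have "v \<noteq> 0\<^sub>v (n + 1)" using v(2) L(1) by auto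
    moreover obtain F where F: "F \<subseteq> sublattices n" "finite F" "pairwise comparable F"
      "\<forall>A\<in>F. \<epsilon> \<le> vol (L * A) \<and> vol (L * A) \<le> \<rho>"
      "\<forall>A\<in>sublattices n - F. (\<forall>B\<in>F. comparable B A) \<longrightarrow> \<rho> \<le> vol (L * A)"
      using marked unfolding marked_def L_def by blast
    ultimately have "\<epsilon> \<le> 2 ^ (n + 1) * real (n + 1) * vec_norm2 (L *\<^sub>v v)"
      using flag_imp_no_short_vector[OF L \<epsilon>(1,2) F(1-3) _ _ v(1)] by blast
    then show ?thesis unfolding \<epsilon>(3) by (rule mult_left_le_imp_le) simp
  qed
  then show ?thesis
    unfolding K_set_def unimodular_lattices_def L_def[symmetric] using L by blast
qed

text \<open>The constants are fixed before \<delta>, \<tau>, \<rho> and \<open>J\<close>. The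
  covolumes are required to reach \<open>\<rho>\<close> on \<open>closure J\<close> because a
  supremum over \<open>J\<close> need not be attained in \<open>J\<close>.\<close>

lemma nondivergence_near_point:
  assumes ahl: "ahlfors_regular C \<alpha> \<rho>0 \<mu>" and U: "open U" "x0 \<in> U" and n: "n \<ge> 1"
    and \<phi>: "analytic_map n \<phi> U"
  obtains \<eta> \<gamma> M where "\<eta> > 0" "\<gamma> > 0" "M > 0" "2 * \<eta> \<le> \<rho>0"
    "\<And>\<tau> A. \<tau> \<in> carrier_vec (n + 1) \<Longrightarrow> A \<in> sublattices n \<Longrightarrow>
       continuous_on (cball x0 \<eta>) (\<lambda>y. vol (gzu n \<phi> \<tau> y * A))"
    "\<And>\<delta> \<tau> \<rho> J. \<lbrakk>\<delta> > 0; \<tau> \<in> carrier_vec (n + 1); (\<Sum>k<n + 1. \<tau> $ k) = 0; 0 < \<rho>; \<rho> \<le> 1;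
       is_interval J; J \<noteq> {}; J \<subseteq> ball x0 \<eta>;
       \<And>A. A \<in> sublattices n \<Longrightarrow> \<exists>y\<in>closure J. \<rho> \<le> vol (gzu n \<phi> \<tau> y * A)\<rbrakk> \<Longrightarrow>
       emeasure \<mu> (W_set n \<phi> \<tau> J \<delta>) \<le> ennreal (M * (\<delta> / \<rho>) powr \<gamma>) * emeasure \<mu> (dilate 3 J)"
proof -
  note ahlD = ahlfors_regularD[OF ahl]
  define B where "B = zu_products n \<phi>"
  have finB: "finite B" unfolding B_def by (rule finite_zu_products)
  have Bps: "power_series_at b x0" if "b \<in> B" for b
    using power_series_at_zu_products[OF \<phi> U] that by (simp add: B_def)
  have "\<exists>\<eta> K Q. \<eta> > 0 \<and> Q \<ge> 1 \<and>
      (\<forall>a. controlled_deriv (\<lambda>x. \<Sum>b\<in>B. a b * b x) (ball x0 \<eta>) K Q)"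
  proof (rule span_controlled_deriv[OF finB])
    show "power_series_at b x0" if "b \<in> B" for b by (rule Bps[OF that])
    fix \<eta> Q :: real and K
    assume "\<eta> > 0" "Q \<ge> 1"
      "\<And>a. controlled_deriv (\<lambda>x. \<Sum>b\<in>B. a b * b x) (ball x0 \<eta>) K Q"
    then show "\<exists>\<eta> K Q. \<eta> > 0 \<and> Q \<ge> 1 \<and>
        (\<forall>a. controlled_deriv (\<lambda>x. \<Sum>b\<in>B. a b * b x) (ball x0 \<eta>) K Q)"
      by (intro exI[of _ \<eta>] exI[of _ K] exI[of _ Q] conjI allI)
  qed
  then obtain \<eta>1 K Q where \<eta>1: "\<eta>1 > 0" and Q: "Q \<ge> 1"
    and cd: "\<forall>a. controlled_deriv (\<lambda>x. \<Sum>b\<in>B. a b * b x) (ball x0 \<eta>1) K Q"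
    by (elim exE conjE)
  obtain \<eta>2 where \<eta>2: "\<eta>2 > 0" "ball x0 \<eta>2 \<subseteq> U" using U openE by blast
  have "\<forall>b\<in>B. \<exists>r. r > 0 \<and> continuous_on (ball x0 r) b"
    using power_series_at_imp_continuous_on[OF Bps] by blast
  from bchoice[OF this] obtain rad where rad: "\<And>b. b \<in> B \<Longrightarrow> rad b > 0"
    "\<And>b. b \<in> B \<Longrightarrow> continuous_on (ball x0 (rad b)) b" by blast
  define \<eta>3 where "\<eta>3 = Min (insert (min \<eta>1 \<eta>2) (rad ` B))"
  have \<eta>3: "\<eta>3 > 0" "\<eta>3 \<le> \<eta>1" "\<eta>3 \<le> \<eta>2" "\<And>b. b \<in> B \<Longrightarrow> \<eta>3 \<le> rad b"
    using finB \<eta>1 \<eta>2(1) rad(1) by (auto simp: \<eta>3_def Min_gr_iff Min_le_iff)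
  define D where "D = cball x0 (\<eta>3 / 2)"
  have D3: "D \<subseteq> ball x0 \<eta>3" using \<eta>3(1) by (auto simp: D_def)
  have Dc: "\<phi> y \<in> carrier_vec n" if "y \<in> D" for y
  proof -
    have "y \<in> U" using that D3 \<eta>3(3) \<eta>2(2) by (auto simp: subset_iff)
    then show ?thesis using \<phi> by (simp add: analytic_map_def)
  qed
  have span_cont: "continuous_on D f" if "lin_span B f" for f
  proof (rule continuous_on_lin_span[OF that])
    show "continuous_on D b" if "b \<in> B" for b
      using rad(2)[OF that] subset_ball[OF \<eta>3(4)[OF that]] D3 by (meson continuous_on_subset subset_trans)
  qed
  have span_cd: "controlled_deriv f D K Q" if "lin_span B f" for f
  proof -
    obtain a where "f = (\<lambda>x. \<Sum>b\<in>B. a b * b x)" using lin_span_coeffs[OF \<open>lin_span B f\<close> finB] by blast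
    moreover have "D \<subseteq> ball x0 \<eta>1" using D3 subset_ball[OF \<eta>3(2)] by blast
    ultimately show ?thesis using controlled_deriv_cong_subset[OF spec[OF cd, of a]] by simp
  qed
  have vol_cont: "continuous_on D (\<lambda>y. vol (gzu n \<phi> \<tau> y * A))"
    if \<tau>: "\<tau> \<in> carrier_vec (n + 1)" and A: "A \<in> sublattices n" for \<tau> A
  proof -
    obtain i where i: "i \<le> n" "A \<in> carrier_mat (n + 1) i" using A by (auto simp: sublattices_def)
    obtain f where f: "\<And>S. S \<in> ext_index (n + 1) i \<Longrightarrow> lin_span B (f S)"
      "\<And>x. \<phi> x \<in> carrier_vec n \<Longrightarrow>
         vol (gzu n \<phi> \<tau> x * A) = sqrt (\<Sum>S\<in>ext_index (n + 1) i. (f S x)\<^sup>2)"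
      using vol_gzu_lin_span[OF n \<tau> i(2,1)] unfolding B_def by blast
    have "continuous_on D (\<lambda>y. sqrt (\<Sum>S\<in>ext_index (n + 1) i. (f S y)\<^sup>2))"
      by (intro continuous_intros span_cont f(1))
    then show ?thesis by (rule continuous_on_eq) (simp add: f(2) Dc)
  qed
  define \<gamma> where "\<gamma> = \<alpha> / (K + 1)"
  have \<gamma>: "\<gamma> > 0" using ahlD(2) by (simp add: \<gamma>_def)
  \<comment> \<open>The factor \<open>2 ^ (n + 1)\<close> replaces the number of minors, which
    depends on the rank, by a common bound.\<close>
  define P where "P = 4 ^ K * (Q + K) * 2 ^ (n + 1)"
  have P: "P > 0" using Q by (simp add: P_def)
  define c2 where "c2 = C * (2 ^ K + 2 powr \<alpha>)"
  have c2: "c2 > 0" using ahlD(1) by (simp add: c2_def add_pos_pos)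
  have good: "\<exists>N\<in>sets \<mu>. {z \<in> cball x R \<inter> measure_support \<mu>. vol (gzu n \<phi> \<tau> z * A) < \<epsilon>} \<subseteq> N \<and>
      emeasure \<mu> N \<le> ennreal (c2 * (P * (\<epsilon> / \<rho>)) powr \<gamma> * R powr \<alpha>)"
    if \<tau>: "\<tau> \<in> carrier_vec (n + 1)" and \<epsilon>: "\<epsilon> > 0" "\<rho> > 0" and A: "A \<in> sublattices n"
      and x: "x \<in> measure_support \<mu>" and R: "R > 0" "2 * R \<le> \<rho>0" "cball x R \<subseteq> D"
      and y: "y \<in> cball x R" "\<rho> \<le> vol (gzu n \<phi> \<tau> y * A)" for \<tau> \<epsilon> \<rho> A x R y
  proof -
    obtain i where i: "i \<le> n" "A \<in> carrier_mat (n + 1) i" "vol A \<noteq> 0" using A by (auto simp: sublattices_def)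
    define X where "X = ext_index (n + 1) i"
    obtain f where f: "\<And>S. S \<in> X \<Longrightarrow> lin_span B (f S)"
      "\<And>x. \<phi> x \<in> carrier_vec n \<Longrightarrow> vol (gzu n \<phi> \<tau> x * A) = sqrt (\<Sum>S\<in>X. (f S x)\<^sup>2)"
      using vol_gzu_lin_span[OF n \<tau> i(2,1)] unfolding B_def X_def by blast
    have X: "finite X" "X \<noteq> {}"
      using finite_ext_index vol_eq_0_iff[OF i(2)] i(3) by (auto simp: X_def)
    have "y \<in> D" using y(1) R(3) by blast
    then have y': "\<rho> \<le> sqrt (\<Sum>S\<in>X. (f S y)\<^sup>2)" using y(2) f(2) Dc by simp
    have "controlled_deriv (f S) (cball x R) K Q" if "S \<in> X" for S
      by (rule controlled_deriv_cong_subset[OF span_cd[OF f(1)[OF that]] R(3)]) simp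
    from controlled_norm_sublevel_measure[OF ahl X this Q x R(1,2) \<epsilon> y(1) y']
    obtain N where N: "N \<in> sets \<mu>"
      "{z \<in> cball x R \<inter> measure_support \<mu>. sqrt (\<Sum>S\<in>X. (f S z)\<^sup>2) < \<epsilon>} \<subseteq> N"
      "emeasure \<mu> N \<le> ennreal (c2 * (4 ^ K * (Q + K) * card X * (\<epsilon> / \<rho>)) powr \<gamma> * R powr \<alpha>)"
      by (auto simp: c2_def \<gamma>_def)
    have "real (card X) \<le> real (2 ^ (n + 1))"
      unfolding X_def by (intro of_nat_mono card_ext_index_le)
    then have "4 ^ K * (Q + K) * card X * (\<epsilon> / \<rho>) \<le> P * (\<epsilon> / \<rho>)"
      unfolding P_def using Q \<epsilon> by (intro mult_right_mono mult_left_mono) auto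
    then have "(4 ^ K * (Q + K) * card X * (\<epsilon> / \<rho>)) powr \<gamma> \<le> (P * (\<epsilon> / \<rho>)) powr \<gamma>"
      using Q \<epsilon> \<gamma> by (intro powr_mono2) auto
    then have "c2 * (4 ^ K * (Q + K) * card X * (\<epsilon> / \<rho>)) powr \<gamma> * R powr \<alpha>
        \<le> c2 * (P * (\<epsilon> / \<rho>)) powr \<gamma> * R powr \<alpha>"
      using c2 by (intro mult_right_mono mult_left_mono) auto
    then have "emeasure \<mu> N \<le> ennreal (c2 * (P * (\<epsilon> / \<rho>)) powr \<gamma> * R powr \<alpha>)"
      using N(3) by (meson ennreal_leI order_trans)
    moreover have "{z \<in> cball x R \<inter> measure_support \<mu>. vol (gzu n \<phi> \<tau> z * A) < \<epsilon>}
        \<subseteq> {z \<in> cball x R \<inter> measure_support \<mu>. sqrt (\<Sum>S\<in>X. (f S z)\<^sup>2) < \<epsilon>}"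
    proof
      fix z assume z: "z \<in> {z \<in> cball x R \<inter> measure_support \<mu>. vol (gzu n \<phi> \<tau> z * A) < \<epsilon>}"
      then have "z \<in> D" using R(3) by blast
      with z f(2)[OF Dc] show "z \<in> {z \<in> cball x R \<inter> measure_support \<mu>. sqrt (\<Sum>S\<in>X. (f S z)\<^sup>2) < \<epsilon>}"
        by simp
    qed
    ultimately show ?thesis using N(1,2) by blast
  qed
  \<comment> \<open>An interval in the ball of radius \<open>\<eta>\<close> has length
    \<open>r \<le> 2 * \<eta>\<close>. The induction over chains needs
    \<open>8 * 5 ^ n * r \<le> \<rho>0\<close> and the ball of radius \<open>5 ^ n * r\<close>
    around a point of the interval inside \<open>D\<close>.\<close>
  define \<eta> where "\<eta> = min (\<eta>3 / (8 * 5 ^ n)) (\<rho>0 / (16 * 5 ^ n))"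
  have pow5: "(1::real) \<le> 5 ^ n" by simp
  have \<eta>: "\<eta> > 0" using \<eta>3(1) ahlD(3) by (simp add: \<eta>_def)
  have "\<eta> \<le> \<eta>3 / (8 * 5 ^ n)" "\<eta> \<le> \<rho>0 / (16 * 5 ^ n)" by (simp_all add: \<eta>_def)
  then have \<eta>a: "8 * 5 ^ n * \<eta> \<le> \<eta>3" and \<eta>b: "8 * 5 ^ n * (2 * \<eta>) \<le> \<rho>0"
    by (simp_all add: field_simps)
  have \<eta>c: "2 * \<eta> \<le> \<rho>0" "\<eta> + 5 ^ n * (2 * \<eta>) \<le> \<eta>3 / 2" "\<eta> \<le> \<eta>3 / 2"
  proof -
    define t where "t = 5 ^ n * \<eta>"
    have "1 * \<eta> \<le> t" unfolding t_def using \<eta> pow5 by (intro mult_right_mono) auto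
    moreover have "8 * t \<le> \<eta>3" "16 * t \<le> \<rho>0" using \<eta>a \<eta>b by (simp_all add: t_def)
    moreover have "5 ^ n * (2 * \<eta>) = 2 * t" by (simp add: t_def)
    ultimately show "2 * \<eta> \<le> \<rho>0" "\<eta> + 5 ^ n * (2 * \<eta>) \<le> \<eta>3 / 2" "\<eta> \<le> \<eta>3 / 2"
      using \<eta> by linarith+
  qed
  define \<kappa> where "\<kappa> = 2 ^ (n + 1) * real (n + 1)"
  have \<kappa>: "\<kappa> > 0" by (simp add: \<kappa>_def)
  define c1 where "c1 = marking_const C \<alpha> n * c2 * (P * \<kappa>) powr \<gamma>"
  \<comment> \<open>The part \<open>c1\<close> serves \<open>\<epsilon> \<le> \<rho>\<close>. The
    other summand serves \<open>\<epsilon> > \<rho>\<close>: then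
    \<open>\<kappa> * (\<delta> / \<rho>)\<close> exceeds 1 and the measure of one ball around
    \<open>J\<close> suffices.\<close>
  define c3 where "c3 = c1 + C * 2 powr \<alpha> * \<kappa> powr \<gamma>"
  have c1: "c1 \<ge> 0" using c2 marking_const_nonneg by (simp add: c1_def)
  have c3: "c3 > 0" using c1 ahlD(1) \<kappa> by (simp add: c3_def add_nonneg_pos)
  have main: "emeasure \<mu> (W_set n \<phi> \<tau> J \<delta>)
      \<le> ennreal (C * c3 * (\<delta> / \<rho>) powr \<gamma>) * emeasure \<mu> (dilate 3 J)"
    if \<delta>: "\<delta> > 0" and \<tau>: "\<tau> \<in> carrier_vec (n + 1)" "(\<Sum>k<n + 1. \<tau> $ k) = 0"
      and \<rho>: "0 < \<rho>" "\<rho> \<le> 1" and J: "is_interval J" "J \<noteq> {}" "J \<subseteq> ball x0 \<eta>"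
      and big: "\<And>A. A \<in> sublattices n \<Longrightarrow> \<exists>y\<in>closure J. \<rho> \<le> vol (gzu n \<phi> \<tau> y * A)"
    for \<delta> \<tau> \<rho> J
  proof -
    define W where "W = W_set n \<phi> \<tau> J \<delta>"
    have WJ: "W \<subseteq> J" by (auto simp: W_def W_set_def)
    have bdd: "bounded J" using J(3) bounded_subset by blast
    define r where "r = Sup J - Inf J"
    have ends: "J \<subseteq> {Inf J..Sup J}" by (rule bounded_interval_between(2)[OF J(1) bdd J(2)])
    have "x0 - \<eta> \<le> Inf J" using J(2,3) by (intro cInf_greatest) (auto simp: dist_real_def subset_iff)
    moreover have "Sup J \<le> x0 + \<eta>" using J(2,3) by (intro cSup_least) (auto simp: dist_real_def subset_iff)
    ultimately have r2: "r \<le> 2 * \<eta>" by (simp add: r_def)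
    have Jbor: "J \<in> sets \<mu>" using bounded_interval_borel(1)[OF J(1) bdd] ahlD(4) by simp
    have "emeasure \<mu> W \<le> ennreal (C * c3 * (\<delta> / \<rho>) powr \<gamma>) * emeasure \<mu> (dilate 3 J)"
    proof (rule interval_dichotomy[OF ahl J(1) bdd J(2)])
      show "Sup J - Inf J \<le> \<rho>0" using r2 \<eta>c(1) by (simp add: r_def)
    next
      assume "emeasure \<mu> J = 0"
      moreover have "emeasure \<mu> W \<le> emeasure \<mu> J" by (rule emeasure_mono[OF WJ Jbor])
      ultimately show ?thesis by simp
    next
      fix x assume x: "x \<in> J" "x \<in> measure_support \<mu>" and "0 < Sup J - Inf J"
        and rC: "ennreal ((Sup J - Inf J) powr \<alpha>) \<le> ennreal C * emeasure \<mu> (dilate 3 J)"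
      then have r0: "r > 0" by (simp add: r_def)
      have clJ: "closure J \<subseteq> cball x r"
      proof -
        have "closure J \<subseteq> {Inf J..Sup J}" using ends by (rule closure_minimal) simp
        then show ?thesis using ends x(1) by (force simp: r_def dist_real_def)
      qed
      define \<epsilon> where "\<epsilon> = \<kappa> * \<delta>"
      have \<epsilon>: "\<epsilon> > 0" using \<kappa> \<delta> by (simp add: \<epsilon>_def)
      have split: "(\<kappa> * t) powr \<gamma> = \<kappa> powr \<gamma> * t powr \<gamma>" if "t \<ge> 0" for t
        using \<kappa> that by (simp add: powr_mult)
      have "emeasure \<mu> W \<le> ennreal (c3 * (\<delta> / \<rho>) powr \<gamma> * r powr \<alpha>)"
      proof (cases "\<epsilon> \<le> \<rho>")
        case True
        have r\<rho>: "8 * 5 ^ n * r \<le> \<rho>0"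
        proof -
          have "8 * 5 ^ n * r \<le> 8 * 5 ^ n * (2 * \<eta>)" using r2 by (intro mult_left_mono) auto
          then show ?thesis using \<eta>b by linarith
        qed
        have rD: "cball x (5 ^ n * r) \<subseteq> D"
        proof -
          have "5 ^ n * r \<le> 5 ^ n * (2 * \<eta>)" using r2 by (intro mult_left_mono) auto
          moreover have "dist x x0 \<le> \<eta>" using x(1) J(3) by (auto simp: dist_commute less_imp_le)
          ultimately have "dist x x0 + 5 ^ n * r \<le> \<eta>3 / 2" using \<eta>c(2) by linarith
          then show ?thesis by (simp add: D_def cball_subset_cball_iff)
        qed
        have "\<exists>N\<in>sets \<mu>. {z \<in> cball x r \<inter> measure_support \<mu>.
            \<not> marked (\<lambda>A y. vol (gzu n \<phi> \<tau> y * A)) comparable \<epsilon> \<rho> (sublattices n) z} \<subseteq> N \<and>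
          emeasure \<mu> N \<le> ennreal (marking_const C \<alpha> n * (c2 * (P * (\<epsilon> / \<rho>)) powr \<gamma>) * r powr \<alpha>)"
        proof (rule unmarked_measure[OF ahl comparable_symp comparable_irreflp, of D])
          show "closed D" by (simp add: D_def)
          show "0 \<le> c2 * (P * (\<epsilon> / \<rho>)) powr \<gamma>" using c2 by simp
          show "card F \<le> n" if "F \<subseteq> sublattices n" "finite F" "pairwise comparable F" for F
            using comparable_chain_card that by blast
          show "\<exists>y\<in>cball x r. \<rho> \<le> vol (gzu n \<phi> \<tau> y * A)" if "A \<in> sublattices n" for A
            using big[OF that] clJ by blast
          show "0 \<le> r" using r0 by simp
          show "continuous_on D (\<lambda>y. vol (gzu n \<phi> \<tau> y * A))" if "A \<in> sublattices n" for A
            by (rule vol_cont[OF \<tau>(1) that])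
        qed (rule x(2) r\<rho> rD good[OF \<tau>(1) \<epsilon> \<rho>(1)]; assumption)+
        then obtain N where N: "N \<in> sets \<mu>" "{z \<in> cball x r \<inter> measure_support \<mu>.
            \<not> marked (\<lambda>A y. vol (gzu n \<phi> \<tau> y * A)) comparable \<epsilon> \<rho> (sublattices n) z} \<subseteq> N"
          "emeasure \<mu> N \<le> ennreal (marking_const C \<alpha> n * (c2 * (P * (\<epsilon> / \<rho>)) powr \<gamma>) * r powr \<alpha>)"
          by blast
        have "z \<in> N" if z: "z \<in> W" "z \<in> measure_support \<mu>" for z
        proof (rule ccontr)
          assume "z \<notin> N"
          have zJ: "z \<in> J" using z(1) WJ by blast
          then have zr: "z \<in> cball x r" using clJ closure_subset by blast
          have "J \<subseteq> D" using J(3) \<eta>c(3) by (auto simp: D_def)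
          then have \<phi>z: "\<phi> z \<in> carrier_vec n" using zJ Dc by blast
          have "marked (\<lambda>A y. vol (gzu n \<phi> \<tau> y * A)) comparable \<epsilon> \<rho> (sublattices n) z"
            using N(2) \<open>z \<notin> N\<close> z(2) zr by blast
          from marked_imp_K_set[OF n \<phi>z \<tau> True \<rho>(2) _ this, of \<delta>]
          show False using z(1) by (simp add: \<epsilon>_def \<kappa>_def W_def W_set_def)
        qed
        \<comment> \<open>Monotonicity asks measurability of the larger set alone, so
          \<open>W\<close> is estimated through this measurable cover.\<close>
        then have "W \<subseteq> N \<union> (- measure_support \<mu>)" by blast
        moreover have null: "- measure_support \<mu> \<in> null_sets \<mu>" by (rule null_outside_support[OF ahlD(4)])
        ultimately have "emeasure \<mu> W \<le> emeasure \<mu> (N \<union> (- measure_support \<mu>))"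
          using N(1) by (intro emeasure_mono) auto
        also have "\<dots> = emeasure \<mu> N" by (rule emeasure_Un_null_set[OF N(1) null])
        also note N(3)
        also have "marking_const C \<alpha> n * (c2 * (P * (\<epsilon> / \<rho>)) powr \<gamma>) = c1 * (\<delta> / \<rho>) powr \<gamma>"
        proof -
          have "P * (\<epsilon> / \<rho>) = (P * \<kappa>) * (\<delta> / \<rho>)" by (simp add: \<epsilon>_def)
          then have "(P * (\<epsilon> / \<rho>)) powr \<gamma> = (P * \<kappa>) powr \<gamma> * (\<delta> / \<rho>) powr \<gamma>"
            by (simp only: powr_mult)
          then show ?thesis by (simp add: c1_def mult.assoc)
        qed
        also have "ennreal (c1 * (\<delta> / \<rho>) powr \<gamma> * r powr \<alpha>) \<le> ennreal (c3 * (\<delta> / \<rho>) powr \<gamma> * r powr \<alpha>)"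
          using ahlD(1) by (intro ennreal_leI mult_right_mono) (auto simp: c3_def)
        finally show ?thesis .
      next
        case False
        have "cball x r \<subseteq> ball x (2 * r)" using r0 by auto
        then have "W \<subseteq> ball x (2 * r)" using WJ closure_subset[of J] clJ by blast
        then have "emeasure \<mu> W \<le> emeasure \<mu> (ball x (2 * r))"
          using ahlD(4) by (intro emeasure_mono) auto
        also have "\<dots> \<le> ennreal (C * (2 * r) powr \<alpha>)"
        proof (rule ahlD(6)[OF x(2)])
          have "2 * r \<le> 8 * 5 ^ n * (2 * \<eta>)"
          proof -
            have "2 * r \<le> 8 * (1 * (2 * \<eta>))" using r2 \<eta> by simp
            also have "\<dots> \<le> 8 * (5 ^ n * (2 * \<eta>))" using pow5 \<eta> by (intro mult_left_mono mult_right_mono) auto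
            finally show ?thesis by simp
          qed
          then show "2 * r \<le> \<rho>0" using \<eta>b by linarith
        qed (use r0 in simp)
        also have "\<dots> \<le> ennreal (c3 * (\<delta> / \<rho>) powr \<gamma> * r powr \<alpha>)"
        proof (rule ennreal_leI)
          have "1 \<le> \<kappa> * (\<delta> / \<rho>)" using False \<rho>(1) by (simp add: \<epsilon>_def field_simps)
          then have "1 \<le> (\<kappa> * (\<delta> / \<rho>)) powr \<gamma>" using \<gamma> by (intro ge_one_powr_ge_zero) auto
          also have "\<dots> = \<kappa> powr \<gamma> * (\<delta> / \<rho>) powr \<gamma>" by (rule split) (use \<delta> \<rho>(1) in simp)
          finally have "C * 2 powr \<alpha> * 1 * r powr \<alpha>
              \<le> C * 2 powr \<alpha> * (\<kappa> powr \<gamma> * (\<delta> / \<rho>) powr \<gamma>) * r powr \<alpha>"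
            using ahlD(1) by (intro mult_right_mono mult_left_mono) auto
          also have "\<dots> = (C * 2 powr \<alpha> * \<kappa> powr \<gamma>) * (\<delta> / \<rho>) powr \<gamma> * r powr \<alpha>" by simp
          also have "\<dots> \<le> c3 * (\<delta> / \<rho>) powr \<gamma> * r powr \<alpha>"
            using c1 by (intro mult_right_mono) (auto simp: c3_def)
          finally show "C * (2 * r) powr \<alpha> \<le> c3 * (\<delta> / \<rho>) powr \<gamma> * r powr \<alpha>"
            using r0 by (simp add: powr_mult)
        qed
        finally show ?thesis .
      qed
      also have "\<dots> = ennreal (c3 * (\<delta> / \<rho>) powr \<gamma>) * ennreal (r powr \<alpha>)"
        using c3 by (intro ennreal_mult) auto
      also have "\<dots> \<le> ennreal (c3 * (\<delta> / \<rho>) powr \<gamma>) * (ennreal C * emeasure \<mu> (dilate 3 J))"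
        using rC by (intro mult_left_mono) (auto simp: r_def)
      also have "\<dots> = (ennreal C * ennreal (c3 * (\<delta> / \<rho>) powr \<gamma>)) * emeasure \<mu> (dilate 3 J)"
        by (simp only: mult.assoc mult.commute mult.left_commute)
      also have "ennreal C * ennreal (c3 * (\<delta> / \<rho>) powr \<gamma>) = ennreal (C * c3 * (\<delta> / \<rho>) powr \<gamma>)"
        using c3 ahlD(1) by (subst ennreal_mult[symmetric]) (auto simp: mult.assoc)
      finally show ?thesis .
    qed
    then show ?thesis by (simp only: W_def)
  qed
  have "cball x0 \<eta> \<subseteq> D" unfolding D_def using \<eta>c(3) by (rule subset_cball)
  then have cont: "continuous_on (cball x0 \<eta>) (\<lambda>y. vol (gzu n \<phi> \<tau> y * A))"
    if "\<tau> \<in> carrier_vec (n + 1)" "A \<in> sublattices n" for \<tau> A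
    using vol_cont[OF that] continuous_on_subset by blast
  have "C * c3 > 0" using c3 ahlD(1) by simp
  from that[OF \<eta> \<gamma> this \<eta>c(1) cont main] show thesis by blast
qed

text \<open>Translates volumes of matrices into norms of wedge products: the list of vectors is the
  list of columns.\<close>

lemma ext_norm_act_wedge_cols:
  assumes L: "L \<in> carrier_mat m m" and A: "A \<in> carrier_mat m i"
  shows "ext_norm m i (act_wedge m L (cols A)) = vol (L * A)"
proof -
  have "mat_of_cols m (map (\<lambda>v. L *\<^sub>v v) (cols A)) = L * A"
    using L A by (intro eq_matI) (auto simp: mat_of_cols_def)
  moreover have "length (cols A) = i" using A by simp
  moreover have "L * A \<in> carrier_mat m i" using L A by simp
  ultimately show ?thesis using L
    by (simp add: ext_norm_def act_wedge_def wedge_def vol_def row_minor_def)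
qed

lemma wedge_cols_nonzero:
  assumes A: "A \<in> carrier_mat m i" and "vol A \<noteq> 0"
  shows "wedge m (cols A) \<noteq> (\<lambda>_. 0)"
proof -
  obtain S where "S \<in> ext_index m i" "row_minor A S \<noteq> 0"
    using assms(2) vol_eq_0_iff[OF A] by auto
  moreover have "mat_of_cols m (cols A) = A" using A by auto
  moreover have "length (cols A) = i" using A by simp
  ultimately have "wedge m (cols A) S \<noteq> 0" by (simp add: wedge_def row_minor_def)
  then show ?thesis by (auto simp: fun_eq_iff)
qed

lemma cols_int_lattice:
  assumes "A \<in> carrier_mat m i" "int_mat A"
  shows "set (cols A) \<subseteq> int_lattice m"
  using assms by (auto simp: cols_def int_lattice_def int_mat_def)

theorem theorem2p4:
  fixes \<mu> :: "real measure" and C \<alpha> \<rho>\<^sub>0 x\<^sub>0 :: real and U :: "real set"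
    and n :: nat and \<phi> :: "real \<Rightarrow> real vec"
  assumes "ahlfors_regular C \<alpha> \<rho>\<^sub>0 \<mu>"
    and "open U" and "is_interval U" and "U \<inter> measure_support \<mu> \<noteq> {}"
    and "n \<ge> 1" and "analytic_map n \<phi> U" and "nondegenerate n \<phi> U"
    and "x\<^sub>0 \<in> measure_support \<mu> \<inter> U"
  shows "\<exists>V. open V \<and> x\<^sub>0 \<in> V \<and>
    (\<forall>I\<^sub>0 r. r > 0 \<and> I\<^sub>0 = {x\<^sub>0 - r..x\<^sub>0 + r} \<and> I\<^sub>0 \<subseteq> U \<and> I\<^sub>0 \<subseteq> V \<and>
        dilate (3 ^ (n + 1)) I\<^sub>0 \<subseteq> U \<and> 3 * diameter I\<^sub>0 \<le> \<rho>\<^sub>0 \<and>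
        (\<forall>x\<in>dilate (3 ^ (n + 1)) I\<^sub>0. \<phi> x $ 0 = x) \<longrightarrow>
      (\<exists>M\<^sub>1>0. \<exists>\<gamma>>0. \<forall>\<delta>>0. \<forall>\<tau>\<in>carrier_vec (n + 1). (\<Sum>k<n + 1. \<tau> $ k) = 0 \<longrightarrow>
        (\<forall>\<rho>. 0 \<le> \<rho> \<and> \<rho> \<le> 1 \<longrightarrow>
          (\<forall>J. is_interval J \<and> J \<noteq> {} \<and> J \<subseteq> I\<^sub>0 \<longrightarrow>
            emeasure \<mu> (W_set n \<phi> \<tau> J \<delta>)
              \<le> ennreal M\<^sub>1 * ratio_powr \<delta> \<rho> \<gamma> * emeasure \<mu> (dilate 3 J)
            \<or> (\<exists>i vs. 1 \<le> i \<and> i \<le> n \<and> length vs = i \<and> set vs \<subseteq> int_lattice (n + 1) \<and>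
                 wedge (n + 1) vs \<noteq> (\<lambda>_. 0) \<and>
                 (SUP x\<in>J. ext_norm (n + 1) i (act_wedge (n + 1) (gzu n \<phi> \<tau> x) vs)) < \<rho>)))))"
proof -
  note ahl = assms(1) and n = assms(5) and \<phi> = assms(6)
  have x0: "x\<^sub>0 \<in> U" using assms(8) by blast
  show ?thesis
  proof (rule nondivergence_near_point[OF ahl assms(2) x0 n \<phi>])
    fix \<eta> \<gamma> M :: real
    assume \<eta>: "\<eta> > 0" and \<gamma>: "\<gamma> > 0" and M: "M > 0" and \<eta>2: "2 * \<eta> \<le> \<rho>\<^sub>0"
      and cont: "\<And>\<tau> A. \<tau> \<in> carrier_vec (n + 1) \<Longrightarrow> A \<in> sublattices n \<Longrightarrow>
         continuous_on (cball x\<^sub>0 \<eta>) (\<lambda>y. vol (gzu n \<phi> \<tau> y * A))"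
      and main: "\<And>\<delta> \<tau> \<rho> J. \<lbrakk>\<delta> > 0; \<tau> \<in> carrier_vec (n + 1); (\<Sum>k<n + 1. \<tau> $ k) = 0; 0 < \<rho>; \<rho> \<le> 1;
         is_interval J; J \<noteq> {}; J \<subseteq> ball x\<^sub>0 \<eta>;
         \<And>A. A \<in> sublattices n \<Longrightarrow> \<exists>y\<in>closure J. \<rho> \<le> vol (gzu n \<phi> \<tau> y * A)\<rbrakk> \<Longrightarrow>
         emeasure \<mu> (W_set n \<phi> \<tau> J \<delta>) \<le> ennreal (M * (\<delta> / \<rho>) powr \<gamma>) * emeasure \<mu> (dilate 3 J)"
    have "emeasure \<mu> (W_set n \<phi> \<tau> J \<delta>) \<le> ennreal M * ratio_powr \<delta> \<rho> \<gamma> * emeasure \<mu> (dilate 3 J)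
        \<or> (\<exists>i vs. 1 \<le> i \<and> i \<le> n \<and> length vs = i \<and> set vs \<subseteq> int_lattice (n + 1) \<and>
             wedge (n + 1) vs \<noteq> (\<lambda>_. 0) \<and>
             (SUP x\<in>J. ext_norm (n + 1) i (act_wedge (n + 1) (gzu n \<phi> \<tau> x) vs)) < \<rho>)"
      if \<delta>: "\<delta> > 0" and \<tau>: "\<tau> \<in> carrier_vec (n + 1)" "(\<Sum>k<n + 1. \<tau> $ k) = 0"
        and \<rho>: "0 \<le> \<rho>" "\<rho> \<le> 1" and J: "is_interval J" "J \<noteq> {}" "J \<subseteq> ball x\<^sub>0 \<eta>" "J \<subseteq> U"
      for \<delta> \<tau> \<rho> J
    proof (cases "\<rho> = 0")
      case True
      have bdd: "bounded J" using J(3) bounded_subset by blast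
      have "x\<^sub>0 - \<eta> \<le> Inf J" using J(2,3) by (intro cInf_greatest) (auto simp: dist_real_def subset_iff)
      moreover have "Sup J \<le> x\<^sub>0 + \<eta>" using J(2,3) by (intro cSup_least) (auto simp: dist_real_def subset_iff)
      ultimately have len: "Sup J - Inf J \<le> \<rho>\<^sub>0" using \<eta>2 by linarith
      have "emeasure \<mu> (W_set n \<phi> \<tau> J \<delta>) \<le> ennreal M * ratio_powr \<delta> \<rho> \<gamma> * emeasure \<mu> (dilate 3 J)"
      proof (rule interval_dichotomy[OF ahl J(1) bdd J(2) len])
        assume "emeasure \<mu> J = 0"
        moreover have "emeasure \<mu> (W_set n \<phi> \<tau> J \<delta>) \<le> emeasure \<mu> J"
          using bounded_interval_borel(1)[OF J(1) bdd] ahlfors_regularD(4)[OF ahl]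
          by (intro emeasure_mono) (auto simp: W_set_def)
        ultimately show ?thesis by simp
      next
        fix x
        assume "0 < Sup J - Inf J"
          "ennreal ((Sup J - Inf J) powr \<alpha>) \<le> ennreal C * emeasure \<mu> (dilate 3 J)"
        \<comment> \<open>For \<open>\<rho> = 0\<close> the factor \<open>ratio_powr\<close> is
          infinite, so a positive measure of the dilate makes the right-hand side infinite.\<close>
        then have "emeasure \<mu> (dilate 3 J) \<noteq> 0" by auto
        then have "ennreal M * ratio_powr \<delta> \<rho> \<gamma> * emeasure \<mu> (dilate 3 J) = \<infinity>"
          using True M by (simp add: ratio_powr_def ennreal_mult_top ennreal_top_mult)
        then show ?thesis by simp
      qed
      then show ?thesis ..
    next
      case False
      then have \<rho>0: "\<rho> > 0" using \<rho>(1) by simp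
      show ?thesis
      \<comment> \<open>If no wedge product is small on all of \<open>J\<close>, this applies to the
        columns of every matrix in \<open>sublattices n\<close>, which is the hypothesis of the
        local estimate.\<close>
      proof (rule disjCI)
        assume no: "\<not> (\<exists>i vs. 1 \<le> i \<and> i \<le> n \<and> length vs = i \<and> set vs \<subseteq> int_lattice (n + 1) \<and>
             wedge (n + 1) vs \<noteq> (\<lambda>_. 0) \<and>
             (SUP x\<in>J. ext_norm (n + 1) i (act_wedge (n + 1) (gzu n \<phi> \<tau> x) vs)) < \<rho>)"
        have "\<exists>y\<in>closure J. \<rho> \<le> vol (gzu n \<phi> \<tau> y * A)" if A: "A \<in> sublattices n" for A
        proof -
          obtain i where i: "1 \<le> i" "i \<le> n" "A \<in> carrier_mat (n + 1) i" "int_mat A" "vol A \<noteq> 0"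
            using A by (auto simp: sublattices_def)
          have "(SUP x\<in>J. ext_norm (n + 1) i (act_wedge (n + 1) (gzu n \<phi> \<tau> x) (cols A)))
              = (SUP x\<in>J. vol (gzu n \<phi> \<tau> x * A))"
          proof (rule SUP_cong)
            fix x assume "x \<in> J"
            then have "\<phi> x \<in> carrier_vec n" using J(4) \<phi> by (auto simp: analytic_map_def)
            from ext_norm_act_wedge_cols[OF gzu_carrier[of n \<phi> x \<tau>, OF n this \<tau>(1)] i(3)]
            show "ext_norm (n + 1) i (act_wedge (n + 1) (gzu n \<phi> \<tau> x) (cols A))
                = vol (gzu n \<phi> \<tau> x * A)" .
          qed simp
          moreover have "\<not> (SUP x\<in>J. ext_norm (n + 1) i (act_wedge (n + 1) (gzu n \<phi> \<tau> x) (cols A))) < \<rho>"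
          proof
            assume "(SUP x\<in>J. ext_norm (n + 1) i (act_wedge (n + 1) (gzu n \<phi> \<tau> x) (cols A))) < \<rho>"
            moreover have "length (cols A) = i" using i(3) by simp
            ultimately show False
              using no i(1,2) cols_int_lattice[OF i(3,4)] wedge_cols_nonzero[OF i(3,5)] by blast
          qed
          ultimately have sup: "\<rho> \<le> (SUP x\<in>J. vol (gzu n \<phi> \<tau> x * A))" by simp
          have clJ: "closure J \<subseteq> cball x\<^sub>0 \<eta>"
            using J(3) ball_subset_cball by (intro closure_minimal) auto
          then have "compact (closure J)" using bounded_cball bounded_subset by (auto simp: compact_eq_bounded_closed)
          moreover have "closure J \<noteq> {}" using J(2) by simp
          moreover have "continuous_on (closure J) (\<lambda>y. vol (gzu n \<phi> \<tau> y * A))"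
            using cont[OF \<tau>(1) A] clJ continuous_on_subset by blast
          ultimately obtain y where y: "y \<in> closure J"
            "\<And>x. x \<in> closure J \<Longrightarrow> vol (gzu n \<phi> \<tau> x * A) \<le> vol (gzu n \<phi> \<tau> y * A)"
            using continuous_attains_sup[of "closure J" "\<lambda>y. vol (gzu n \<phi> \<tau> y * A)"] by blast
          \<comment> \<open>The continuous covolume has a maximum on the compact closure, which
            dominates the supremum over \<open>J\<close> and hence reaches
            \<open>\<rho>\<close>.\<close>
          have "(SUP x\<in>J. vol (gzu n \<phi> \<tau> x * A)) \<le> vol (gzu n \<phi> \<tau> y * A)"
            using J(2) y(2) closure_subset by (intro cSUP_least) blast+
          then show ?thesis using sup y(1) by (intro bexI[of _ y]) linarith+
        qed
        from main[OF \<delta> \<tau> \<rho>0 \<rho>(2) J(1-3) this]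
        show "emeasure \<mu> (W_set n \<phi> \<tau> J \<delta>) \<le> ennreal M * ratio_powr \<delta> \<rho> \<gamma> * emeasure \<mu> (dilate 3 J)"
          using M False by (simp add: ratio_powr_def ennreal_mult')
      qed
    qed
    note dichotomy = this
    show ?thesis
    \<comment> \<open>The constants \<open>M\<close> and \<open>\<gamma>\<close> belong to the ball
      and serve every interval inside it.\<close>
    proof (intro exI[of _ "ball x\<^sub>0 \<eta>"] conjI allI impI)
      fix I\<^sub>0 r
      assume I\<^sub>0: "r > 0 \<and> I\<^sub>0 = {x\<^sub>0 - r..x\<^sub>0 + r} \<and> I\<^sub>0 \<subseteq> U \<and> I\<^sub>0 \<subseteq> ball x\<^sub>0 \<eta> \<and>
        dilate (3 ^ (n + 1)) I\<^sub>0 \<subseteq> U \<and> 3 * diameter I\<^sub>0 \<le> \<rho>\<^sub>0 \<and>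
        (\<forall>x\<in>dilate (3 ^ (n + 1)) I\<^sub>0. \<phi> x $ 0 = x)"
      then have sub: "I\<^sub>0 \<subseteq> ball x\<^sub>0 \<eta>" "I\<^sub>0 \<subseteq> U" by blast+
      show "\<exists>M\<^sub>1>0. \<exists>\<gamma>>0. \<forall>\<delta>>0. \<forall>\<tau>\<in>carrier_vec (n + 1). (\<Sum>k<n + 1. \<tau> $ k) = 0 \<longrightarrow>
        (\<forall>\<rho>. 0 \<le> \<rho> \<and> \<rho> \<le> 1 \<longrightarrow>
          (\<forall>J. is_interval J \<and> J \<noteq> {} \<and> J \<subseteq> I\<^sub>0 \<longrightarrow>
            emeasure \<mu> (W_set n \<phi> \<tau> J \<delta>)
              \<le> ennreal M\<^sub>1 * ratio_powr \<delta> \<rho> \<gamma> * emeasure \<mu> (dilate 3 J)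
            \<or> (\<exists>i vs. 1 \<le> i \<and> i \<le> n \<and> length vs = i \<and> set vs \<subseteq> int_lattice (n + 1) \<and>
                 wedge (n + 1) vs \<noteq> (\<lambda>_. 0) \<and>
                 (SUP x\<in>J. ext_norm (n + 1) i (act_wedge (n + 1) (gzu n \<phi> \<tau> x) vs)) < \<rho>)))"
      proof (rule exI[of _ M], rule conjI[OF M], rule exI[of _ \<gamma>], rule conjI[OF \<gamma>],
          intro allI impI ballI, elim conjE)
        fix \<delta> \<rho> :: real and \<tau> :: "real vec" and J
        assume "\<delta> > 0" "\<tau> \<in> carrier_vec (n + 1)" "(\<Sum>k<n + 1. \<tau> $ k) = 0" "0 \<le> \<rho>" "\<rho> \<le> 1"
          "is_interval J" "J \<noteq> {}" "J \<subseteq> I\<^sub>0"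
        then show "emeasure \<mu> (W_set n \<phi> \<tau> J \<delta>)
              \<le> ennreal M * ratio_powr \<delta> \<rho> \<gamma> * emeasure \<mu> (dilate 3 J)
            \<or> (\<exists>i vs. 1 \<le> i \<and> i \<le> n \<and> length vs = i \<and> set vs \<subseteq> int_lattice (n + 1) \<and>
                 wedge (n + 1) vs \<noteq> (\<lambda>_. 0) \<and>
                 (SUP x\<in>J. ext_norm (n + 1) i (act_wedge (n + 1) (gzu n \<phi> \<tau> x) vs)) < \<rho>)"
          using sub by (intro dichotomy) auto
      qed
    qed (use \<eta> in simp_all)
  qed
qed

end
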